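(* Let $m,n\in\mathbb{N}^+$ with $m\geq n$. For a generic $f\in C([0,1]^m,\mathbb{R}^n)$, for all $y\in\operatorname{int}f([0,1]^m)$ we have \[\dim_T f^{-1}(y)=\dim_H f^{-1}(y)=m-n\quad\text{and}\quad\dim_P f^{-1}(y)=m.\]
   Context: $\dim_T$, $\dim_H$, $\dim_P$ denote the topological (small inductive), Hausdorff and packing dimensions. $C([0,1]^m,\mathbb{R}^n)$ is the complete metric space of continuous maps $[0,1]^m\to\mathbb{R}^n$ with the maximum norm. A property holds for a generic $f$ in this space if the set of $f$ having it is co-meager. $\operatorname{int}$ denotes interior in $\mathbb{R}^n$. *)

theory Defs
  imports "HOL-Analysis.Analysis"
begin

section \<open>Baire category\<close>

definition nowhere_dense_in :: "'a topology \<Rightarrow> 'a set \<Rightarrow> bool" where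
  "nowhere_dense_in X S \<longleftrightarrow> S \<subseteq> topspace X \<and> X interior_of (X closure_of S) = {}"

definition meager_in :: "'a topology \<Rightarrow> 'a set \<Rightarrow> bool" where
  "meager_in X S \<longleftrightarrow> (\<exists>\<G>. countable \<G> \<and> (\<forall>T\<in>\<G>. nowhere_dense_in X T) \<and> S = \<Union>\<G>)"

definition comeager_in :: "'a topology \<Rightarrow> 'a set \<Rightarrow> bool" where
  "comeager_in X S \<longleftrightarrow> S \<subseteq> topspace X \<and> meager_in X (topspace X - S)"


section \<open>Small inductive dimension\<close>

text \<open>The relation \<open>dim_le\<close> is the library's small inductive dimension bound. The value is
  \<open>-1\<close> for the empty space and \<open>\<infinity>\<close> if there is no finite bound.\<close>

definition top_dim :: "'a topology \<Rightarrow> ereal" where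
  "top_dim X = (INF k\<in>{k::int. X dim_le k}. ereal (real_of_int k))"


section \<open>Hausdorff dimension\<close>

text \<open>The \<open>s\<close>-th power of the diameter, with the usual conventions that it is \<open>0\<close> for the empty
  set and that \<open>0\<close> to the power \<open>0\<close> is \<open>1\<close> for nonempty sets (whereas \<open>0 powr 0 = 0\<close>).\<close>

definition diam_pow :: "real \<Rightarrow> 'a::metric_space set \<Rightarrow> ennreal" where
  "diam_pow s U = (if U = {} then 0 else if s = 0 then 1 else ennreal (diameter U powr s))"

text \<open>Boundedness is demanded because \<open>diameter\<close> is only meaningful for bounded sets.\<close>

definition hausdorff_premeasure :: "real \<Rightarrow> real \<Rightarrow> 'a::metric_space set \<Rightarrow> ennreal" where
  "hausdorff_premeasure s \<delta> A =
     (INF U\<in>{U :: nat \<Rightarrow> 'a set. A \<subseteq> (\<Union>i. U i) \<and> (\<forall>i. bounded (U i) \<and> diameter (U i) \<le> \<delta>)}.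
        \<Sum>i. diam_pow s (U i))"

definition hausdorff_measure :: "real \<Rightarrow> 'a::metric_space set \<Rightarrow> ennreal" where
  "hausdorff_measure s A = (SUP \<delta>\<in>{0<..}. hausdorff_premeasure s \<delta> A)"

definition hausdorff_dim :: "'a::metric_space set \<Rightarrow> ereal" where
  "hausdorff_dim A = (INF s\<in>{s. 0 \<le> s \<and> hausdorff_measure s A = 0}. ereal s)"


section \<open>Packing dimension\<close>

text \<open>A packing is a finite or countable family of pairwise disjoint closed balls centred in \<open>A\<close>;
  it is encoded by the set of (centre, radius) pairs. In a Euclidean space a ball of radius
  \<open>r\<close> has diameter \<open>2 * r\<close>.\<close>

definition packings :: "real \<Rightarrow> 'a::euclidean_space set \<Rightarrow> ('a \<times> real) set set" where
  "packings \<delta> A =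
     {P. countable P \<and> (\<forall>(x, r)\<in>P. x \<in> A \<and> 0 < r \<and> 2 * r \<le> \<delta>) \<and>
         disjoint_family_on (\<lambda>(x, r). cball x r) P}"

definition packing_premeasure :: "real \<Rightarrow> 'a::euclidean_space set \<Rightarrow> ennreal" where
  "packing_premeasure s A =
     (INF \<delta>\<in>{0<..}. SUP P\<in>packings \<delta> A. \<Sum>\<^sub>\<infinity>(x, r)\<in>P. ennreal ((2 * r) powr s))"

text \<open>The premeasure is not countably subadditive; the packing measure is obtained from it
  through countable covers.\<close>

definition packing_measure :: "real \<Rightarrow> 'a::euclidean_space set \<Rightarrow> ennreal" where
  "packing_measure s A =
     (INF B\<in>{B :: nat \<Rightarrow> 'a set. A \<subseteq> (\<Union>i. B i)}. \<Sum>i. packing_premeasure s (B i))"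

definition packing_dim :: "'a::euclidean_space set \<Rightarrow> ereal" where
  "packing_dim A = (INF s\<in>{s. 0 \<le> s \<and> packing_measure s A = 0}. ereal s)"


section \<open>Continuous maps on the cube\<close>

abbreviation unit_cube :: "(real ^ 'm) set" where
  "unit_cube \<equiv> cbox 0 1"

text \<open>Elements of this metric space are extensional, i.e. \<open>undefined\<close> off the cube; the metric is
  the supremum of the Euclidean distances of the values.\<close>

definition cube_maps :: "(real ^ 'm \<Rightarrow> real ^ 'n) metric" where
  "cube_maps = cfunspace (top_of_set unit_cube) euclidean_metric"

end

theory Submission
  imports Defs
begin

text \<open>Three properties are shared by a comeager set of maps \<open>f\<close>.

  First, \<open>f\<close> lies in the interior of every set of maps whose image contains a given rational ball, as
  soon as it lies in that set; so each \<open>y\<close> in the interior of the image is a stable value, attained by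
  all maps near \<open>f\<close>.

  Secondly, \<open>f\<close> is infinitely often a tiny perturbation of some \<open>g - \<delta> cos (\<pi> x / h)\<close> with \<open>h\<close> much
  smaller than \<open>\<delta>\<close>. A stable \<open>y\<close> is a value of \<open>g\<close>, and near each point where \<open>g\<close> takes it there are
  about \<open>h\<close> to the power \<open>-m\<close> disjoint cubes of side \<open>h\<close> on which the components of \<open>f - y\<close>
  change sign between \<open>n\<close> pairs of opposite faces. In such a cube the Poincare-Miranda theorem together
  with the separation theory of dimension shows that the fiber has topological dimension at least
  \<open>m - n\<close>. Moreover \<open>y\<close> is again stable on each cube, so the construction can be iterated; the points
  at which \<open>y\<close> is stable in every neighbourhood form a closed subset of the fiber that has full box
  dimension in each of its open parts, and a Baire argument yields packing dimension \<open>m\<close>.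

  Thirdly, maps whose components are max-min combinations of affine functions in general position are
  dense and have fibers contained in finitely many \<open>(m - n)\<close>-dimensional affine pieces. Covers of
  these fibers by small balls survive perturbations, so the fibers of \<open>f\<close> have Hausdorff dimension at
  most \<open>m - n\<close>. Szpilrajn's inequality (topological dimension is at most Hausdorff dimension)
  combines this with the lower bound for the topological dimension.\<close>

section \<open>Partitions and small inductive dimension\<close>

text \<open>A bound through countably many compact pieces is inherited in an induction on dimension:
  what a suitable partition leaves of \<open>X\<close> is covered by the frontiers of countably many
  basic sets, which are again compact and one dimension lower.\<close>

definition countably_covered_dim_le :: "'a::euclidean_space set \<Rightarrow> int \<Rightarrow> bool" where
  "countably_covered_dim_le X k \<longleftrightarrow>
     (\<exists>\<C>. countable \<C> \<and> (\<forall>C\<in>\<C>. compact C \<and> top_of_set C dim_le k) \<and> X \<subseteq> \<Union>\<C>)"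

text \<open>For each \<open>n\<close>, compactness selects finitely many small sets with
  low-dimensional frontiers, each inside a ball of radius \<open>1 / Suc n\<close>; together they
  form a countable base. Since \<open>C\<close> is closed and \<open>U\<close> relatively open, the
  frontier of \<open>U\<close> in \<open>C\<close> is \<open>closure U - U\<close>.\<close>

lemma compact_dim_le_countable_base:
  fixes C :: "'a::euclidean_space set"
  assumes "compact C" "top_of_set C dim_le k"
  obtains \<B> where "countable \<B>"
    "\<And>U. U \<in> \<B> \<Longrightarrow> openin (top_of_set C) U \<and> top_of_set (closure U - U) dim_le (k - 1)"
    "\<And>x e. x \<in> C \<Longrightarrow> 0 < e \<Longrightarrow> \<exists>U\<in>\<B>. x \<in> U \<and> U \<subseteq> ball x e"
proof -
  have *: "\<exists>U. x \<in> U \<and> U \<subseteq> ball x e \<and> openin (top_of_set C) U \<and> top_of_set (closure U - U) dim_le (k - 1)"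
    if "x \<in> C" "0 < e" for x e
  proof -
    have "openin (top_of_set C) (C \<inter> ball x e)" "x \<in> C \<inter> ball x e"
      using that by (auto simp: openin_open_Int)
    then obtain U where U: "x \<in> U" "U \<subseteq> C \<inter> ball x e" "openin (top_of_set C) U"
      and dim: "subtopology (top_of_set C) (top_of_set C frontier_of U) dim_le (k - 1)"
      using assms(2) unfolding dimension_le.simps[of "top_of_set C"] by meson
    have "closure U \<subseteq> C"
      by (metis U(2) assms(1) closure_minimal compact_imp_closed le_inf_iff)
    then have "top_of_set C frontier_of U = closure U - U"
      using U by (simp add: frontier_of_openin closure_of_subtopology) (metis Int_absorb1 Int_absorb2 le_inf_iff)
    with dim have "top_of_set (closure U - U) dim_le (k - 1)"
      using \<open>closure U \<subseteq> C\<close> by (metis Diff_subset inf.absorb2 subset_trans subtopology_subtopology)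
    with U show ?thesis by auto
  qed
  have "\<exists>\<D>. finite \<D> \<and> C \<subseteq> \<Union>\<D> \<and> (\<forall>U\<in>\<D>. (\<exists>x. U \<subseteq> ball x (1 / Suc n)) \<and>
          openin (top_of_set C) U \<and> top_of_set (closure U - U) dim_le (k - 1))" for n :: nat
  proof -
    let ?P = "\<lambda>U. (\<exists>x. U \<subseteq> ball x (1 / Suc n)) \<and>
          openin (top_of_set C) U \<and> top_of_set (closure U - U) dim_le (k - 1)"
    have "C \<subseteq> \<Union>{U. ?P U}"
    proof
      fix x assume "x \<in> C"
      then show "x \<in> \<Union>{U. ?P U}"
        using *[of x "1 / Suc n"] by auto
    qed
    then obtain \<D> where "\<D> \<subseteq> {U. ?P U}" "finite \<D>" "C \<subseteq> \<Union>\<D>"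
      using assms(1)[unfolded compact_eq_openin_cover, rule_format, of "{U. ?P U}"] by auto
    then show ?thesis by (intro exI[of _ \<D>]) blast
  qed
  then obtain \<D> where \<D>: "\<And>n::nat. finite (\<D> n) \<and> C \<subseteq> \<Union>(\<D> n) \<and> (\<forall>U\<in>\<D> n. (\<exists>x. U \<subseteq> ball x (1 / Suc n)) \<and>
          openin (top_of_set C) U \<and> top_of_set (closure U - U) dim_le (k - 1))"
    by metis
  show thesis
  proof
    show "countable (\<Union>n. \<D> n)"
      using \<D> by (auto intro: countable_finite)
    fix x :: 'a and e :: real assume x: "x \<in> C" "0 < e"
    then obtain n where n: "1 / real (Suc n) < e / 2"
      by (metis half_gt_zero nat_approx_posE)
    obtain U y where U: "U \<in> \<D> n" "x \<in> U" "U \<subseteq> ball y (1 / Suc n)"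
      using \<D> x by (meson UnionE subsetD)
    have "U \<subseteq> ball x e"
    proof
      fix z assume "z \<in> U"
      then have "dist y z < 1 / Suc n" "dist y x < 1 / Suc n" using U by auto
      then have "dist x z < e"
        using n dist_triangle[of x z y] by (simp add: dist_commute)
      then show "z \<in> ball x e" by simp
    qed
    then show "\<exists>U\<in>(\<Union>n. \<D> n). x \<in> U \<and> U \<subseteq> ball x e" using U by auto
  qed (use \<D> in auto)
qed

text \<open>A Lindelof-type disjointification: a countable clopen base makes the small inductive
  dimension \<open>0\<close> of a separable space agree with the large one.\<close>

lemma clopen_separation:
  fixes M :: "'a::euclidean_space set"
  assumes "countable \<B>" and clopen: "\<And>U. U \<in> \<B> \<Longrightarrow> openin (top_of_set M) U \<and> closedin (top_of_set M) U"
    and base: "\<And>x e. x \<in> M \<Longrightarrow> 0 < e \<Longrightarrow> \<exists>U\<in>\<B>. x \<in> U \<and> U \<subseteq> ball x e"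
    and D: "closedin (top_of_set M) D" and E: "closedin (top_of_set M) E" and DE: "D \<inter> E = {}"
  obtains Q where "openin (top_of_set M) Q" "closedin (top_of_set M) Q" "D \<subseteq> Q" "Q \<inter> E = {}"
proof -
  let ?\<G> = "{U\<in>\<B>. U \<inter> D = {} \<or> U \<inter> E = {}}"
  have cov: "\<exists>U\<in>?\<G>. x \<in> U" if "x \<in> M" for x
  proof -
    have "\<exists>e>0. ball x e \<inter> M \<inter> D = {} \<or> ball x e \<inter> M \<inter> E = {}"
    proof (cases "x \<in> D")
      case True
      then have "x \<in> M - E" using that DE by auto
      moreover have "openin (top_of_set M) (M - E)" using E by (simp add: openin_diff)
      ultimately obtain e where "e > 0" "ball x e \<inter> M \<subseteq> M - E"
        by (meson openin_contains_ball)
      then show ?thesis by blast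
    next
      case False
      then have "x \<in> M - D" using that by auto
      moreover have "openin (top_of_set M) (M - D)" using D by (simp add: openin_diff)
      ultimately obtain e where "e > 0" "ball x e \<inter> M \<subseteq> M - D"
        by (meson openin_contains_ball)
      then show ?thesis by blast
    qed
    then obtain e where e: "e > 0" "ball x e \<inter> M \<inter> D = {} \<or> ball x e \<inter> M \<inter> E = {}" by blast
    obtain U where U: "U \<in> \<B>" "x \<in> U" "U \<subseteq> ball x e" using base \<open>x \<in> M\<close> e(1) by meson
    moreover have "U \<subseteq> M" using clopen U(1) openin_imp_subset by blast
    ultimately show ?thesis using e(2) by blast
  qed
  show thesis
  proof (cases "M = {}")
    case True
    show thesis
      by (rule that[of "{}"]) (use True D in \<open>auto dest: closedin_imp_subset\<close>)
  next
    case False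
    then have ne: "?\<G> \<noteq> {}" using cov by blast
    have "countable ?\<G>" using assms(1) by auto
    define W where "W = from_nat_into ?\<G>"
    have W: "range W = ?\<G>" unfolding W_def by (rule range_from_nat_into[OF ne \<open>countable ?\<G>\<close>])
    have Wco: "openin (top_of_set M) (W i)" "closedin (top_of_set M) (W i)" for i
      using clopen W by blast+
    \<comment> \<open>Only finitely many clopen predecessors are removed from \<open>W i\<close>, so
      the pieces stay open; they partition \<open>M\<close>.\<close>
    have Op: "openin (top_of_set M) (disjointed W i)" for i
      unfolding disjointed_def
      by (intro openin_diff closedin_Union Wco) (use Wco in auto)
    \<comment> \<open>Every \<open>W i\<close> misses \<open>D\<close> or \<open>E\<close>, so the
      ones that meet \<open>D\<close> miss \<open>E\<close>. The complement of \<open>Q\<close> is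
      the union of the remaining pieces, hence open as well.\<close>
    let ?I = "{i. W i \<inter> D \<noteq> {}}"
    define Q where "Q = (\<Union>i\<in>?I. disjointed W i)"
    have UN: "(\<Union>i. disjointed W i) = M"
    proof -
      have "(\<Union>i. W i) \<subseteq> M"
        using Wco(1) openin_imp_subset by blast
      moreover have "M \<subseteq> \<Union>(range W)" unfolding W using cov by (intro subsetI) (meson UnionI)
      ultimately have "(\<Union>i. W i) = M" by simp
      then show ?thesis by (simp add: UN_disjointed_eq)
    qed
    have comp: "M - Q = (\<Union>i\<in>-?I. disjointed W i)"
    proof -
      have dj: "disjointed W i \<inter> disjointed W j = {}" if "i \<noteq> j" for i j
        using disjoint_family_disjointed[of W] that by (auto simp: disjoint_family_on_def)
      have "disjointed W i \<inter> Q = {}" if i: "i \<notin> ?I" for i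
      proof (rule equals0I)
        fix x assume x: "x \<in> disjointed W i \<inter> Q"
        then obtain j where "j \<in> ?I" "x \<in> disjointed W j" unfolding Q_def by blast
        with x dj[of i j] i show False by blast
      qed
      moreover have "x \<in> Q" if "x \<in> disjointed W i" "i \<in> ?I" for x i
        unfolding Q_def using that by blast
      moreover have "disjointed W i \<subseteq> M" for i using UN by blast
      moreover have "\<exists>i. x \<in> disjointed W i" if "x \<in> M" for x using UN that by blast
      ultimately show ?thesis by fast
    qed
    have oQ: "openin (top_of_set M) Q" unfolding Q_def using Op by blast
    have "openin (top_of_set M) (M - Q)" unfolding comp using Op by blast
    then have cQ: "closedin (top_of_set M) Q"
      using openin_imp_subset[OF oQ] by (simp add: closedin_def)
    show thesis
    proof
      show "D \<subseteq> Q"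
      proof
        fix x assume "x \<in> D"
        then have "x \<in> M" using D closedin_imp_subset by blast
        then obtain i where "x \<in> disjointed W i" using UN by blast
        moreover from this have "x \<in> W i" using disjointed_subset[of W i] by blast
        ultimately show "x \<in> Q" unfolding Q_def using \<open>x \<in> D\<close> by blast
      qed
      have "W i \<inter> E = {}" if "i \<in> ?I" for i
      proof -
        have "W i \<in> ?\<G>" using W by auto
        then show ?thesis using that by auto
      qed
      then show "Q \<inter> E = {}"
        unfolding Q_def using disjointed_subset[of W] by fast
    qed (use oQ cQ in auto)
  qed
qed

text \<open>The countable sum theorem in dimension \<open>0\<close>, stated as the existence of a partition of the
  ambient space that avoids \<open>M\<close>.\<close>

lemma partition_avoiding_countable_union:
  fixes M :: "'a::euclidean_space set" and N :: "nat \<Rightarrow> 'a set"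
  assumes M: "M = (\<Union>i. N i)" and clo: "\<And>i. closedin (top_of_set M) (N i)"
    and sep: "\<And>i D E. closedin (top_of_set (N i)) D \<Longrightarrow> closedin (top_of_set (N i)) E \<Longrightarrow> D \<inter> E = {} \<Longrightarrow>
       \<exists>Q. openin (top_of_set (N i)) Q \<and> closedin (top_of_set (N i)) Q \<and> D \<subseteq> Q \<and> Q \<inter> E = {}"
    and A: "compact A" and B: "compact B" and AB: "A \<inter> B = {}"
  obtains U V where "open U" "open V" "U \<inter> V = {}" "A \<subseteq> U" "B \<subseteq> V" "M \<subseteq> U \<union> V"
proof -
  let ?T = "top_of_set M"
  have nrm: "normal_space ?T"
    by (intro metrizable_imp_normal_space metrizable_space_subtopology metrizable_space_euclidean)
  have cte: "euclidean closure_of S = closure S" for S :: "'a set" by simp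
  have norm2: "\<exists>P R. openin ?T P \<and> openin ?T R \<and> D \<subseteq> P \<and> E \<subseteq> R \<and> ?T closure_of P \<inter> ?T closure_of R = {}"
    if DE: "closedin ?T D" "closedin ?T E" "D \<inter> E = {}" for D E
  proof -
    obtain P where P: "openin ?T P" "D \<subseteq> P" "disjnt E (?T closure_of P)"
      using nrm[unfolded normal_space, rule_format, of D E] DE unfolding disjnt_def by blast
    obtain R where R: "openin ?T R" "E \<subseteq> R" "disjnt (?T closure_of P) (?T closure_of R)"
      using nrm DE(2) P(3) closedin_closure_of[of ?T P] unfolding normal_space by (metis disjnt_sym)
    then show ?thesis using P R by (auto simp: disjnt_def)
  qed
  have "\<exists>A0 B0. open A0 \<and> open B0 \<and> A \<subseteq> A0 \<and> B \<subseteq> B0 \<and> closure A0 \<inter> closure B0 = {}"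
  proof -
    have nE: "normal_space (euclidean :: 'a topology)"
      by (intro metrizable_imp_normal_space metrizable_space_euclidean)
    have cl: "closedin euclidean A" "closedin euclidean B"
      using A B compact_imp_closed by auto
    obtain P where P: "open P" "A \<subseteq> P" "disjnt B (closure P)"
      using nE cl AB unfolding normal_space disjnt_def
      by (metis cte open_openin)
    obtain R where R: "open R" "B \<subseteq> R" "disjnt (closure P) (closure R)"
      using nE cl(2) P(3) closed_closure[of P] unfolding normal_space disjnt_def
      by (metis cte open_openin closed_closedin)
    then show ?thesis using P by (auto simp: disjnt_def)
  qed
  then obtain A0 B0 where A0: "open A0" "open B0" "A \<subseteq> A0" "B \<subseteq> B0" "closure A0 \<inter> closure B0 = {}"
    by blast
  \<comment> \<open>Two relatively open sets with disjoint closures are enlarged step by step; the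
    \<open>n\<close>-th step distributes all of \<open>N n\<close> among them. They start from the
    traces of neighbourhoods of \<open>A\<close> and \<open>B\<close>.\<close>
  let ?inv = "\<lambda>PR. openin ?T (fst PR) \<and> openin ?T (snd PR) \<and> ?T closure_of (fst PR) \<inter> ?T closure_of (snd PR) = {}
     \<and> M \<inter> A0 \<subseteq> fst PR \<and> M \<inter> B0 \<subseteq> snd PR"
  have "\<exists>s. \<forall>n. ?inv (s n) \<and> (fst (s n) \<subseteq> fst (s (Suc n)) \<and> snd (s n) \<subseteq> snd (s (Suc n)) \<and> N n \<subseteq> fst (s (Suc n)) \<union> snd (s (Suc n)))"
  proof (rule dependent_nat_choice)
    have "?inv (M \<inter> A0, M \<inter> B0)"
    proof -
      have "?T closure_of (M \<inter> A0) \<subseteq> closure A0" "?T closure_of (M \<inter> B0) \<subseteq> closure B0"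
        by (auto simp: closure_of_subtopology intro: closure_mono[THEN subsetD])
      then show ?thesis using A0 by (auto simp: openin_open_Int)
    qed
    then show "\<exists>x. ?inv x" by blast
    fix x n assume x: "?inv x"
    define P R where "P = ?T closure_of (fst x)" and "R = ?T closure_of (snd x)"
    have PR: "closedin ?T P" "closedin ?T R" "P \<inter> R = {}" "fst x \<subseteq> P" "snd x \<subseteq> R"
      using x openin_subset[of ?T "fst x"] openin_subset[of ?T "snd x"]
      by (simp_all add: P_def R_def closure_of_subset)
    have sub: "N n \<subseteq> M" using M by auto
    have "closedin (top_of_set (N n)) (N n \<inter> P)" "closedin (top_of_set (N n)) (N n \<inter> R)"
      by (meson PR closedin_closed_subtopology closedin_subset_trans closedin_Int clo closedin_subset inf_le1 sub)+
    with sep[of n "N n \<inter> P" "N n \<inter> R"] PR obtain Q where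
      Q: "openin (top_of_set (N n)) Q" "closedin (top_of_set (N n)) Q" "N n \<inter> P \<subseteq> Q" "Q \<inter> (N n \<inter> R) = {}"
      by (auto simp: disjoint_iff)
    \<comment> \<open>The clopen set \<open>Q\<close> splits \<open>N n\<close> compatibly with
      \<open>P\<close> and \<open>R\<close>; both parts are closed in \<open>M\<close> because
      \<open>N n\<close> is, so normality can separate the enlarged pair.\<close>
    have "closedin (top_of_set (N n)) (N n - Q)"
      using Q(1) by (simp add: closedin_diff)
    then have cl: "closedin ?T (P \<union> Q)" "closedin ?T (R \<union> (N n - Q))"
      using PR Q clo closedin_trans by blast+
    have "Q \<subseteq> N n" using Q(1) openin_imp_subset by blast
    then have dj: "(P \<union> Q) \<inter> (R \<union> (N n - Q)) = {}"
      using Q PR by blast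
    obtain P' R' where "openin ?T P'" "openin ?T R'" "P \<union> Q \<subseteq> P'" "R \<union> (N n - Q) \<subseteq> R'"
      "?T closure_of P' \<inter> ?T closure_of R' = {}"
      using norm2[OF cl dj] by blast
    then show "\<exists>y. ?inv y \<and> fst x \<subseteq> fst y \<and> snd x \<subseteq> snd y \<and> N n \<subseteq> fst y \<union> snd y"
      using x PR by (intro exI[of _ "(P', R')"]) auto
  qed
  then obtain s where inv: "\<And>n. ?inv (s n)"
    and mono: "\<And>n. fst (s n) \<subseteq> fst (s (Suc n))" "\<And>n. snd (s n) \<subseteq> snd (s (Suc n))"
    and Ns: "\<And>n. N n \<subseteq> fst (s (Suc n)) \<union> snd (s (Suc n))" by metis
  define E F where "E = (\<Union>n. fst (s n))" and "F = (\<Union>n. snd (s n))"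
  have oE: "openin ?T E" "openin ?T F" unfolding E_def F_def using inv by auto
  have EF: "E \<inter> F = {}"
  proof -
    have "fst (s i) \<inter> snd (s j) = {}" for i j
    proof -
      have "fst (s i) \<subseteq> fst (s (max i j))" "snd (s j) \<subseteq> snd (s (max i j))"
        using lift_Suc_mono_le[of "\<lambda>n. fst (s n)"] lift_Suc_mono_le[of "\<lambda>n. snd (s n)"] mono
        by (metis max.cobounded1 max.cobounded2)+
      moreover have "fst (s k) \<inter> snd (s k) = {}" for k
        using inv[of k] openin_subset closure_of_subset[of _ ?T] by (metis (no_types, lifting) Int_mono subset_empty)
      ultimately show ?thesis by blast
    qed
    then show ?thesis unfolding E_def F_def by blast
  qed
  have cov: "E \<union> F = M"
  proof
    show "E \<union> F \<subseteq> M" using oE openin_imp_subset by blast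
    show "M \<subseteq> E \<union> F" unfolding M E_def F_def using Ns by blast
  qed
  have "M - E = F" "M - F = E" using EF cov by auto
  then have cE: "closedin ?T E" "closedin ?T F"
    using oE cov closedin_def by (metis (no_types, lifting) Un_upper1 Un_upper2 topspace_euclidean_subtopology)+
  have clE: "closure E \<inter> M \<subseteq> E" "closure F \<inter> M \<subseteq> F"
    using cE by (auto simp: closedin_closed intro: closure_minimal[THEN subsetD] Int_lower2)+
  have AE: "M \<inter> A0 \<subseteq> E" "M \<inter> B0 \<subseteq> F" unfolding E_def F_def using inv by blast+
  have dA: "closure F \<inter> A0 = {}" "closure E \<inter> B0 = {}"
    using AE EF cov A0 open_Int_closure_eq_empty by blast+
  \<comment> \<open>\<open>E\<close> and \<open>F\<close> are clopen in \<open>M\<close> only, but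
    neither of the two unions meets the closure of the other: the neighbourhoods \<open>A0\<close>
    and \<open>B0\<close> keep \<open>F\<close> away from \<open>A\<close> and \<open>E\<close> away
    from \<open>B\<close>. Separated sets in a metrizable space have disjoint open
    neighbourhoods.\<close>
  have "separatedin euclidean (A \<union> E) (B \<union> F)"
  proof -
    have c: "closure A = A" "closure B = B" 
      by (simp_all add: A B compact_imp_closed closure_closed)
    have "closure (A \<union> E) \<inter> (B \<union> F) = {}" "closure (B \<union> F) \<inter> (A \<union> E) = {}"
      unfolding closure_Un c using AB dA A0 clE EF AE cov by blast+
    then show ?thesis by (auto simp: separatedin_def)
  qed
  then obtain U V where "open U" "open V" "A \<union> E \<subseteq> U" "B \<union> F \<subseteq> V" "disjnt U V"
    using metrizable_space_separation[OF metrizable_space_euclidean] by (metis open_openin)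
  then show thesis using that[of U V] cov unfolding disjnt_def by blast
qed

text \<open>Remove the frontiers of all basic sets from the pieces. On what remains of a piece the
  traces of the basic sets are clopen, so the zero-dimensional sum theorem yields a partition that
  avoids the remainder. The part of \<open>X\<close> outside \<open>U \<union> V\<close> therefore
  lies in the frontiers, which have dimension at most \<open>k - 1\<close>.\<close>

lemma partition_lowering_dim:
  fixes X :: "'a::euclidean_space set"
  assumes X: "countably_covered_dim_le X k"
    and A: "compact A" and B: "compact B" and AB: "A \<inter> B = {}"
  obtains U V where "open U" "open V" "U \<inter> V = {}" "A \<subseteq> U" "B \<subseteq> V"
    "countably_covered_dim_le (X - (U \<union> V)) (k - 1)"
proof -
  obtain \<C> where \<C>: "countable \<C>" "\<And>C. C \<in> \<C> \<Longrightarrow> compact C" "\<And>C. C \<in> \<C> \<Longrightarrow> top_of_set C dim_le k" "X \<subseteq> \<Union>\<C>"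
    using X unfolding countably_covered_dim_le_def by blast
  have "\<exists>\<B>. countable \<B> \<and> (\<forall>U\<in>\<B>. openin (top_of_set C) U \<and> top_of_set (closure U - U) dim_le (k - 1)) \<and>
      (\<forall>x\<in>C. \<forall>e>0. \<exists>U\<in>\<B>. x \<in> U \<and> U \<subseteq> ball x e)" if "C \<in> \<C>" for C
    using compact_dim_le_countable_base[OF \<C>(2,3)[OF that]] by metis
  then obtain \<B> where \<B>: "\<And>C. C \<in> \<C> \<Longrightarrow> countable (\<B> C)"
    "\<And>C U. C \<in> \<C> \<Longrightarrow> U \<in> \<B> C \<Longrightarrow> openin (top_of_set C) U \<and> top_of_set (closure U - U) dim_le (k - 1)"
    "\<And>C x e. C \<in> \<C> \<Longrightarrow> x \<in> C \<Longrightarrow> e > 0 \<Longrightarrow> \<exists>U\<in>\<B> C. x \<in> U \<and> U \<subseteq> ball x e"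
    by metis
  define \<F> where "\<F> = (\<Union>C\<in>\<C>. (\<lambda>U. closure U - U) ` \<B> C)"
  have cF: "countable \<F>" unfolding \<F>_def using \<C>(1) \<B>(1) by auto
  have cpF: "compact F \<and> top_of_set F dim_le (k - 1)" if F: "F \<in> \<F>" for F
  proof -
    obtain C U where CU: "C \<in> \<C>" "U \<in> \<B> C" "F = closure U - U" using F by (auto simp: \<F>_def)
    then obtain T where "open T" "U = C \<inter> T" using \<B>(2) by (meson openin_open)
    moreover have "closure U \<subseteq> C"
      using calculation \<C>(2)[OF CU(1)] by (simp add: closure_minimal compact_imp_closed)
    ultimately have "F = closure U - T" using CU by auto
    moreover have "compact (closure U)"
      using \<open>closure U \<subseteq> C\<close> \<C>(2)[OF CU(1)] by (meson bounded_subset closed_closure compact_eq_bounded_closed)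
    ultimately have "compact F" using \<open>open T\<close> by (metis compact_diff)
    moreover have "top_of_set F dim_le (k - 1)" using \<B>(2)[OF CU(1,2)] CU(3) by simp
    ultimately show ?thesis ..
  qed
  define M where "M = \<Union>\<C> - \<Union>\<F>"
  show thesis
  proof (cases "\<C> = {}")
    case True
    obtain U V where "open U" "open V" "A \<subseteq> U" "B \<subseteq> V" "U \<inter> V = {}"
      using separation_normal_compact[OF A compact_imp_closed[OF B] AB] by metis
    then show thesis using that[of U V] True \<C>(4) 
      by (auto simp: countably_covered_dim_le_def)
  next
    case False
    define N where "N i = from_nat_into \<C> i - \<Union>\<F>" for i
    have inC: "from_nat_into \<C> i \<in> \<C>" for i by (simp add: False from_nat_into)
    obtain U V where UV: "open U" "open V" "U \<inter> V = {}" "A \<subseteq> U" "B \<subseteq> V" "M \<subseteq> U \<union> V"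
    proof (rule partition_avoiding_countable_union[of M N A B])
      show "M = (\<Union>i. N i)"
        using range_from_nat_into[OF False \<C>(1)] unfolding M_def N_def by auto
      fix i
      let ?C = "from_nat_into \<C> i"
      have "N i = M \<inter> ?C" unfolding M_def N_def using inC[of i] by auto
      then show "closedin (top_of_set M) (N i)"
        using \<C>(2)[OF inC] by (simp add: closedin_closed_Int compact_imp_closed)
      fix D E assume DE: "closedin (top_of_set (N i)) D" "closedin (top_of_set (N i)) E" "D \<inter> E = {}"
      show "\<exists>Q. openin (top_of_set (N i)) Q \<and> closedin (top_of_set (N i)) Q \<and> D \<subseteq> Q \<and> Q \<inter> E = {}"
      proof (rule clopen_separation[of "(\<lambda>U. U \<inter> N i) ` \<B> ?C" "N i" D E])
        show "countable ((\<lambda>U. U \<inter> N i) ` \<B> ?C)" using \<B>(1)[OF inC] by simp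
        show "openin (top_of_set (N i)) U \<and> closedin (top_of_set (N i)) U" if "U \<in> (\<lambda>U. U \<inter> N i) ` \<B> ?C" for U
        proof -
          obtain W where W: "W \<in> \<B> ?C" "U = W \<inter> N i" using \<open>U \<in> _\<close> by auto
          then obtain T where T: "open T" "W = ?C \<inter> T" using \<B>(2)[OF inC] by (meson openin_open)
          have "U = N i \<inter> T" using W T by (auto simp: N_def)
          \<comment> \<open>The frontier \<open>closure W - W\<close> was removed from
            \<open>N i\<close>, so the open trace of \<open>W\<close> is also the trace of a closed
            set.\<close>
          moreover have "U = N i \<inter> closure W"
          proof -
            have "closure W - W \<in> \<F>" unfolding \<F>_def using inC W by blast
            then have "N i \<inter> (closure W - W) = {}" by (auto simp: N_def)
            then show ?thesis using W closure_subset[of W] by blast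
          qed
          ultimately show ?thesis using T by (metis closed_closure closedin_closed_Int openin_open_Int)
        qed
        show "\<exists>U\<in>(\<lambda>U. U \<inter> N i) ` \<B> ?C. x \<in> U \<and> U \<subseteq> ball x e" if "x \<in> N i" "0 < e" for x e
        proof -
          have "x \<in> ?C" using that by (simp add: N_def)
          then obtain U where "U \<in> \<B> ?C" "x \<in> U" "U \<subseteq> ball x e" using \<B>(3)[OF inC] \<open>0 < e\<close> by meson
          then show ?thesis using that by (intro bexI[of _ "U \<inter> N i"]) auto
        qed
      qed (use DE in auto)
    qed (use A B AB in auto)
    have "X - (U \<union> V) \<subseteq> \<Union>\<F>" using UV(6) \<C>(4) unfolding M_def by blast
    then have "countably_covered_dim_le (X - (U \<union> V)) (k - 1)"
      unfolding countably_covered_dim_le_def using cF cpF by blast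
    then show thesis using that UV by blast
  qed
qed

text \<open>Each partition lowers the dimension of what is left by one. After \<open>card J\<close>
  partitions the bound is \<open>-1\<close>, which forces every covering piece to be empty.\<close>

lemma partitions_avoiding:
  fixes X :: "'a::euclidean_space set"
  assumes "finite J" "countably_covered_dim_le X (int (card J) - 1)"
    and "\<And>j. j \<in> J \<Longrightarrow> compact (A j) \<and> compact (B j) \<and> A j \<inter> B j = {}"
  shows "\<exists>U V. (\<forall>j\<in>J. open (U j) \<and> open (V j) \<and> U j \<inter> V j = {} \<and> A j \<subseteq> U j \<and> B j \<subseteq> V j) \<and>
            X \<subseteq> (\<Union>j\<in>J. U j \<union> V j)"
  using assms
proof (induction J arbitrary: X rule: finite_induct)
  case empty
  then obtain \<C> where \<C>: "\<forall>C\<in>\<C>. top_of_set C dim_le -1" "X \<subseteq> \<Union>\<C>"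
    by (auto simp: countably_covered_dim_le_def)
  have "C = {}" if "C \<in> \<C>" for C
    using \<C>(1) that by (auto simp: subtopology_eq_discrete_topology_empty)
  then have "X = {}" using \<C>(2) by blast
  then show ?case by simp
next
  case (insert j J)
  obtain U0 V0 where U0: "open U0" "open V0" "U0 \<inter> V0 = {}" "A j \<subseteq> U0" "B j \<subseteq> V0"
    and d: "countably_covered_dim_le (X - (U0 \<union> V0)) (int (card (insert j J)) - 1 - 1)"
    using partition_lowering_dim[OF insert.prems(1), of "A j" "B j"] insert.prems(2)[of j] by auto
  have e: "int (card (insert j J)) - 1 - 1 = int (card J) - 1" using insert.hyps by simp
  obtain U V where UV: "\<forall>j\<in>J. open (U j) \<and> open (V j) \<and> U j \<inter> V j = {} \<and> A j \<subseteq> U j \<and> B j \<subseteq> V j"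
    "X - (U0 \<union> V0) \<subseteq> (\<Union>j\<in>J. U j \<union> V j)"
    using insert.IH[OF d[unfolded e]] insert.prems(2) by blast
  show ?case
  proof (intro exI conjI)
    show "X \<subseteq> (\<Union>i\<in>insert j J. (U(j := U0)) i \<union> (V(j := V0)) i)"
    proof
      fix x assume "x \<in> X"
      then consider "x \<in> U0 \<union> V0" | i where "i \<in> J" "x \<in> U i \<union> V i" using UV(2) by blast
      then show "x \<in> (\<Union>i\<in>insert j J. (U(j := U0)) i \<union> (V(j := V0)) i)"
        using insert.hyps(2) by cases (auto split: if_splits)
    qed
  qed (use UV U0 insert.hyps in auto)
qed

section \<open>Crossed cubes\<close>

text \<open>Brouwer's theorem is applied to \<open>x + w x\<close> clipped to the box. At a fixed
  point with \<open>w x $ j\<close> nonzero the clipping would be active, so \<open>x\<close> would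
  lie on the face towards which \<open>w\<close> points, against the sign condition there.\<close>

lemma poincare_miranda:
  fixes w :: "real^'m \<Rightarrow> real^'m"
  assumes ab: "\<And>j. a$j \<le> b$j" and w: "continuous_on (cbox a b) w"
    and lower: "\<And>x j. x \<in> cbox a b \<Longrightarrow> x$j = a$j \<Longrightarrow> 0 \<le> w x $ j"
    and upper: "\<And>x j. x \<in> cbox a b \<Longrightarrow> x$j = b$j \<Longrightarrow> w x $ j \<le> 0"
  obtains x where "x \<in> cbox a b" "w x = 0"
proof -
  define F where "F x = (\<chi> j. max (a$j) (min (b$j) (x$j + w x $ j)))" for x
  have "continuous_on (cbox a b) F"
    unfolding F_def by (intro continuous_intros w)
  moreover have "F \<in> cbox a b \<rightarrow> cbox a b"
    using ab by (auto simp: F_def mem_box_cart)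
  moreover have "cbox a b \<noteq> {}"
    using ab by (simp add: interval_ne_empty_cart)
  ultimately obtain x where x: "x \<in> cbox a b" "F x = x"
    using brouwer[of "cbox a b" F] by (metis compact_cbox convex_box(1))
  have "w x $ j = 0" for j
  proof -
    have e: "x$j = max (a$j) (min (b$j) (x$j + w x $ j))"
      using arg_cong[OF x(2), of "\<lambda>v. v$j"] by (simp add: F_def)
    have b: "a$j \<le> x$j" "x$j \<le> b$j" using x(1) by (auto simp: mem_box_cart)
    show ?thesis
    proof (rule ccontr)
      assume "w x $ j \<noteq> 0"
      then consider "w x $ j > 0" | "w x $ j < 0" by linarith
      then show False
      proof cases
        case 1
        then have "x$j = b$j" using e b ab[of j] by (auto simp: max_def min_def split: if_splits)
        then show False using upper[OF x(1)] 1 by fastforce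
      next
        case 2
        then have "x$j = a$j" using e b ab[of j] by (auto simp: max_def min_def split: if_splits)
        then show False using lower[OF x(1)] 2 by fastforce
      qed
    qed
  qed
  then show thesis using that x(1) by (simp add: vec_eq_iff)
qed

text \<open>\<open>\<iota>\<close> assigns to each component of \<open>f\<close> the direction in
  which it changes sign across the cube with lower corner \<open>a\<close> and side
  \<open>h\<close>. The margin \<open>\<epsilon>\<close> is uniform, so the condition survives small
  perturbations of \<open>f\<close>.\<close>

definition crosses :: "('n \<Rightarrow> 'm) \<Rightarrow> (real^'m \<Rightarrow> real^'n) \<Rightarrow> real^'n \<Rightarrow> real^'m \<Rightarrow> real \<Rightarrow> bool" where
  "crosses \<iota> f y a h \<longleftrightarrow> (\<exists>\<epsilon>>0. \<forall>x\<in>cbox a (a + h *\<^sub>R 1). \<forall>i.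
     (x$\<iota> i = a$\<iota> i \<longrightarrow> f x $ i \<le> y$i - \<epsilon>) \<and> (x$\<iota> i = a$\<iota> i + h \<longrightarrow> y$i + \<epsilon> \<le> f x $ i))"

lemma crosses_perturb:
  fixes f :: "real^'m \<Rightarrow> real^'n"
  assumes "crosses \<iota> f y a h"
  obtains \<epsilon> where "\<epsilon> > 0" "\<And>g. (\<And>x. x \<in> cbox a (a + h *\<^sub>R 1) \<Longrightarrow> dist (g x) (f x) \<le> \<epsilon>) \<Longrightarrow> crosses \<iota> g y a h"
proof -
  obtain \<epsilon> where \<epsilon>: "\<epsilon> > 0" "\<And>x i. x\<in>cbox a (a + h *\<^sub>R 1) \<Longrightarrow>
     (x$\<iota> i = a$\<iota> i \<longrightarrow> f x $ i \<le> y$i - \<epsilon>) \<and> (x$\<iota> i = a$\<iota> i + h \<longrightarrow> y$i + \<epsilon> \<le> f x $ i)"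
    using assms unfolding crosses_def by blast
  show thesis
  proof (rule that[of "\<epsilon>/2"])
    fix g assume g: "\<And>x. x \<in> cbox a (a + h *\<^sub>R 1) \<Longrightarrow> dist (g x) (f x) \<le> \<epsilon>/2"
    show "crosses \<iota> g y a h" unfolding crosses_def
    proof (intro exI[of _ "\<epsilon>/2"] conjI ballI allI)
      fix x i assume x: "x \<in> cbox a (a + h *\<^sub>R 1)"
      have "\<bar>g x $ i - f x $ i\<bar> \<le> \<epsilon>/2"
        using g[OF x] component_le_norm_cart[of "g x - f x" i] by (simp add: dist_norm)
      then show "x$\<iota> i = a$\<iota> i \<longrightarrow> g x $ i \<le> y$i - \<epsilon>/2" "x$\<iota> i = a$\<iota> i + h \<longrightarrow> y$i + \<epsilon>/2 \<le> g x $ i"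
        using \<epsilon>(2)[OF x, of i] by (auto simp: abs_if split: if_splits)
    qed (use \<epsilon> in auto)
  qed (use \<epsilon> in auto)
qed

text \<open>Poincare-Miranda needs one function for each of the \<open>m\<close> directions.
  Directions outside \<open>range \<iota>\<close> receive the zero function, which satisfies both
  sign conditions.\<close>

lemma crosses_attains:
  fixes f :: "real^'m \<Rightarrow> real^'n"
  assumes "inj \<iota>" "0 \<le> h" "crosses \<iota> f y a h" and f: "continuous_on (cbox a (a + h *\<^sub>R 1)) f"
  shows "y \<in> f ` cbox a (a + h *\<^sub>R 1)"
proof -
  obtain \<epsilon> where \<epsilon>: "\<epsilon> > 0" "\<And>x i. x\<in>cbox a (a + h *\<^sub>R 1) \<Longrightarrow>
     (x$\<iota> i = a$\<iota> i \<longrightarrow> f x $ i \<le> y$i - \<epsilon>) \<and> (x$\<iota> i = a$\<iota> i + h \<longrightarrow> y$i + \<epsilon> \<le> f x $ i)"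
    using assms unfolding crosses_def by blast
  define w where "w x = (\<chi> j. if j \<in> range \<iota> then y $ inv \<iota> j - f x $ inv \<iota> j else 0)" for x
  obtain x where x: "x \<in> cbox a (a + h *\<^sub>R 1)" "w x = 0"
  proof (rule poincare_miranda[of a "a + h *\<^sub>R 1" w])
    show "continuous_on (cbox a (a + h *\<^sub>R 1)) w" unfolding w_def
    proof (intro continuous_on_vec_lambda)
      fix j show "continuous_on (cbox a (a + h *\<^sub>R 1)) (\<lambda>x. if j \<in> range \<iota> then y $ inv \<iota> j - f x $ inv \<iota> j else 0)"
        by (cases "j \<in> range \<iota>") (auto intro!: continuous_intros f)
    qed
    show "0 \<le> w x $ j" if "x \<in> cbox a (a + h *\<^sub>R 1)" "x $ j = a $ j" for x j
      using \<epsilon>(2)[OF that(1), of "inv \<iota> j"] \<epsilon>(1) that by (auto simp: w_def f_inv_into_f)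
    show "w x $ j \<le> 0" if "x \<in> cbox a (a + h *\<^sub>R 1)" "x $ j = (a + h *\<^sub>R 1) $ j" for x j
      using \<epsilon>(2)[OF that(1), of "inv \<iota> j"] \<epsilon>(1) that by (auto simp: w_def f_inv_into_f)
  qed (use assms in auto)
  have "f x $ i = y $ i" for i
  proof -
    have "w x $ \<iota> i = 0" using x(2) by simp
    then show ?thesis using assms(1) by (simp add: w_def)
  qed
  then show ?thesis using x(1) by (auto simp: vec_eq_iff image_iff intro!: bexI[of _ x])
qed

text \<open>Were the dimension below \<open>m - n\<close>, then for the \<open>m - n\<close>
  directions outside \<open>range \<iota>\<close> there would be partitions between opposite faces
  with no point of \<open>F\<close> common to all of them. Poincare-Miranda, with these partitions
  described as zero sets of functions, produces such a common point on the fiber.\<close>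

lemma crosses_not_dim_le:
  fixes f :: "real^'m \<Rightarrow> real^'n"
  assumes \<iota>: "inj \<iota>" and h: "0 < h" and cr: "crosses \<iota> f y a h"
    and f: "continuous_on (cbox a (a + h *\<^sub>R 1)) f"
    and F: "compact F" "{x \<in> cbox a (a + h *\<^sub>R 1). f x = y} \<subseteq> F"
  shows "\<not> top_of_set F dim_le (int CARD('m) - int CARD('n) - 1)"
proof
  assume dim: "top_of_set F dim_le (int CARD('m) - int CARD('n) - 1)"
  let ?K = "cbox a (a + h *\<^sub>R 1)"
  let ?J = "- range \<iota>"
  have "card (range \<iota>) = CARD('n)" using \<iota> by (rule card_image)
  then have "int (card ?J) = int CARD('m) - int CARD('n)"
    by (metis Compl_eq_Diff_UNIV card_Diff_subset card_mono finite of_nat_diff subset_UNIV)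
  with dim F(1) have cov: "countably_covered_dim_le F (int (card ?J) - 1)"
    unfolding countably_covered_dim_le_def by (intro exI[of _ "{F}"]) auto
  define A B where "A j = {x \<in> ?K. x$j = a$j}" and "B j = {x \<in> ?K. x$j = a$j + h}" for j
  have AB: "compact (A j) \<and> compact (B j) \<and> A j \<inter> B j = {}" for j
  proof -
    have "A j = ?K \<inter> {x. x$j = a$j}" "B j = ?K \<inter> {x. x$j = a$j + h}" by (auto simp: A_def B_def)
    moreover have "closed {x::real^'m. x$j = c}" for c
      by (intro closed_Collect_eq continuous_intros)
    ultimately show ?thesis using h by (auto simp: compact_Int_closed)
  qed
  have "\<exists>U V. (\<forall>j\<in>?J. open (U j) \<and> open (V j) \<and> U j \<inter> V j = {} \<and> A j \<subseteq> U j \<and> B j \<subseteq> V j) \<and>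
            F \<subseteq> (\<Union>j\<in>?J. U j \<union> V j)"
    by (rule partitions_avoiding[OF finite cov AB])
  then obtain U V where UV: "\<And>j. j \<in> ?J \<Longrightarrow> open (U j) \<and> open (V j) \<and> U j \<inter> V j = {} \<and> A j \<subseteq> U j \<and> B j \<subseteq> V j"
    and FU: "F \<subseteq> (\<Union>j\<in>?J. U j \<union> V j)"
    by (elim exE conjE) (rule that, erule bspec)
  obtain \<epsilon> where \<epsilon>: "\<epsilon> > 0" "\<And>x i. x\<in>?K \<Longrightarrow>
     (x$\<iota> i = a$\<iota> i \<longrightarrow> f x $ i \<le> y$i - \<epsilon>) \<and> (x$\<iota> i = a$\<iota> i + h \<longrightarrow> y$i + \<epsilon> \<le> f x $ i)"
    using cr unfolding crosses_def by blast
  \<comment> \<open>For a direction outside \<open>range \<iota>\<close> the component is positive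
    on \<open>U j\<close>, negative on \<open>V j\<close> and zero exactly on the partition between
    them.\<close>
  define w where "w x = (\<chi> j. if j \<in> range \<iota> then y $ inv \<iota> j - f x $ inv \<iota> j
       else infdist x (- U j) - infdist x (- V j))" for x
  obtain x where x: "x \<in> ?K" "w x = 0"
  proof (rule poincare_miranda[of a "a + h *\<^sub>R 1" w])
    show "continuous_on ?K w" unfolding w_def
    proof (intro continuous_on_vec_lambda)
      fix j show "continuous_on ?K (\<lambda>x. if j \<in> range \<iota> then y $ inv \<iota> j - f x $ inv \<iota> j
          else infdist x (- U j) - infdist x (- V j))"
        by (cases "j \<in> range \<iota>") (auto intro!: continuous_intros f)
    qed
    show "0 \<le> w x $ j" if x: "x \<in> ?K" "x $ j = a $ j" for x j
    proof (cases "j \<in> range \<iota>")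
      case True
      then show ?thesis using \<epsilon>(2)[OF x(1), of "inv \<iota> j"] \<epsilon>(1) x by (auto simp: w_def f_inv_into_f)
    next
      case False
      then have "x \<in> - V j" using UV[of j] x by (auto simp: A_def)
      then show ?thesis using False by (simp add: w_def infdist_nonneg)
    qed
    show "w x $ j \<le> 0" if x: "x \<in> ?K" "x $ j = (a + h *\<^sub>R 1) $ j" for x j
    proof (cases "j \<in> range \<iota>")
      case True
      then show ?thesis using \<epsilon>(2)[OF x(1), of "inv \<iota> j"] \<epsilon>(1) x by (auto simp: w_def f_inv_into_f)
    next
      case False
      then have "x \<in> - U j" using UV[of j] x by (auto simp: B_def)
      then show ?thesis using False by (simp add: w_def infdist_nonneg)
    qed
  qed (use h in auto)
  have "f x $ i = y $ i" for i
  proof -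
    have "w x $ \<iota> i = 0" using x(2) by simp
    then show ?thesis using \<iota> by (simp add: w_def)
  qed
  then have "x \<in> F" using F(2) x(1) by (auto simp: vec_eq_iff)
  then obtain j where j: "j \<in> ?J" "x \<in> U j \<union> V j" using FU by blast
  have "w x $ j = 0" using x(2) by simp
  then have eq: "infdist x (- U j) = infdist x (- V j)" using j(1) by (simp add: w_def)
  \<comment> \<open>The distance \<open>infdist\<close> to the empty set is 0 by convention, so both
    complements must be known to be nonempty; the opposite faces provide the points.\<close>
  have "a \<in> A j" "a + h *\<^sub>R 1 \<in> B j" using h by (auto simp: A_def B_def mem_box_cart)
  then have ne: "- U j \<noteq> {}" "- V j \<noteq> {}" using UV[OF j(1)] by auto
  have cl: "closed (- U j)" "closed (- V j)" using UV[OF j(1)] by auto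
  have "infdist x (- U j) = 0 \<longleftrightarrow> x \<in> - U j" "infdist x (- V j) = 0 \<longleftrightarrow> x \<in> - V j"
    using in_closed_iff_infdist_zero[OF cl(1) ne(1)] in_closed_iff_infdist_zero[OF cl(2) ne(2)] by auto
  then show False using eq j(2) UV[OF j(1)] by auto
qed

section \<open>Hausdorff dimension and topological dimension\<close>

lemma hausdorff_measure_eq_0_iff:
  "hausdorff_measure s A = 0 \<longleftrightarrow> (\<forall>\<delta>>0. hausdorff_premeasure s \<delta> A = 0)"
  by (auto simp: hausdorff_measure_def SUP_eq_iff bot_ennreal[symmetric] simp del: bot_ennreal)

lemma hausdorff_measure_eq_0I:
  assumes "\<And>\<delta> e. 0 < \<delta> \<Longrightarrow> 0 < e \<Longrightarrow> \<exists>U. A \<subseteq> (\<Union>i. U i) \<and> (\<forall>i. bounded (U i) \<and> diameter (U i) \<le> \<delta>) \<and>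
      (\<Sum>i. diam_pow s (U i)) \<le> ennreal e"
  shows "hausdorff_measure s A = 0"
  unfolding hausdorff_measure_eq_0_iff
proof (intro allI impI)
  fix \<delta> :: real assume "\<delta> > 0"
  have "hausdorff_premeasure s \<delta> A \<le> ennreal e" if e: "0 < e" for e
  proof -
    obtain U where "A \<subseteq> (\<Union>i. U i) \<and> (\<forall>i. bounded (U i) \<and> diameter (U i) \<le> \<delta>)"
      "(\<Sum>i. diam_pow s (U i)) \<le> ennreal e" using assms[OF \<open>\<delta> > 0\<close> e] by auto
    then show ?thesis unfolding hausdorff_premeasure_def by (intro INF_lower2[of U]) auto
  qed
  then show "hausdorff_premeasure s \<delta> A = 0"
    by (metis ennreal_le_epsilon add.left_neutral le_zero_eq)
qed

lemma hausdorff_measure_eq_0D: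
  assumes "hausdorff_measure s A = 0" "0 < \<delta>" "0 < e"
  obtains U where "A \<subseteq> (\<Union>i. U i)" "\<And>i::nat. bounded (U i)" "\<And>i. diameter (U i) \<le> \<delta>"
      "(\<Sum>i. diam_pow s (U i)) < ennreal e"
proof -
  have "hausdorff_premeasure s \<delta> A < ennreal e"
    using assms by (simp add: hausdorff_measure_eq_0_iff)
  then show thesis using that unfolding hausdorff_premeasure_def INF_less_iff by blast
qed

lemma diam_pow_mono_exponent:
  assumes "0 \<le> s" "s \<le> t" "bounded U" "diameter U \<le> 1"
  shows "diam_pow t U \<le> diam_pow s U"
proof -
  have "0 \<le> diameter U" using assms by (simp add: diameter_ge_0)
  moreover have "diameter U powr t \<le> diameter U powr s"
    using assms calculation by (cases "diameter U = 0") (auto intro: powr_mono')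
  moreover have "diameter U powr t \<le> 1" if "0 < t"
    using assms calculation that powr_le1 by auto
  ultimately show ?thesis using assms
    by (auto simp: diam_pow_def intro: ennreal_leI)
qed

lemma hausdorff_measure_eq_0_mono_exponent:
  assumes "0 \<le> s" "s \<le> t" "hausdorff_measure s A = 0"
  shows "hausdorff_measure t A = 0"
proof (rule hausdorff_measure_eq_0I)
  fix \<delta> e :: real assume "0 < \<delta>" "0 < e"
  then obtain U where U: "A \<subseteq> (\<Union>i. U i)" "\<And>i::nat. bounded (U i)" "\<And>i. diameter (U i) \<le> min \<delta> 1"
      "(\<Sum>i. diam_pow s (U i)) < ennreal e"
    using hausdorff_measure_eq_0D[OF assms(3), of "min \<delta> 1" e] by auto
  have "(\<Sum>i. diam_pow t (U i)) \<le> (\<Sum>i. diam_pow s (U i))"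
    using U assms by (intro suminf_le diam_pow_mono_exponent) auto
  then show "\<exists>U. A \<subseteq> (\<Union>i. U i) \<and> (\<forall>i. bounded (U i) \<and> diameter (U i) \<le> \<delta>) \<and> (\<Sum>i. diam_pow t (U i)) \<le> ennreal e"
    using U by (intro exI[of _ U]) (auto intro: order_trans less_imp_le)
qed

text \<open>In exponent 0 each nonempty set of a cover costs 1, so a cover of total cost below 1
  consists of empty sets. This starts the induction for Szpilrajn's inequality.\<close>

lemma hausdorff_measure_0_eq_0_imp_empty:
  assumes "hausdorff_measure 0 A = 0"
  shows "A = {}"
proof (rule ccontr)
  assume "A \<noteq> {}"
  obtain U where U: "A \<subseteq> (\<Union>i::nat. U i)" "(\<Sum>i. diam_pow 0 (U i)) < ennreal 1"
    using hausdorff_measure_eq_0D[OF assms, of 1 1] by (metis zero_less_one)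
  then obtain i where "U i \<noteq> {}" using \<open>A \<noteq> {}\<close> by blast
  then have "1 = diam_pow 0 (U i)" by (simp add: diam_pow_def)
  also have "\<dots> \<le> (\<Sum>i. diam_pow 0 (U i))"
    using sum_le_suminf[of "\<lambda>i. diam_pow 0 (U i)" "{i}"] by simp
  finally show False using U by simp
qed

text \<open>The Eilenberg inequality for the \<open>1\<close>-Lipschitz function \<open>dist z\<close>: integrating over \<open>r\<close> the
  sum of \<open>diam_pow s\<close> over those sets of a cover which can meet the sphere of radius \<open>r\<close> gains
  one factor of the diameter.\<close>

lemma hausdorff_measure_sphere_eq_0:
  fixes A :: "'a::metric_space set"
  assumes s: "0 \<le> s" and A: "hausdorff_measure (s + 1) A = 0" and e: "0 < e"
  obtains r where "0 < r" "r < e" "hausdorff_measure s (A \<inter> sphere z r) = 0"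
proof -
  have "\<exists>U. A \<subseteq> (\<Union>i. U i) \<and> (\<forall>i::nat. bounded (U i) \<and> diameter (U i) \<le> (1/2)^l) \<and>
      (\<Sum>i. diam_pow (s + 1) (U i)) < ennreal ((1/2)^l)" for l :: nat
    using hausdorff_measure_eq_0D[OF A, of "(1/2)^l" "(1/2)^l"] by (metis half_gt_zero zero_less_one zero_less_power)
  then obtain U where U: "\<And>l. A \<subseteq> (\<Union>i. U l i)" "\<And>l i::nat. bounded (U l i)" "\<And>l i. diameter (U l i) \<le> (1/2)^l"
      "\<And>l::nat. (\<Sum>i. diam_pow (s + 1) (U l i)) < ennreal ((1/2)^l)" by metis
  \<comment> \<open>Radii of spheres around \<open>z\<close> that could meet \<open>U l i\<close>:
    an interval around the distance of a chosen point. Its length, twice the diameter, supplies the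
    additional factor.\<close>
  define I where "I l i = (let d = dist z (SOME u. u \<in> U l i) in {d - diameter (U l i) .. d + diameter (U l i)})" for l i
  have I: "dist z u \<in> I l i" if "u \<in> U l i" for u l i
  proof -
    have u: "(SOME u. u \<in> U l i) \<in> U l i" (is "?u \<in> _") using that by (rule someI)
    then have "dist u ?u \<le> diameter (U l i)"
      using U(2) that by (intro diameter_bounded_bound) auto
    then show ?thesis using dist_triangle2[of z u ?u] dist_triangle2[of z ?u u]
      by (simp add: I_def Let_def dist_commute)
  qed
  define \<phi> where "\<phi> l r = (\<Sum>i. diam_pow s (U l i) * indicator (I l i) r)" for l r
  have I_meas: "I l i \<in> sets lborel" for l i unfolding I_def Let_def by simp
  have \<phi>_meas[measurable]: "\<phi> l \<in> borel_measurable lborel" for l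
    unfolding \<phi>_def using I_meas by measurable
  have em: "diam_pow s V * emeasure lborel (I l i) = 2 * diam_pow (s+1) V" if "V = U l i" for V l i
  proof -
    have d: "0 \<le> diameter V" using U(2) that by (simp add: diameter_ge_0)
    have "emeasure lborel (I l i) = ennreal (2 * diameter V)"
      using d that by (simp add: I_def Let_def)
    moreover have "1 * ennreal (2 * diameter V) = 2 * ennreal (diameter V powr 1)"
      using d by (simp add: ennreal_mult)
    moreover have "ennreal (diameter V powr s) * ennreal (2 * diameter V) = 2 * ennreal (diameter V powr (s + 1))"
      using d by (simp add: ennreal_mult powr_add mult_ac)
    ultimately show ?thesis using s by (auto simp: diam_pow_def)
  qed
  have int: "(\<integral>\<^sup>+r. \<phi> l r \<partial>lborel) \<le> ennreal (2 * (1/2)^l)" for l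
  proof -
    have "(\<integral>\<^sup>+r. \<phi> l r \<partial>lborel) = (\<Sum>i. \<integral>\<^sup>+r. diam_pow s (U l i) * indicator (I l i) r \<partial>lborel)"
      unfolding \<phi>_def
      by (intro nn_integral_suminf borel_measurable_times_ennreal borel_measurable_const borel_measurable_indicator I_meas)
    also have "\<dots> = (\<Sum>i. 2 * diam_pow (s+1) (U l i))"
      using I_meas em by (simp add: nn_integral_cmult_indicator)
    also have "\<dots> = 2 * (\<Sum>i. diam_pow (s+1) (U l i))" by simp
    also have "\<dots> \<le> 2 * ennreal ((1/2)^l)" using U(4)[of l] by (intro mult_left_mono) auto
    also have "\<dots> = ennreal (2 * (1/2)^l)" by (subst ennreal_mult) auto
    finally show ?thesis .
  qed
  \<comment> \<open>The \<open>l\<close>-th cover has cost below a geometric term, so even the sum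
    of all \<open>\<phi> l\<close> has finite integral. It is finite almost everywhere, hence at
    some \<open>r\<close> in the nonnull interval \<open>{0<..<e}\<close>.\<close>
  have "(\<integral>\<^sup>+r. (\<Sum>l. \<phi> l r) \<partial>lborel) = (\<Sum>l. \<integral>\<^sup>+r. \<phi> l r \<partial>lborel)"
    by (intro nn_integral_suminf) measurable
  also have "\<dots> \<le> (\<Sum>l. ennreal (2 * (1/2)^l))" by (intro suminf_le int) auto
  also have "\<dots> = ennreal (\<Sum>l. 2 * (1/2)^l)"
    by (intro suminf_ennreal2) (auto intro!: summable_mult summable_geometric)
  finally have "(\<integral>\<^sup>+r. (\<Sum>l. \<phi> l r) \<partial>lborel) \<noteq> \<infinity>" by (auto simp: top_unique)
  then have "AE r in lborel. (\<Sum>l. \<phi> l r) \<noteq> \<infinity>"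
    by (intro nn_integral_noteq_infinite) measurable
  moreover have "\<not> (AE r in lborel. r \<notin> {0<..<e})"
    using e by (subst AE_iff_measurable[of "{0<..<e}"]) auto
  ultimately have "\<exists>r\<in>{0<..<e}. (\<Sum>l. \<phi> l r) \<noteq> \<infinity>"
    by (metis (mono_tags, lifting) eventually_mono)
  then obtain r where r: "(\<Sum>l. \<phi> l r) \<noteq> \<infinity>" "0 < r" "r < e" by auto
  have fin: "\<phi> l r \<noteq> \<infinity>" for l
  proof -
    have "\<phi> l r \<le> (\<Sum>l. \<phi> l r)" using sum_le_suminf[of "\<lambda>l. \<phi> l r" "{l}"] by simp
    then show ?thesis using r(1) by (auto simp: top_unique)
  qed
  then have \<phi>r: "\<phi> l r = ennreal (enn2real (\<phi> l r))" for l by (simp add: less_top)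
  have "summable (\<lambda>l. enn2real (\<phi> l r))"
    by (rule summable_suminf_not_top) (use r(1) \<phi>r in auto)
  \<comment> \<open>At the chosen radius the terms of a convergent series tend to 0, so the sets
    that can meet this sphere form covers of arbitrarily small cost and mesh.\<close>
  then have lim: "(\<lambda>l. enn2real (\<phi> l r)) \<longlonglongrightarrow> 0" by (rule summable_LIMSEQ_zero)
  have "hausdorff_measure s (A \<inter> sphere z r) = 0"
  proof (rule hausdorff_measure_eq_0I)
    fix \<delta> \<epsilon> :: real assume "0 < \<delta>" "0 < \<epsilon>"
    have "\<forall>\<^sub>F l in sequentially. enn2real (\<phi> l r) < \<epsilon>" using lim \<open>0 < \<epsilon>\<close> by (rule order_tendstoD)
    moreover have "\<forall>\<^sub>F l in sequentially. (1/2::real)^l < \<delta>"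
      using LIMSEQ_realpow_zero[of "1/2::real"] \<open>0 < \<delta>\<close> by (intro order_tendstoD(2)) auto
    ultimately obtain l where l: "enn2real (\<phi> l r) < \<epsilon>" "(1/2::real)^l < \<delta>"
      using eventually_happens'[OF sequentially_bot] eventually_conj by (metis (no_types, lifting))
    define V where "V i = (if r \<in> I l i then U l i else {})" for i
    have "A \<inter> sphere z r \<subseteq> (\<Union>i. V i)"
    proof
      fix x assume x: "x \<in> A \<inter> sphere z r"
      then obtain i where "x \<in> U l i" using U(1)[of l] by blast
      moreover from this have "r \<in> I l i" using I[of x l i] x by simp
      ultimately show "x \<in> (\<Union>i. V i)" by (auto simp: V_def)
    qed
    moreover have "bounded (V i) \<and> diameter (V i) \<le> \<delta>" for i
      using U(2,3)[of l i] l(2) \<open>0 < \<delta>\<close> by (auto simp: V_def)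
    moreover have "(\<Sum>i. diam_pow s (V i)) \<le> ennreal \<epsilon>"
    proof -
      have "diam_pow s (V i) = diam_pow s (U l i) * indicator (I l i) r" for i
        by (auto simp: V_def diam_pow_def)
      then have "(\<Sum>i. diam_pow s (V i)) = \<phi> l r" by (simp add: \<phi>_def)
      then show ?thesis using \<phi>r[of l] l(1) by (metis ennreal_leI less_imp_le)
    qed
    ultimately show "\<exists>U. A \<inter> sphere z r \<subseteq> (\<Union>i. U i) \<and> (\<forall>i. bounded (U i) \<and> diameter (U i) \<le> \<delta>) \<and>
        (\<Sum>i. diam_pow s (U i)) \<le> ennreal \<epsilon>" by blast
  qed
  then show thesis using that r by blast
qed

text \<open>Szpilrajn's inequality: spheres with null intersection bound arbitrarily small neighbourhoods.\<close>

lemma hausdorff_measure_eq_0_imp_dim_le: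
  fixes A :: "'a::metric_space set"
  shows "hausdorff_measure (real k) A = 0 \<Longrightarrow> top_of_set A dim_le (int k - 1)"
proof (induction k arbitrary: A)
  case 0
  then show ?case using hausdorff_measure_0_eq_0_imp_empty[of A] by simp
next
  case (Suc k)
  show ?case
  proof (rule dimension_le.intros)
    fix V a assume V: "openin (top_of_set A) V" "a \<in> V"
    then obtain e where e: "e > 0" "ball a e \<inter> A \<subseteq> V" by (meson openin_contains_ball)
    obtain r where r: "0 < r" "r < e" "hausdorff_measure (real k) (A \<inter> sphere a r) = 0"
      using hausdorff_measure_sphere_eq_0[of "real k" A e a] Suc.prems e by (auto simp: add.commute)
    let ?U = "A \<inter> ball a r"
    have "top_of_set A frontier_of ?U \<subseteq> A \<inter> sphere a r"
    proof -
      have "openin (top_of_set A) ?U" by (simp add: openin_open_Int)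
      then have "top_of_set A frontier_of ?U \<subseteq> A \<inter> closure ?U - ?U"
        by (simp add: frontier_of_openin closure_of_subtopology)
      moreover have "closure ?U \<subseteq> cball a r"
        by (meson ball_subset_cball closed_cball closure_minimal inf_le2 subset_trans)
      ultimately show ?thesis by fastforce
    qed
    then have "top_of_set (top_of_set A frontier_of ?U) dim_le (int k - 1)"
      using dimension_le_subtopologies[OF Suc.IH[OF r(3)]] by blast
    then have "subtopology (top_of_set A) (top_of_set A frontier_of ?U) dim_le (int k - 1)"
      using dimension_le_subtopology[of "top_of_set (top_of_set A frontier_of ?U)" "int k - 1" A]
      by (simp add: subtopology_subtopology Int_commute)
    moreover have "?U \<subseteq> V" using e r by auto
    moreover have "a \<in> ?U" using V r openin_imp_subset by fastforce
    ultimately show "\<exists>U. a \<in> U \<and> U \<subseteq> V \<and> openin (top_of_set A) U \<and>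
       subtopology (top_of_set A) (top_of_set A frontier_of U) dim_le (int (Suc k) - 1 - 1)"
      by (intro exI[of _ ?U]) (auto simp: openin_open_Int)
  qed auto
qed

text \<open>Both upper bounds come from the null measures, the topological one through exponent
  \<open>d + 1\<close>. Both lower bounds come from \<open>nd\<close>: a null measure in an exponent
  below \<open>d\<close> would be null in exponent \<open>d\<close> too, and Szpilrajn's inequality
  would contradict \<open>nd\<close>.\<close>

lemma top_dim_hausdorff_dim_eq:
  fixes A :: "'a::metric_space set"
  assumes H: "\<And>s. real d < s \<Longrightarrow> hausdorff_measure s A = 0" and nd: "\<not> top_of_set A dim_le (int d - 1)"
  shows "top_dim (top_of_set A) = ereal (real d)" "hausdorff_dim A = ereal (real d)"
proof -
  have d: "top_of_set A dim_le int d"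
    using hausdorff_measure_eq_0_imp_dim_le[of "Suc d" A] H[of "real (Suc d)"] by simp
  show "top_dim (top_of_set A) = ereal (real d)" unfolding top_dim_def
  proof (rule antisym)
    show "(INF k\<in>{k. top_of_set A dim_le k}. ereal (real_of_int k)) \<le> ereal (real d)"
      using d by (intro INF_lower2[of "int d"]) auto
    show "ereal (real d) \<le> (INF k\<in>{k. top_of_set A dim_le k}. ereal (real_of_int k))"
    proof (rule INF_greatest)
      fix k assume "k \<in> {k. top_of_set A dim_le k}"
      then have "\<not> k \<le> int d - 1" using nd dimension_le_mono by blast
      then show "ereal (real d) \<le> ereal (real_of_int k)" by simp
    qed
  qed
  show "hausdorff_dim A = ereal (real d)" unfolding hausdorff_dim_def
  proof (rule antisym)
    have "(INF s\<in>{s. 0 \<le> s \<and> hausdorff_measure s A = 0}. ereal s) \<le> ereal (real d) + ereal \<epsilon>" if "0 < \<epsilon>" for \<epsilon>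
      using H that by (intro INF_lower2[of "real d + \<epsilon>"]) auto
    then show "(INF s\<in>{s. 0 \<le> s \<and> hausdorff_measure s A = 0}. ereal s) \<le> ereal (real d)"
      using ereal_le_epsilon2 by blast
    show "ereal (real d) \<le> (INF s\<in>{s. 0 \<le> s \<and> hausdorff_measure s A = 0}. ereal s)"
    proof (rule INF_greatest)
      fix s assume s: "s \<in> {s. 0 \<le> s \<and> hausdorff_measure s A = 0}"
      have "real d \<le> s"
      proof (rule ccontr)
        assume "\<not> real d \<le> s"
        then have "hausdorff_measure (real d) A = 0"
          using s hausdorff_measure_eq_0_mono_exponent[of s "real d" A] by auto
        then show False using nd hausdorff_measure_eq_0_imp_dim_le by blast
      qed
      then show "ereal (real d) \<le> ereal s" by simp
    qed
  qed
qed

section \<open>Covers by finitely many balls of equal radius\<close>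

text \<open>A finite cover by open balls still covers every fiber of a nearby map, by compactness;
  hence this replacement for small Hausdorff premeasure. The bound \<open>e\<close> controls both
  the mesh and the total cost in exponent \<open>s\<close>.\<close>

definition ball_coverable :: "real \<Rightarrow> real \<Rightarrow> 'a::metric_space set \<Rightarrow> bool" where
  "ball_coverable s e A \<longleftrightarrow> (\<exists>C r. finite C \<and> 0 < r \<and> A \<subseteq> (\<Union>c\<in>C. ball c r) \<and>
      2 * r < e \<and> real (card C) * (2 * r) powr s < e)"

text \<open>The exponent may vary with \<open>e\<close>: once diameters are below 1, passing from
  \<open>s\<close> to the larger \<open>t\<close> only lowers the cost. This allows exponents that
  descend to the dimension.\<close>

lemma ball_coverable_imp_hausdorff_measure_eq_0:
  fixes A :: "'a::metric_space set"
  assumes t: "0 < t" and cov: "\<And>e. 0 < e \<Longrightarrow> \<exists>s\<le>t. ball_coverable s e A"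
  shows "hausdorff_measure t A = 0"
proof (rule hausdorff_measure_eq_0I)
  fix \<delta> e :: real assume \<delta>e: "0 < \<delta>" "0 < e"
  define e' where "e' = min (min \<delta> 1) e"
  have "0 < e'" using \<delta>e by (simp add: e'_def)
  then obtain s C r where C: "s \<le> t" "finite C" "0 < r" "A \<subseteq> (\<Union>c\<in>C. ball c r)"
     "2 * r < e'" "real (card C) * (2 * r) powr s < e'"
    using cov[of e'] unfolding ball_coverable_def by blast
  obtain c where c: "bij_betw c {0..<card C} C" using C(2) ex_bij_betw_nat_finite by blast
  define U where "U i = (if i < card C then ball (c i) r else {})" for i
  have dU: "diameter (U i) \<le> 2 * r" for i
  proof (cases "i < card C")
    case True
    have "dist x y \<le> 2 * r" if "x \<in> ball (c i) r" "y \<in> ball (c i) r" for x y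
      using that dist_triangle3[of x y "c i"] by simp
    then have "diameter (ball (c i) r) \<le> 2 * r"
      unfolding diameter_def using C(3) by (auto intro!: cSUP_least)
    then show ?thesis using True by (simp add: U_def)
  qed (use C(3) in \<open>simp add: U_def\<close>)
  have bU: "bounded (U i)" for i by (simp add: U_def)
  have "A \<subseteq> (\<Union>i. U i)"
  proof
    fix x assume "x \<in> A"
    then obtain k where "k \<in> C" "x \<in> ball k r" using C(4) by blast
    moreover obtain i where "i < card C" "c i = k"
      using c \<open>k \<in> C\<close> by (metis atLeastLessThan_iff bij_betw_def imageE)
    ultimately show "x \<in> (\<Union>i. U i)" by (auto simp: U_def)
  qed
  moreover have "(\<Sum>i. diam_pow t (U i)) \<le> ennreal e"
  proof -
    have r1: "2 * r < 1" using C(5) by (simp add: e'_def)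
    have "diam_pow t (U i) \<le> ennreal ((2 * r) powr s)" for i
    proof -
      have "diameter (U i) powr t \<le> (2 * r) powr t"
        using dU[of i] t diameter_ge_0[OF bU[of i]] by (intro powr_mono2) auto
      also have "\<dots> \<le> (2 * r) powr s" using C r1 by (intro powr_mono') auto
      finally show ?thesis using t by (auto simp: diam_pow_def intro: ennreal_leI)
    qed
    moreover have "(\<Sum>i. diam_pow t (U i)) = (\<Sum>i<card C. diam_pow t (U i))"
      by (intro suminf_finite) (auto simp: U_def diam_pow_def)
    ultimately have "(\<Sum>i. diam_pow t (U i)) \<le> (\<Sum>i<card C. ennreal ((2 * r) powr s))"
      by (metis (no_types, lifting) sum_mono)
    also have "\<dots> = ennreal (real (card C) * (2 * r) powr s)"
      by (simp add: ennreal_mult ennreal_of_nat_eq_real_of_nat)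
    also have "\<dots> \<le> ennreal e" using C(6) by (intro ennreal_leI) (simp add: e'_def)
    finally show ?thesis .
  qed
  moreover have "diameter (U i) \<le> \<delta>" for i using dU[of i] C(5) by (simp add: e'_def)
  ultimately show "\<exists>U. A \<subseteq> (\<Union>i. U i) \<and> (\<forall>i. bounded (U i) \<and> diameter (U i) \<le> \<delta>) \<and> (\<Sum>i. diam_pow t (U i)) \<le> ennreal e"
    using bU by blast
qed

section \<open>Generic maps on the cube\<close>

lemma mspace_cube_maps:
  "f \<in> mspace cube_maps \<longleftrightarrow> f \<in> extensional unit_cube \<and> continuous_on unit_cube (f :: real^'m \<Rightarrow> real^'n)"
  unfolding cube_maps_def
  by (subst compactin_mspace_cfunspace) (auto simp: compact_cbox)

lemma unit_cube_nonempty: "(unit_cube :: (real^'m) set) \<noteq> {}"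
  by (simp add: interval_ne_empty_cart)

lemma mdist_cube_maps_le_iff:
  assumes "f \<in> mspace cube_maps" "g \<in> mspace cube_maps"
  shows "mdist cube_maps f g \<le> e \<longleftrightarrow> (\<forall>x\<in>unit_cube. dist (f x) (g x :: real^'n) \<le> e)"
  using assms unfolding cube_maps_def
  by (subst cfunspace_mdist_le) (auto simp: unit_cube_nonempty)

lemma restrict_in_mspace_cube_maps:
  assumes "continuous_on unit_cube f"
  shows "restrict f unit_cube \<in> mspace cube_maps"
  using assms by (simp add: mspace_cube_maps cong: continuous_on_cong)

text \<open>Allows density and openness to be argued with arbitrary functions continuous on the
  cube; restriction turns them into points of the space, where maps are extensional.\<close>

lemma nowhere_dense_in_cube_maps:
  fixes P :: "(real^'m \<Rightarrow> real^'n) \<Rightarrow> bool"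
  assumes "\<And>f \<epsilon>. continuous_on unit_cube f \<Longrightarrow> 0 < \<epsilon> \<Longrightarrow>
     \<exists>g \<delta>. 0 < \<delta> \<and> continuous_on unit_cube g \<and> (\<forall>x\<in>unit_cube. dist (f x) (g x) \<le> \<epsilon>) \<and>
        (\<forall>h. continuous_on unit_cube h \<longrightarrow> (\<forall>x\<in>unit_cube. dist (g x) (h x) \<le> \<delta>) \<longrightarrow> P h)"
  shows "nowhere_dense_in (mtopology_of cube_maps) {f \<in> mspace cube_maps. \<not> P f}"
proof -
  interpret M: Metric_space "mspace cube_maps" "mdist (cube_maps :: (real^'m \<Rightarrow> real^'n) metric)"
    by (rule Metric_space_mspace_mdist)
  have T: "mtopology_of cube_maps = M.mtopology" by (simp add: mtopology_of_def)
  let ?N = "{f \<in> mspace cube_maps. \<not> P f}"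
  have "M.mtopology interior_of (M.mtopology closure_of ?N) = {}"
  proof (rule equals0I)
    fix f assume "f \<in> M.mtopology interior_of (M.mtopology closure_of ?N)"
    then obtain U where U: "openin M.mtopology U" "f \<in> U" "U \<subseteq> M.mtopology closure_of ?N"
      by (auto simp: interior_of_def)
    then obtain r where r: "0 < r" "M.mball f r \<subseteq> U" and f: "f \<in> mspace cube_maps"
      using U(1,2) unfolding M.openin_mtopology by blast
    obtain g \<delta> where g: "0 < \<delta>" "continuous_on unit_cube g" "\<And>x. x \<in> unit_cube \<Longrightarrow> dist (f x) (g x) \<le> r / 2"
      and gP: "\<And>h. continuous_on unit_cube h \<Longrightarrow> (\<forall>x\<in>unit_cube. dist (g x) (h x) \<le> \<delta>) \<Longrightarrow> P h"
      using assms[of f "r/2"] f r(1) by (auto simp: mspace_cube_maps)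
    let ?g = "restrict g unit_cube"
    have g': "?g \<in> mspace cube_maps" by (rule restrict_in_mspace_cube_maps[OF g(2)])
    have "mdist cube_maps f ?g \<le> r / 2"
      by (subst mdist_cube_maps_le_iff[OF f g']) (use g(3) in auto)
    then have "?g \<in> M.mball f r" using f g' r(1) by (simp add: M.in_mball)
    then have "?g \<in> M.mtopology closure_of ?N" using r U by blast
    then obtain h where h: "h \<in> ?N" "h \<in> M.mball ?g \<delta>"
      using g(1) by (auto simp: M.metric_closure_of)
    then have "mdist cube_maps ?g h \<le> \<delta>" "h \<in> mspace cube_maps" by (auto simp: M.in_mball)
    then have "\<forall>x\<in>unit_cube. dist (g x) (h x) \<le> \<delta>"
      using mdist_cube_maps_le_iff[OF g'] by fastforce
    then have "P h" using gP[of h] h(1) by (auto simp: mspace_cube_maps)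
    then show False using h(1) by simp
  qed
  then show ?thesis unfolding nowhere_dense_in_def T by auto
qed

text \<open>\<open>meager_in\<close> demands equality with a countable union, so the nowhere dense
  sets where some \<open>P i\<close> fails are cut down to the maps that violate
  \<open>Q\<close>.\<close>

lemma comeager_in_cube_maps:
  fixes P :: "'i \<Rightarrow> (real^'m \<Rightarrow> real^'n) \<Rightarrow> bool"
  assumes I: "countable I"
    and dense: "\<And>i f \<epsilon>. i \<in> I \<Longrightarrow> continuous_on unit_cube f \<Longrightarrow> 0 < \<epsilon> \<Longrightarrow>
     \<exists>g \<delta>. 0 < \<delta> \<and> continuous_on unit_cube g \<and> (\<forall>x\<in>unit_cube. dist (f x) (g x) \<le> \<epsilon>) \<and>
        (\<forall>h. continuous_on unit_cube h \<longrightarrow> (\<forall>x\<in>unit_cube. dist (g x) (h x) \<le> \<delta>) \<longrightarrow> P i h)"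
    and Q: "\<And>f. continuous_on unit_cube f \<Longrightarrow> (\<And>i. i \<in> I \<Longrightarrow> P i f) \<Longrightarrow> Q f"
  shows "comeager_in (mtopology_of cube_maps) {f \<in> mspace cube_maps. Q f}"
proof -
  let ?X = "mtopology_of (cube_maps :: (real^'m \<Rightarrow> real^'n) metric)"
  let ?S = "{f \<in> mspace cube_maps. Q f}"
  let ?N = "\<lambda>i. {f \<in> mspace cube_maps. \<not> P i f}"
  have top: "topspace ?X = mspace cube_maps" by simp
  have nd: "nowhere_dense_in ?X (?N i \<inter> - ?S)" if i: "i \<in> I" for i
  proof -
    have "nowhere_dense_in ?X (?N i)"
      by (rule nowhere_dense_in_cube_maps) (use dense[OF i] in blast)
    moreover have "?X interior_of (?X closure_of (?N i \<inter> - ?S)) \<subseteq> ?X interior_of (?X closure_of ?N i)"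
      by (intro interior_of_mono closure_of_mono) auto
    ultimately show ?thesis unfolding nowhere_dense_in_def by blast
  qed
  have "meager_in ?X (topspace ?X - ?S)"
    unfolding meager_in_def
  proof (intro exI conjI ballI)
    show "countable ((\<lambda>i. ?N i \<inter> - ?S) ` I)" using I by simp
    show "nowhere_dense_in ?X T" if "T \<in> (\<lambda>i. ?N i \<inter> - ?S) ` I" for T
      using that nd by blast
    show "topspace ?X - ?S = \<Union>((\<lambda>i. ?N i \<inter> - ?S) ` I)"
      unfolding top using Q by (auto simp: mspace_cube_maps)
  qed
  then show ?thesis unfolding comeager_in_def top by auto
qed

text \<open>The boundary of the closed set of maps whose image contains a given ball is nowhere dense, so
  a generic map covers every point of the interior of its image stably.\<close>

lemma stably_covers_dense:
  fixes f :: "real^'m \<Rightarrow> real^'n" and q :: "real^'n" and r :: real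
  defines "P \<equiv> \<lambda>f. cball q r \<subseteq> f ` unit_cube \<longrightarrow> (\<exists>\<epsilon>>0. \<forall>h. continuous_on unit_cube h \<longrightarrow>
       (\<forall>x\<in>unit_cube. dist (h x) (f x) \<le> \<epsilon>) \<longrightarrow> cball q r \<subseteq> h ` unit_cube)"
  assumes f: "continuous_on unit_cube f" and \<epsilon>: "0 < \<epsilon>"
  shows "\<exists>g \<delta>. 0 < \<delta> \<and> continuous_on unit_cube g \<and> (\<forall>x\<in>unit_cube. dist (f x) (g x) \<le> \<epsilon>) \<and>
        (\<forall>h. continuous_on unit_cube h \<longrightarrow> (\<forall>x\<in>unit_cube. dist (g x) (h x) \<le> \<delta>) \<longrightarrow> P h)"
\<comment> \<open>Either all maps within \<open>\<epsilon>\<close> of \<open>f\<close> cover the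
  ball, and then those within \<open>\<epsilon>/2\<close> do so stably; or some \<open>g\<close>
  misses a point of it, maps near \<open>g\<close> miss it too, and \<open>P\<close> holds
  vacuously.\<close>
proof (cases "\<forall>g. continuous_on unit_cube g \<longrightarrow> (\<forall>x\<in>unit_cube. dist (f x) (g x) \<le> \<epsilon>) \<longrightarrow> cball q r \<subseteq> g ` unit_cube")
  case True
  have "P h" if h: "continuous_on unit_cube h" "\<forall>x\<in>unit_cube. dist (f x) (h x) \<le> \<epsilon>/2" for h
    unfolding P_def
  proof (intro impI exI[of _ "\<epsilon>/2"] conjI allI)
    fix h' assume h': "continuous_on unit_cube h'" "\<forall>x\<in>unit_cube. dist (h' x) (h x) \<le> \<epsilon>/2"
    have "dist (f x) (h' x) \<le> \<epsilon>" if "x \<in> unit_cube" for x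
      using dist_triangle2[of "f x" "h' x" "h x"] h(2) h'(2) that by fastforce
    then show "cball q r \<subseteq> h' ` unit_cube" using True h'(1) by blast
  qed (use \<epsilon> in auto)
  then show ?thesis using f \<epsilon> by (intro exI[of _ f] exI[of _ "\<epsilon>/2"]) auto
next
  case False
  then obtain g where g: "continuous_on unit_cube g" "\<forall>x\<in>unit_cube. dist (f x) (g x) \<le> \<epsilon>" "\<not> cball q r \<subseteq> g ` unit_cube"
    by blast
  then obtain z where z: "z \<in> cball q r" "z \<notin> g ` unit_cube" by blast
  have "closed (g ` unit_cube)" using g(1) by (intro compact_imp_closed compact_continuous_image compact_cbox)
  then obtain d where d: "d > 0" "\<And>w. w \<in> g ` unit_cube \<Longrightarrow> d \<le> dist z w"
    using separate_point_closed[OF _ z(2)] by blast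
  have "P h" if h: "\<forall>x\<in>unit_cube. dist (g x) (h x) \<le> d/2" for h
  proof -
    have "z \<notin> h ` unit_cube"
    proof
      assume "z \<in> h ` unit_cube"
      then obtain x where "x \<in> unit_cube" "z = h x" by blast
      then show False using d(2)[of "g x"] h d(1) by (force simp: dist_commute)
    qed
    then show ?thesis using z(1) unfolding P_def by blast
  qed
  then show ?thesis using g d(1) by (intro exI[of _ g] exI[of _ "d/2"]) auto
qed

section \<open>Rapidly oscillating perturbations\<close>

text \<open>The crossed value at \<open>x\<close> is \<open>g x\<close>, so a point where
  \<open>g\<close> takes the value \<open>y\<close> has cubes crossed at \<open>y\<close> nearby.
  The count says that there are almost \<open>h\<close> to the power \<open>-m\<close> cubes: for
  each \<open>s < m\<close> and large \<open>k\<close> at least \<open>k\<close> times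
  \<open>h powr (-s)\<close>. Corners \<open>2 * h\<close> apart keep the cubes of side
  \<open>h\<close> at mutual distance at least \<open>h\<close>.\<close>

definition oscillates :: "('n \<Rightarrow> 'm) \<Rightarrow> nat \<Rightarrow> (real^'m \<Rightarrow> real^'n) \<Rightarrow> bool" where
  "oscillates \<iota> k f \<longleftrightarrow> (\<exists>g h. continuous_on unit_cube g \<and> (\<forall>x\<in>unit_cube. dist (f x) (g x) \<le> 1 / real k) \<and>
     0 < h \<and> h < 1 / real k \<and>
     (\<forall>x\<in>unit_cube. \<exists>C. finite C \<and> real k \<le> real (card C) * h powr (real CARD('m) - 1 / real k) \<and>
        (\<forall>a\<in>C. crosses \<iota> f (g x) a h \<and> cbox a (a + h *\<^sub>R 1) \<subseteq> unit_cube \<inter> ball x (1 / real k)) \<and>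
        (\<forall>a\<in>C. \<forall>b\<in>C. a \<noteq> b \<longrightarrow> (\<exists>j. 2 * h \<le> \<bar>a$j - b$j\<bar>))))"

text \<open>The corners are even multiples of \<open>h\<close>, so that
  \<open>cos (pi * x / h)\<close> is 1 on lower faces and -1 on upper faces. The cubes fill a fixed
  proportion of a box of side \<open>\<rho>\<close> that contains \<open>x\<close>.\<close>

lemma cube_grid:
  fixes x :: "real^'m"
  assumes x: "x \<in> unit_cube" and \<rho>: "0 < \<rho>" "\<rho> \<le> 1/2" and h: "0 < h" "h \<le> \<rho> / 8"
  obtains C where "finite C" "(\<rho> / (8 * h)) ^ CARD('m) \<le> real (card C)"
    "\<And>a j. a \<in> C \<Longrightarrow> \<exists>l::nat. a$j = 2 * h * real l"
    "\<And>a z j. a \<in> C \<Longrightarrow> z \<in> cbox a (a + h *\<^sub>R 1) \<Longrightarrow> \<bar>z$j - x$j\<bar> \<le> \<rho> \<and> 0 \<le> z$j \<and> z$j \<le> 1"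
    "\<And>a b. a \<in> C \<Longrightarrow> b \<in> C \<Longrightarrow> a \<noteq> b \<Longrightarrow> \<exists>j. 2 * h \<le> \<bar>a$j - b$j\<bar>"
proof -
  \<comment> \<open>Lower corner of a box of side \<open>\<rho>\<close> through \<open>x\<close>,
    extended towards the interior in each direction; it stays in the unit cube because
    \<open>\<rho> \<le> 1/2\<close>.\<close>
  define b where "b j = (if x$j \<le> 1/2 then x$j else x$j - \<rho>)" for j
  have xj: "0 \<le> x$j" "x$j \<le> 1" for j using x by (auto simp: mem_box_cart)
  have b: "0 \<le> b j" "b j + \<rho> \<le> 1" "b j \<le> x$j" "x$j \<le> b j + \<rho>" for j
    using xj[of j] \<rho> by (auto simp: b_def)
  define l0 where "l0 j = nat \<lceil>b j / (2 * h)\<rceil>" for j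
  have l0: "b j \<le> 2 * h * real (l0 j)" "2 * h * real (l0 j) \<le> b j + 2 * h" for j
  proof -
    have "real (l0 j) = of_int \<lceil>b j / (2 * h)\<rceil>" using b(1)[of j] h by (simp add: l0_def)
    then have "b j / (2 * h) \<le> real (l0 j)" "real (l0 j) \<le> b j / (2 * h) + 1" by linarith+
    then show "b j \<le> 2 * h * real (l0 j)" "2 * h * real (l0 j) \<le> b j + 2 * h"
      using h by (simp_all add: field_simps)
  qed
  \<comment> \<open>Corners per direction. They use half of the side \<open>\<rho>\<close>, which
    leaves room for rounding \<open>b j\<close> up to the grid; since
    \<open>h \<le> \<rho> / 8\<close>, the floor loses at most half of
    \<open>\<rho> / (4 * h)\<close>.\<close>
  define N where "N = nat \<lfloor>\<rho> / (4 * h)\<rfloor>"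
  have N: "real N \<le> \<rho> / (4 * h)" "\<rho> / (8 * h) \<le> real N"
  proof -
    have e: "real N = of_int \<lfloor>\<rho> / (4 * h)\<rfloor>" using \<rho> h by (simp add: N_def)
    then show "real N \<le> \<rho> / (4 * h)" by linarith
    have "\<rho> / (4 * h) - 1 \<le> real N" using e by linarith
    moreover have "\<rho> / (8 * h) \<le> \<rho> / (4 * h) - 1" using h by (simp add: field_simps)
    ultimately show "\<rho> / (8 * h) \<le> real N" by linarith
  qed
  define \<Phi> :: "('m \<Rightarrow> nat) \<Rightarrow> real^'m" where "\<Phi> t = (\<chi> j. 2 * h * real (l0 j + t j))" for t
  define T where "T = PiE (UNIV :: 'm set) (\<lambda>_. {..<N})"
  have fT: "finite T" unfolding T_def by (intro finite_PiE) auto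
  have cT: "card T = N ^ CARD('m)" unfolding T_def by (simp add: card_PiE)
  have inj: "inj_on \<Phi> T"
    using h by (auto simp: inj_on_def \<Phi>_def vec_eq_iff)
  have Ncast: "2 * h * real N \<le> \<rho> / 2" using N(1) h by (simp add: field_simps)
  show thesis
  proof (rule that[of "\<Phi> ` T"])
    show "finite (\<Phi> ` T)" using fT by simp
    have "card (\<Phi> ` T) = N ^ CARD('m)" using card_image[OF inj] cT by simp
    then show "(\<rho> / (8 * h)) ^ CARD('m) \<le> real (card (\<Phi> ` T))"
      using N(2) \<rho> h by (simp add: power_mono)
    show "\<exists>l::nat. a$j = 2 * h * real l" if "a \<in> \<Phi> ` T" for a j
      using that by (force simp: \<Phi>_def simp del: of_nat_add)
    show "\<bar>z$j - x$j\<bar> \<le> \<rho> \<and> 0 \<le> z$j \<and> z$j \<le> 1"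
      if a: "a \<in> \<Phi> ` T" and z: "z \<in> cbox a (a + h *\<^sub>R 1)" for a z j
    proof -
      obtain t where t: "t \<in> T" "a = \<Phi> t" using a by blast
      then have "t j < N" by (auto simp: T_def PiE_iff)
      then have tj: "real (t j) + 1 \<le> real N" by linarith
      have "2 * h * (real (t j) + 1) \<le> 2 * h * real N" using tj h by (intro mult_left_mono) auto
      then have tN: "2 * h * real (t j) + 2 * h \<le> \<rho> / 2" using Ncast by (simp add: algebra_simps)
      have aj: "a $ j = 2 * h * real (l0 j) + 2 * h * real (t j)" using t by (simp add: \<Phi>_def algebra_simps)
      have zj: "a $ j \<le> z $ j" "z $ j \<le> a $ j + h" using z by (auto simp: mem_box_cart)
      have "0 \<le> 2 * h * real (t j)" using h by simp
      then have "b j \<le> z $ j" "z $ j \<le> b j + \<rho>" using aj zj l0[of j] tN h \<rho> by linarith+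
      then show ?thesis using b[of j] by linarith
    qed
    show "\<exists>j. 2 * h \<le> \<bar>a$j - c$j\<bar>" if ac: "a \<in> \<Phi> ` T" "c \<in> \<Phi> ` T" "a \<noteq> c" for a c
    proof -
      obtain t s where ts: "a = \<Phi> t" "c = \<Phi> s" using ac by blast
      then obtain j where "t j \<noteq> s j" using ac(3) by (metis ext)
      then have "1 \<le> \<bar>real (t j) - real (s j)\<bar>" by linarith
      then have "2 * h * 1 \<le> 2 * h * \<bar>real (t j) - real (s j)\<bar>" using h by (intro mult_left_mono) auto
      also have "\<dots> = \<bar>2 * h * (real (t j) - real (s j))\<bar>" using h by (simp add: abs_mult)
      also have "2 * h * (real (t j) - real (s j)) = a$j - c$j" using ts by (simp add: \<Phi>_def algebra_simps)
      finally show ?thesis by auto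
    qed
  qed
qed

text \<open>Subtracting \<open>\<delta> * cos\<close> with period \<open>2 * h\<close> in direction
  \<open>\<iota> i\<close> creates jumps of size \<open>\<delta>\<close> on a scale where
  \<open>f\<close> varies by less than \<open>\<delta> / 2\<close>. A later error of
  \<open>\<delta> / 4\<close> leaves the margin \<open>\<delta> / 4\<close>.\<close>

lemma oscillates_dense:
  fixes f :: "real^'m \<Rightarrow> real^'n"
  assumes f: "continuous_on unit_cube f" and \<epsilon>: "0 < \<epsilon>" and k: "0 < k"
  shows "\<exists>g \<delta>. 0 < \<delta> \<and> continuous_on unit_cube g \<and> (\<forall>x\<in>unit_cube. dist (f x) (g x) \<le> \<epsilon>) \<and>
        (\<forall>h. continuous_on unit_cube h \<longrightarrow> (\<forall>x\<in>unit_cube. dist (g x) (h x) \<le> \<delta>) \<longrightarrow> oscillates \<iota> k h)"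
proof -
  define n m where "n = real CARD('n)" and "m = real CARD('m)"
  have nm: "1 \<le> n" "1 \<le> m" by (auto simp: n_def m_def Suc_leI)
  \<comment> \<open>The \<open>n\<close> components together move the value by at most
    \<open>n * \<delta>\<close>; keeping this below \<open>1 / (2 * real k)\<close> leaves room for
    the later error of \<open>\<delta> / 4\<close>.\<close>
  define \<delta> where "\<delta> = min \<epsilon> (1 / (2 * real k)) / n"
  have \<delta>: "0 < \<delta>" "n * \<delta> \<le> \<epsilon>" "n * \<delta> \<le> 1 / (2 * real k)"
    using nm \<epsilon> k by (auto simp: \<delta>_def)
  have \<delta>n: "\<delta> \<le> n * \<delta>" using nm \<delta>(1) by (simp add: mult_le_cancel_right1)
  have "uniformly_continuous_on unit_cube f"
    using f by (intro compact_uniformly_continuous compact_cbox)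
  then obtain \<rho>0 where \<rho>0: "\<rho>0 > 0" "\<And>x z. x \<in> unit_cube \<Longrightarrow> z \<in> unit_cube \<Longrightarrow> dist z x < \<rho>0 \<Longrightarrow> dist (f z) (f x) < \<delta> / 2"
    unfolding uniformly_continuous_on_def using \<delta>(1) by (metis half_gt_zero)
  define \<rho> where "\<rho> = min (min \<rho>0 (1 / real k)) 1 / (2 * m)"
  have \<rho>: "0 < \<rho>" "\<rho> \<le> 1/2" "m * \<rho> < \<rho>0" "m * \<rho> < 1 / real k"
  proof -
    define M where "M = min (min \<rho>0 (1 / real k)) 1"
    have M: "0 < M" "M \<le> \<rho>0" "M \<le> 1 / real k" "M \<le> 1" using k \<rho>0(1) by (auto simp: M_def)
    have e: "m * \<rho> = M / 2" using nm by (simp add: \<rho>_def M_def)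
    show "0 < \<rho>" using M nm by (simp add: \<rho>_def M_def)
    then have "\<rho> \<le> m * \<rho>" using nm by (simp add: mult_le_cancel_right1)
    then show "\<rho> \<le> 1/2" "m * \<rho> < \<rho>0" "m * \<rho> < 1 / real k" using e M by linarith+
  qed
  \<comment> \<open>The third bound makes \<open>h powr (1 / real k)\<close> so small that the
    \<open>(\<rho> / (8 * h)) ^ m\<close> available cubes meet the required count.\<close>
  define h where "h = Min {1 / (2 * real k), \<rho> / 8, ((\<rho> / 8) ^ CARD('m) / real k) ^ k}"
  have h: "0 < h" "h < 1 / real k" "h \<le> \<rho> / 8" "h \<le> ((\<rho> / 8) ^ CARD('m) / real k) ^ k"
  proof -
    have "h \<le> 1 / (2 * real k)" by (simp add: h_def)
    also have "\<dots> < 1 / real k" using k by (simp add: field_simps)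
    finally show "h < 1 / real k" .
  qed (use k \<rho> in \<open>auto simp: h_def\<close>)
  have hk: "real k \<le> (\<rho> / 8) ^ CARD('m) * h powr (- 1 / real k)"
  proof -
    have "h powr (1 / real k) \<le> (((\<rho> / 8) ^ CARD('m) / real k) ^ k) powr (1 / real k)"
      using h by (intro powr_mono2) auto
    also have "\<dots> = (\<rho> / 8) ^ CARD('m) / real k"
      using k \<rho> by (simp add: powr_powr flip: powr_realpow)
    finally have "real k * h powr (1 / real k) \<le> (\<rho> / 8) ^ CARD('m)" using k by (simp add: field_simps)
    then show ?thesis using h(1) by (simp add: powr_minus field_simps)
  qed
  define g where "g x = (\<chi> i. f x $ i - \<delta> * cos (pi * (x $ \<iota> i) / h))" for x
  have fg: "dist (f x) (g x) \<le> n * \<delta>" for x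
  proof -
    have "norm (f x - g x) \<le> (\<Sum>i\<in>UNIV. \<bar>(f x - g x) $ i\<bar>)" by (rule norm_le_l1_cart)
    also have "\<dots> \<le> (\<Sum>i\<in>(UNIV::'n set). \<delta>)"
      using \<delta>(1) by (intro sum_mono) (simp add: g_def abs_mult)
    finally show ?thesis by (simp add: dist_norm n_def)
  qed
  show ?thesis
  proof (intro exI conjI allI impI ballI)
    show "0 < \<delta> / 4" using \<delta> by simp
    show "continuous_on unit_cube g"
      unfolding g_def using h(1) by (intro continuous_intros f) auto
    show "dist (f x) (g x) \<le> \<epsilon>" for x using fg[of x] \<delta>(2) by simp
    fix f' assume f': "continuous_on unit_cube f'" "\<forall>x\<in>unit_cube. dist (g x) (f' x) \<le> \<delta>/4"
    show "oscillates \<iota> k f'" unfolding oscillates_def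
    \<comment> \<open>The unperturbed \<open>f\<close> serves as the nearby map in
      \<open>oscillates\<close>: near \<open>x\<close> the perturbed maps cross the value
      \<open>f x\<close>.\<close>
    proof (rule exI[of _ f], rule exI[of _ h], intro conjI ballI f h(1,2))
      fix x :: "real^'m" assume x: "x \<in> unit_cube"
      have "dist (f' x) (f x) \<le> \<delta> / 4 + n * \<delta>"
        using f'(2) x fg[of x] dist_triangle2[of "f' x" "f x" "g x"] by (force simp: dist_commute)
      also have "\<dots> \<le> 1 / real k" 
      proof -
        have "2 * (1 / (2 * real k)) = 1 / real k" by simp
        then show ?thesis using \<delta>n \<delta>(1,3) by linarith
      qed
      finally show "dist (f' x) (f x) \<le> 1 / real k" .
      obtain C where C: "finite C" "(\<rho> / (8 * h)) ^ CARD('m) \<le> real (card C)"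
        "\<And>a j. a \<in> C \<Longrightarrow> \<exists>l::nat. a$j = 2 * h * real l"
        "\<And>a z j. a \<in> C \<Longrightarrow> z \<in> cbox a (a + h *\<^sub>R 1) \<Longrightarrow> \<bar>z$j - x$j\<bar> \<le> \<rho> \<and> 0 \<le> z$j \<and> z$j \<le> 1"
        "\<And>a b. a \<in> C \<Longrightarrow> b \<in> C \<Longrightarrow> a \<noteq> b \<Longrightarrow> \<exists>j. 2 * h \<le> \<bar>a$j - b$j\<bar>"
        using cube_grid[OF x \<rho>(1,2) h(1,3)] by metis
      have zx: "z \<in> unit_cube" "dist z x \<le> m * \<rho>" if "a \<in> C" "z \<in> cbox a (a + h *\<^sub>R 1)" for a z
      proof -
        show "z \<in> unit_cube" using C(4)[OF that] by (simp add: mem_box_cart)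
        have "norm (z - x) \<le> (\<Sum>j\<in>UNIV. \<bar>(z - x) $ j\<bar>)" by (rule norm_le_l1_cart)
        also have "\<dots> \<le> (\<Sum>j\<in>(UNIV::'m set). \<rho>)"
          using C(4)[OF that] by (intro sum_mono) simp
        finally show "dist z x \<le> m * \<rho>" by (simp add: dist_norm m_def)
      qed
      show "\<exists>C. finite C \<and> real k \<le> real (card C) * h powr (real CARD('m) - 1 / real k) \<and>
        (\<forall>a\<in>C. crosses \<iota> f' (f x) a h \<and> cbox a (a + h *\<^sub>R 1) \<subseteq> unit_cube \<inter> ball x (1 / real k)) \<and>
        (\<forall>a\<in>C. \<forall>b\<in>C. a \<noteq> b \<longrightarrow> (\<exists>j. 2 * h \<le> \<bar>a$j - b$j\<bar>))"
      proof (intro exI[of _ C] conjI ballI impI)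
        have "real k \<le> (\<rho> / 8) ^ CARD('m) * h powr (- 1 / real k)" by (rule hk)
        also have "\<dots> = (\<rho> / (8 * h)) ^ CARD('m) * h powr (real CARD('m) - 1 / real k)"
          using h(1) by (simp add: powr_diff powr_minus powr_realpow field_simps power_divide power_mult_distrib)
        also have "\<dots> \<le> real (card C) * h powr (real CARD('m) - 1 / real k)"
          using C(2) by (intro mult_right_mono) auto
        finally show "real k \<le> real (card C) * h powr (real CARD('m) - 1 / real k)" .
        fix a assume a: "a \<in> C"
        show "cbox a (a + h *\<^sub>R 1) \<subseteq> unit_cube \<inter> ball x (1 / real k)"
        proof
          fix z assume "z \<in> cbox a (a + h *\<^sub>R 1)"
          then show "z \<in> unit_cube \<inter> ball x (1 / real k)"
            using zx[OF a] \<rho>(4) by (fastforce simp: dist_commute)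
        qed
        show "crosses \<iota> f' (f x) a h" unfolding crosses_def
        proof (intro exI[of _ "\<delta>/4"] conjI ballI allI impI)
          fix z i assume z: "z \<in> cbox a (a + h *\<^sub>R 1)"
          have "dist (f z) (f x) < \<delta> / 2" using \<rho>0(2)[OF x] zx[OF a z] \<rho>(3) by auto
          then have fz: "\<bar>f z $ i - f x $ i\<bar> < \<delta> / 2"
            using component_le_norm_cart[of "f z - f x" i] by (simp add: dist_norm)
          have "dist (g z) (f' z) \<le> \<delta> / 4" using f'(2) zx[OF a z] by blast
          then have gz: "\<bar>g z $ i - f' z $ i\<bar> \<le> \<delta> / 4"
            using component_le_norm_cart[of "g z - f' z" i] by (simp add: dist_norm)
          obtain l :: nat where l: "a $ \<iota> i = 2 * h * real l" using C(3)[OF a] by blast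
          show "f' z $ i \<le> f x $ i - \<delta> / 4" if "z $ \<iota> i = a $ \<iota> i"
          proof -
            have "pi * (z $ \<iota> i) / h = real (2 * l) * pi" using h(1) that l by simp
            then have "cos (pi * (z $ \<iota> i) / h) = 1" by (simp only: cos_npi) simp
            then have "g z $ i = f z $ i - \<delta>" by (simp add: g_def)
            then show ?thesis using fz gz by linarith
          qed
          show "f x $ i + \<delta> / 4 \<le> f' z $ i" if "z $ \<iota> i = a $ \<iota> i + h"
          proof -
            have "pi * (z $ \<iota> i) / h = real (2 * l + 1) * pi" using h(1) that l by (simp add: field_simps)
            then have "cos (pi * (z $ \<iota> i) / h) = -1" by (simp only: cos_npi) simp
            then have "g z $ i = f z $ i + \<delta>" by (simp add: g_def)
            then show ?thesis using fz gz by linarith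
          qed
        qed (use \<delta> in auto)
      qed (use C(1,5) in auto)
    qed
  qed
qed

section \<open>Stable values and packing dimension\<close>

definition stable_value :: "(real^'m \<Rightarrow> real^'n) \<Rightarrow> real^'n \<Rightarrow> (real^'m) set \<Rightarrow> bool" where
  "stable_value f y Z \<longleftrightarrow> (\<exists>\<epsilon>>0. \<forall>h. continuous_on unit_cube h \<longrightarrow>
      (\<forall>x\<in>unit_cube. dist (h x) (f x) \<le> \<epsilon>) \<longrightarrow> y \<in> h ` Z)"

lemma stable_value_mono: "stable_value f y Z \<Longrightarrow> Z \<subseteq> Z' \<Longrightarrow> stable_value f y Z'"
  unfolding stable_value_def by (meson image_mono subsetD)

lemma stable_value_attained:
  "stable_value f y Z \<Longrightarrow> continuous_on unit_cube f \<Longrightarrow> y \<in> f ` Z"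
  unfolding stable_value_def by (metis dist_self less_imp_le)

lemma crosses_stable_value:
  fixes f :: "real^'m \<Rightarrow> real^'n"
  assumes "inj \<iota>" "0 \<le> h" "crosses \<iota> f y a h" "cbox a (a + h *\<^sub>R 1) \<subseteq> unit_cube"
  shows "stable_value f y (cbox a (a + h *\<^sub>R 1))"
proof -
  obtain \<epsilon> where \<epsilon>: "\<epsilon> > 0" "\<And>g. (\<And>x. x \<in> cbox a (a + h *\<^sub>R 1) \<Longrightarrow> dist (g x) (f x) \<le> \<epsilon>) \<Longrightarrow> crosses \<iota> g y a h"
    using crosses_perturb[OF assms(3)] by blast
  show ?thesis unfolding stable_value_def
  proof (intro exI[of _ \<epsilon>] conjI allI impI)
    fix g :: "real^'m \<Rightarrow> real^'n"
    assume g: "continuous_on unit_cube g" "\<forall>x\<in>unit_cube. dist (g x) (f x) \<le> \<epsilon>"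
    have "crosses \<iota> g y a h" using \<epsilon>(2) g(2) assms(4) by blast
    then show "y \<in> g ` cbox a (a + h *\<^sub>R 1)"
      using crosses_attains assms(1,2) continuous_on_subset[OF g(1) assms(4)] by blast
  qed (use \<epsilon> in auto)
qed

text \<open>Once \<open>1 / real k\<close> is below the stability margin of \<open>y\<close>, the
  map \<open>g\<close> from \<open>oscillates\<close> must take the value \<open>y\<close> at some
  \<open>x\<close> in \<open>Z\<close>. The cubes near \<open>x\<close>, crossed at
  \<open>g x\<close>, are then crossed at \<open>y\<close> itself.\<close>

lemma oscillates_stable_value:
  fixes f :: "real^'m \<Rightarrow> real^'n"
  assumes osc: "\<forall>k>0. oscillates \<iota> k f" and Z: "Z \<subseteq> unit_cube" "stable_value f y Z"
  shows "\<exists>k h C x. k0 \<le> k \<and> 0 < k \<and> 0 < h \<and> h < 1 / real k \<and> x \<in> Z \<and> finite C \<and> C \<noteq> {} \<and>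
    real k \<le> real (card C) * h powr (real CARD('m) - 1 / real k) \<and>
    (\<forall>a\<in>C. crosses \<iota> f y a h) \<and>
    (\<forall>a\<in>C. cbox a (a + h *\<^sub>R 1) \<subseteq> unit_cube \<inter> ball x (1 / real k)) \<and>
    (\<forall>a\<in>C. \<forall>b\<in>C. a \<noteq> b \<longrightarrow> (\<exists>j. 2 * h \<le> \<bar>a$j - b$j\<bar>))"
proof -
  obtain \<epsilon> where \<epsilon>: "0 < \<epsilon>" "\<And>h. continuous_on unit_cube h \<Longrightarrow> (\<forall>x\<in>unit_cube. dist (h x) (f x) \<le> \<epsilon>) \<Longrightarrow> y \<in> h ` Z"
    using Z(2) unfolding stable_value_def by blast
  obtain l :: nat where l: "1 / real (Suc l) < \<epsilon>" using \<epsilon>(1) nat_approx_posE by blast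
  define k where "k = max k0 (Suc l)"
  have k: "k0 \<le> k" "0 < k" "1 / real k \<le> 1 / real (Suc l)" by (auto simp: k_def intro!: divide_left_mono)
  obtain g h where g: "continuous_on unit_cube g" "\<forall>x\<in>unit_cube. dist (f x) (g x) \<le> 1 / real k"
    and h: "0 < h" "h < 1 / real k"
    and C: "\<forall>x\<in>unit_cube. \<exists>C. finite C \<and> real k \<le> real (card C) * h powr (real CARD('m) - 1 / real k) \<and>
        (\<forall>a\<in>C. crosses \<iota> f (g x) a h \<and> cbox a (a + h *\<^sub>R 1) \<subseteq> unit_cube \<inter> ball x (1 / real k)) \<and>
        (\<forall>a\<in>C. \<forall>b\<in>C. a \<noteq> b \<longrightarrow> (\<exists>j. 2 * h \<le> \<bar>a$j - b$j\<bar>))"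
    using osc[rule_format, OF k(2)] unfolding oscillates_def by (elim exE conjE) (rule that)
  have "\<forall>x\<in>unit_cube. dist (g x) (f x) \<le> \<epsilon>" using g(2) k(3) l by (auto simp: dist_commute intro: order_trans less_imp_le)
  then have "y \<in> g ` Z" by (rule \<epsilon>(2)[OF g(1)])
  then obtain x where x: "x \<in> Z" "y = g x" by blast
  have "x \<in> unit_cube" using x Z by blast
  then obtain C where C: "finite C" "real k \<le> real (card C) * h powr (real CARD('m) - 1 / real k)"
        "\<forall>a\<in>C. crosses \<iota> f (g x) a h \<and> cbox a (a + h *\<^sub>R 1) \<subseteq> unit_cube \<inter> ball x (1 / real k)"
        "\<forall>a\<in>C. \<forall>b\<in>C. a \<noteq> b \<longrightarrow> (\<exists>j. 2 * h \<le> \<bar>a$j - b$j\<bar>)"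
    using C by meson
  moreover have "C \<noteq> {}" using C(2) k(2) by auto
  ultimately show ?thesis
    using k h x by (intro exI[of _ k] exI[of _ h] exI[of _ C] exI[of _ x]) auto
qed

section \<open>The core of a fiber\<close>

definition stable_core :: "(real^'m \<Rightarrow> real^'n) \<Rightarrow> real^'n \<Rightarrow> (real^'m) set" where
  "stable_core f y = {x \<in> unit_cube. \<forall>r>0. stable_value f y (unit_cube \<inter> cball x r)}"

lemma closed_stable_core: "closed (stable_core f y)"
  unfolding closed_sequential_limits
proof (intro allI impI)
  fix x l assume xl: "(\<forall>n. x n \<in> stable_core f y) \<and> x \<longlonglongrightarrow> l"
  have "l \<in> unit_cube"
    using xl closed_cbox[of 0 1] by (auto simp: stable_core_def intro: closed_sequentially)
  moreover have "stable_value f y (unit_cube \<inter> cball l r)" if r: "0 < r" for r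
  proof -
    obtain n where n: "dist (x n) l < r / 2"
      using xl r by (metis half_gt_zero metric_LIMSEQ_D order_refl)
    have "cball (x n) (r/2) \<subseteq> cball l r"
    proof
      fix z assume "z \<in> cball (x n) (r/2)"
      then show "z \<in> cball l r" using n dist_triangle3[of l z "x n"] by simp
    qed
    moreover have "stable_value f y (unit_cube \<inter> cball (x n) (r/2))"
      using xl r by (simp add: stable_core_def)
    ultimately show ?thesis by (meson Int_mono order_refl stable_value_mono)
  qed
  ultimately show "l \<in> stable_core f y" by (simp add: stable_core_def)
qed

lemma stable_core_subset_fiber:
  assumes f: "continuous_on unit_cube f"
  shows "stable_core f y \<subseteq> f -` {y} \<inter> unit_cube"
proof
  fix x assume x: "x \<in> stable_core f y"
  then have xK: "x \<in> unit_cube" by (simp add: stable_core_def)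
  have "dist y (f x) \<le> e" if "0 < e" for e
  proof -
    obtain d where d: "d > 0" "\<And>z. z \<in> unit_cube \<Longrightarrow> dist z x < d \<Longrightarrow> dist (f z) (f x) < e"
      using f xK \<open>0 < e\<close> unfolding continuous_on_iff by metis
    have "stable_value f y (unit_cube \<inter> cball x (d/2))" using x d(1) by (simp add: stable_core_def)
    then obtain z where "z \<in> unit_cube \<inter> cball x (d/2)" "y = f z"
      using stable_value_attained[OF _ f] by blast
    then show ?thesis using d by (force simp: dist_commute)
  qed
  then have "dist y (f x) \<le> 0" by (rule dense_ge)
  then show "x \<in> f -` {y} \<inter> unit_cube" using xK by simp
qed

text \<open>Nested boxes with faces crossed by \<open>f\<close> shrink to a point of the core.\<close>

lemma stable_core_near:
  fixes f :: "real^'m \<Rightarrow> real^'n"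
  assumes \<iota>: "inj \<iota>" and osc: "\<forall>k>0. oscillates \<iota> k f"
    and Z: "Z \<subseteq> unit_cube" "stable_value f y Z" and \<tau>: "0 < \<tau>"
  obtains x z where "x \<in> stable_core f y" "z \<in> Z" "dist z x \<le> \<tau>"
proof -
  \<comment> \<open>A set on which \<open>y\<close> is stable has a crossed cube arbitrarily near
    one of its points, and on that small cube \<open>y\<close> is stable again; so the step can be
    iterated.\<close>
  have step: "\<exists>x r z. x \<in> unit_cube \<and> 0 < r \<and> r \<le> e \<and> stable_value f y (unit_cube \<inter> cball x r) \<and> z \<in> W \<and> dist z x \<le> e"
    if W: "W \<subseteq> unit_cube" "stable_value f y W" and e: "0 < e" for W e
  proof -
    obtain k0 :: nat where k0: "1 / real (Suc k0) < e / 2" using e nat_approx_posE[of "e/2"] by auto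
    obtain k h C z where kh: "Suc k0 \<le> k" "0 < k" "0 < h" "z \<in> W" "C \<noteq> {}"
      and cr: "\<And>a. a \<in> C \<Longrightarrow> crosses \<iota> f y a h"
      and bx: "\<And>a. a \<in> C \<Longrightarrow> cbox a (a + h *\<^sub>R 1) \<subseteq> unit_cube \<inter> ball z (1 / real k)"
      using oscillates_stable_value[OF osc W, of "Suc k0"] by metis
    obtain a where a: "a \<in> C" using kh by blast
    have ke: "1 / real k < e / 2"
      using k0 kh(1) by (smt (verit) frac_le of_nat_le_iff of_nat_0_less_iff zero_less_Suc)
    have aa: "a \<in> cbox a (a + h *\<^sub>R 1)" using kh(3) by (simp add: mem_box_cart)
    then have az: "a \<in> unit_cube" "dist z a < 1 / real k" using bx[OF a] by auto
    have "cbox a (a + h *\<^sub>R 1) \<subseteq> unit_cube \<inter> cball a e"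
    proof
      fix w assume "w \<in> cbox a (a + h *\<^sub>R 1)"
      then have "w \<in> unit_cube" "dist z w < 1 / real k" using bx[OF a] by auto
      then show "w \<in> unit_cube \<inter> cball a e"
        using az ke dist_triangle3[of a w z] by simp
    qed
    moreover have "stable_value f y (cbox a (a + h *\<^sub>R 1))"
      using crosses_stable_value[OF \<iota> _ cr[OF a]] bx[OF a] kh(3) by auto
    ultimately have "stable_value f y (unit_cube \<inter> cball a e)" by (rule stable_value_mono[rotated])
    then show ?thesis using az ke kh(4) e by (intro exI[of _ a] exI[of _ e] exI[of _ z]) auto
  qed
  \<comment> \<open>The first step costs \<open>\<sigma>\<close> and the geometric tail
    \<open>4 * \<sigma>\<close>, together less than \<open>\<tau>\<close>.\<close>
  define \<sigma> where "\<sigma> = \<tau> / 8"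
  have \<sigma>: "0 < \<sigma>" using \<tau> by (simp add: \<sigma>_def)
  obtain x0 r0 z where init: "x0 \<in> unit_cube" "0 < r0" "r0 \<le> \<sigma>" "stable_value f y (unit_cube \<inter> cball x0 r0)"
      "z \<in> Z" "dist z x0 \<le> \<sigma>"
    using step[OF Z \<sigma>] by blast
  \<comment> \<open>The clause for \<open>n = 0\<close> fixes the start, so that the limit can be
    compared with the point \<open>z\<close> of \<open>Z\<close>.\<close>
  let ?P = "\<lambda>n p. fst p \<in> unit_cube \<and> 0 < snd p \<and> snd p \<le> \<sigma> * (1/2)^n \<and>
      stable_value f y (unit_cube \<inter> cball (fst p) (snd p)) \<and> (n = 0 \<longrightarrow> p = (x0, r0))"
  have "\<exists>s. \<forall>n. ?P n (s n) \<and> dist (fst (s n)) (fst (s (Suc n))) \<le> 2 * \<sigma> * (1/2)^n"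
  proof (rule dependent_nat_choice)
    show "\<exists>p. ?P 0 p" using init by auto
    fix p n assume p: "?P n p"
    obtain x r w where x: "x \<in> unit_cube" "0 < r" "r \<le> \<sigma> * (1/2)^(Suc n)" "stable_value f y (unit_cube \<inter> cball x r)"
      "w \<in> unit_cube \<inter> cball (fst p) (snd p)" "dist w x \<le> \<sigma> * (1/2)^(Suc n)"
      using step[of "unit_cube \<inter> cball (fst p) (snd p)" "\<sigma> * (1/2)^(Suc n)"] p \<sigma> by auto
    have "dist (fst p) x \<le> snd p + \<sigma> * (1/2)^(Suc n)"
      using x(5,6) dist_triangle[of "fst p" x w] by simp
    moreover have "\<sigma> * (1/2)^(Suc n) \<le> \<sigma> * (1/2)^n" using \<sigma> by simp
    ultimately have "dist (fst p) x \<le> 2 * \<sigma> * (1/2)^n" using p by linarith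
    then show "\<exists>q. ?P (Suc n) q \<and> dist (fst p) (fst q) \<le> 2 * \<sigma> * (1/2)^n"
      using x by (intro exI[of _ "(x, r)"]) auto
  qed
  then obtain s where P: "\<And>n. ?P n (s n)" and d: "\<And>n. dist (fst (s n)) (fst (s (Suc n))) \<le> 2 * \<sigma> * (1/2)^n"
    by blast
  define x where "x n = fst (s n)" for n
  have dist_np: "dist (x n) (x (n + p)) \<le> 4 * \<sigma> * ((1/2)^n - (1/2)^(n+p))" for n p
  proof (induction p)
    case (Suc p)
    have "dist (x n) (x (n + Suc p)) \<le> dist (x n) (x (n + p)) + dist (x (n + p)) (x (Suc (n + p)))"
      by (simp add: dist_triangle)
    also have "\<dots> \<le> 4 * \<sigma> * ((1/2)^n - (1/2)^(n+p)) + 2 * \<sigma> * (1/2)^(n+p)"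
      using Suc d[of "n+p"] by (simp add: x_def)
    also have "\<dots> = 4 * \<sigma> * ((1/2)^n - (1/2)^(n+Suc p))" by (simp add: algebra_simps)
    finally show ?case .
  qed simp
  have dist_nm: "dist (x n) (x k) \<le> 4 * \<sigma> * (1/2)^n" if "n \<le> k" for n k
  proof -
    have "4 * \<sigma> * ((1/2)^n - (1/2)^k) \<le> 4 * \<sigma> * (1/2)^n" using \<sigma> by (intro mult_left_mono) auto
    then show ?thesis using dist_np[of n "k - n"] that by simp
  qed
  have lim0: "(\<lambda>n. c * \<sigma> * (1/2)^n) \<longlonglongrightarrow> 0" for c
    by (intro tendsto_mult_right_zero LIMSEQ_realpow_zero) auto
  have "Cauchy x"
  proof (rule metric_CauchyI)
    fix e :: real assume "0 < e"
    then have "\<forall>\<^sub>F n in sequentially. 8 * \<sigma> * (1/2)^n < e" using lim0[of 8] by (intro order_tendstoD(2))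
    then obtain N where N: "8 * \<sigma> * (1/2)^N < e" by (meson eventually_sequentially order_refl)
    have "dist (x n) (x k) < e" if "N \<le> n" "N \<le> k" for n k
      using dist_nm[OF that(1)] dist_nm[OF that(2)] dist_triangle3[of "x n" "x k" "x N"] N by simp
    then show "\<exists>M. \<forall>m\<ge>M. \<forall>n\<ge>M. dist (x m) (x n) < e" by blast
  qed
  then obtain l where l: "x \<longlonglongrightarrow> l" using Cauchy_convergent_iff convergent_def by blast
  have xl: "dist (x n) l \<le> 4 * \<sigma> * (1/2)^n" for n
  proof (rule tendsto_upperbound)
    show "(\<lambda>k. dist (x n) (x k)) \<longlonglongrightarrow> dist (x n) l" by (intro tendsto_intros l)
    show "\<forall>\<^sub>F k in sequentially. dist (x n) (x k) \<le> 4 * \<sigma> * (1/2)^n"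
      using dist_nm by (auto simp: eventually_sequentially)
  qed simp
  have "l \<in> unit_cube"
    using P l closed_cbox by (metis closed_sequentially x_def)
  moreover have "stable_value f y (unit_cube \<inter> cball l r)" if r: "0 < r" for r
  proof -
    have "\<forall>\<^sub>F n in sequentially. 5 * \<sigma> * (1/2)^n < r" using lim0[of 5] r by (intro order_tendstoD(2))
    then obtain n where n: "5 * \<sigma> * (1/2)^n < r" by (meson eventually_sequentially order_refl)
    have sn: "snd (s n) \<le> \<sigma> * (1/2)^n" "stable_value f y (unit_cube \<inter> cball (x n) (snd (s n)))"
      using P[of n] by (auto simp: x_def)
    have "cball (x n) (snd (s n)) \<subseteq> cball l r"
    proof
      fix w assume "w \<in> cball (x n) (snd (s n))"
      then show "w \<in> cball l r" using dist_triangle3[of l w "x n"] xl[of n] sn(1) n by simp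
    qed
    then show ?thesis using sn(2) by (meson Int_mono order_refl stable_value_mono)
  qed
  ultimately have "l \<in> stable_core f y" by (simp add: stable_core_def)
  moreover have "dist z l \<le> \<tau>"
  proof -
    have "x 0 = x0" using P[of 0] by (simp add: x_def)
    then show ?thesis using xl[of 0] init(6) dist_triangle[of z l x0] \<tau> by (simp add: \<sigma>_def)
  qed
  ultimately show thesis using that init(5) by blast
qed

text \<open>A cover of the fiber with total premeasure below 1 is refuted. By Baire's theorem one
  \<open>closure (B i)\<close> contains a relatively open part of the core; crossed cubes near that
  part carry balls centred in \<open>B i\<close> that form a packing of cost at least 1.\<close>

lemma packing_measure_fiber_nonzero:
  fixes f :: "real^'m \<Rightarrow> real^'n"
  assumes \<iota>: "inj \<iota>" and osc: "\<forall>k>0. oscillates \<iota> k f" and f: "continuous_on unit_cube f"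
    and st: "stable_value f y unit_cube" and s: "0 \<le> s" "s < real CARD('m)"
  shows "packing_measure s (f -` {y} \<inter> unit_cube) \<noteq> 0"
proof
  let ?K = "unit_cube :: (real^'m) set" and ?S = "stable_core f y"
  assume "packing_measure s (f -` {y} \<inter> ?K) = 0"
  then have "packing_measure s (f -` {y} \<inter> ?K) < 1" by simp
  then obtain B :: "nat \<Rightarrow> (real^'m) set" where B: "f -` {y} \<inter> ?K \<subseteq> (\<Union>i. B i)" "(\<Sum>i. packing_premeasure s (B i)) < 1"
    unfolding packing_measure_def INF_less_iff by blast
  obtain x0 where x0: "x0 \<in> ?S" using stable_core_near[OF \<iota> osc order_refl st, of 1] by auto
  \<comment> \<open>If all the relatively open sets \<open>?S - closure (B i)\<close> were dense in
    the closed core, so would be their intersection; but that is empty because the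
    \<open>B i\<close> cover the fiber.\<close>
  have "\<exists>i. \<not> ?S \<subseteq> closure (?S - closure (B i))"
  proof (rule ccontr)
    assume "\<nexists>i. \<not> ?S \<subseteq> closure (?S - closure (B i))"
    then have "?S \<subseteq> closure (\<Inter>(range (\<lambda>i. ?S - closure (B i))))"
      by (intro Baire closed_stable_core) (auto simp: Diff_eq intro!: openin_open_Int)
    moreover have "\<Inter>(range (\<lambda>i. ?S - closure (B i))) = {}"
    proof (rule equals0I)
      fix z assume z: "z \<in> \<Inter>(range (\<lambda>i. ?S - closure (B i)))"
      then have "z \<in> f -` {y} \<inter> ?K" using stable_core_subset_fiber[OF f, of y] by blast
      then obtain i where "z \<in> B i" using B(1) by blast
      then show False using z closure_subset[of "B i"] by blast
    qed
    ultimately have "?S \<subseteq> closure {}" by (simp only:)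
    then show False using x0 by simp
  qed
  then obtain i x where x: "x \<in> ?S" "x \<notin> closure (?S - closure (B i))" by blast
  have "\<not> (\<forall>e>0. \<exists>z\<in>?S - closure (B i). dist z x < e)"
    using x(2) unfolding closure_approachable[of x "?S - closure (B i)"] .
  then obtain \<rho> where \<rho>: "0 < \<rho>" "\<And>z. z \<in> ?S \<Longrightarrow> dist z x < \<rho> \<Longrightarrow> z \<in> closure (B i)"
    by blast
  have "1 \<le> packing_premeasure s (B i)"
    unfolding packing_premeasure_def
  proof (rule INF_greatest)
    fix \<delta> :: real assume "\<delta> \<in> {0<..}"
    then have \<delta>: "0 < \<delta>" by simp
    let ?Z = "?K \<inter> cball x (\<rho>/2)"
    have Z: "?Z \<subseteq> ?K" "stable_value f y ?Z" using x(1) \<rho>(1) by (auto simp: stable_core_def)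
    \<comment> \<open>With \<open>1 / real k\<close> below \<open>t\<close>, the cubes stay in the
      ball of radius \<open>\<rho>\<close> where the core lies in \<open>closure (B i)\<close>, the
      balls respect \<open>\<delta>\<close>, and the exponent \<open>m - 1 / real k\<close> is at
      least \<open>s\<close>.\<close>
    define t where "t = Min {\<rho> / 8, \<delta>, real CARD('m) - s}"
    have t: "0 < t" "t \<le> \<rho> / 8" "t \<le> \<delta>" "t \<le> real CARD('m) - s" 
    proof -
      show "0 < t" unfolding t_def using \<rho>(1) \<delta> s by (subst Min_gr_iff) auto
      show "t \<le> \<rho> / 8" "t \<le> \<delta>" "t \<le> real CARD('m) - s" unfolding t_def by (rule Min_le; simp)+
    qed
    obtain k1 :: nat where k1: "1 / real (Suc k1) < t" using t(1) nat_approx_posE by blast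
    \<comment> \<open>The bound \<open>4 ^ CARD('m) \<le> k\<close> will absorb the factor
      \<open>4 powr s\<close> caused by balls of diameter \<open>h / 4\<close>.\<close>
    obtain k h C z where kh: "max (Suc k1) (4 ^ CARD('m)) \<le> k" "0 < k" "0 < h" "h < 1 / real k"
      and zZ: "z \<in> ?Z" and C: "finite C" "C \<noteq> {}"
        "real k \<le> real (card C) * h powr (real CARD('m) - 1 / real k)"
      and cr: "\<And>a. a \<in> C \<Longrightarrow> crosses \<iota> f y a h"
      and bx: "\<And>a. a \<in> C \<Longrightarrow> cbox a (a + h *\<^sub>R 1) \<subseteq> unit_cube \<inter> ball z (1 / real k)"
      and sep: "\<And>a b. a \<in> C \<Longrightarrow> b \<in> C \<Longrightarrow> a \<noteq> b \<Longrightarrow> \<exists>j. 2 * h \<le> \<bar>a$j - b$j\<bar>"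
      using oscillates_stable_value[OF osc Z, of "max (Suc k1) (4 ^ CARD('m))"] by metis
    have kt: "1 / real k < t"
      using k1 kh(1) by (smt (verit) frac_le of_nat_le_iff of_nat_0_less_iff zero_less_Suc max.bounded_iff)
    \<comment> \<open>The core comes within \<open>h/16\<close> of each crossed cube, and
      \<open>B i\<close>, which is only dense near that core point, within another
      \<open>h/16\<close>.\<close>
    have "\<exists>p w. p \<in> B i \<and> w \<in> cbox a (a + h *\<^sub>R 1) \<and> dist w p \<le> h / 8" if a: "a \<in> C" for a
    proof -
      have "stable_value f y (cbox a (a + h *\<^sub>R 1))"
        using crosses_stable_value[OF \<iota> _ cr[OF a]] bx[OF a] kh(3) by auto
      then obtain u w where u: "u \<in> ?S" "w \<in> cbox a (a + h *\<^sub>R 1)" "dist w u \<le> h/16"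
        using stable_core_near[OF \<iota> osc _ _, of "cbox a (a + h *\<^sub>R 1)" y "h/16"] bx[OF a] kh(3) by auto
      have "dist z w < 1 / real k" using bx[OF a] u(2) by auto
      moreover have "dist x z \<le> \<rho> / 2" using zZ by simp
      ultimately have "dist u x < \<rho>"
        using u(3) kt t(2) kh(3,4) \<rho>(1) dist_triangle[of x w z] dist_triangle[of x u w]
        by (simp add: dist_commute)
      then have "u \<in> closure (B i)" using \<rho>(2) u(1) by blast
      then obtain p where p: "p \<in> B i" "dist p u < h/16"
        using kh(3) unfolding closure_approachable by (metis divide_pos_pos zero_less_numeral)
      then have "dist w p \<le> h / 8" using u(3) dist_triangle2[of w p u] by simp
      then show ?thesis using p u by blast
    qed
    then obtain p w where pw: "\<And>a. a \<in> C \<Longrightarrow> p a \<in> B i \<and> w a \<in> cbox a (a + h *\<^sub>R 1) \<and> dist (w a) (p a) \<le> h / 8"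
      by metis
    \<comment> \<open>Points of different cubes are \<open>h\<close> apart and each centre is
      \<open>h / 8\<close> off its cube, which leaves \<open>3 * h / 4\<close>, more than the two
      radii \<open>h / 8\<close> together.\<close>
    have pd: "3 * h / 4 \<le> dist (p a) (p b)" if ab: "a \<in> C" "b \<in> C" "a \<noteq> b" for a b
    proof -
      obtain j where j: "2 * h \<le> \<bar>a$j - b$j\<bar>" using sep[OF ab] by blast
      have "a$j \<le> w a$j" "w a$j \<le> a$j + h" "b$j \<le> w b$j" "w b$j \<le> b$j + h"
        using pw[OF ab(1)] pw[OF ab(2)] by (auto simp: mem_box_cart)
      then have "h \<le> \<bar>(w a - w b)$j\<bar>" using j by (simp add: abs_if split: if_splits)
      also have "\<dots> \<le> dist (w a) (w b)" by (simp add: dist_norm component_le_norm_cart del: vector_minus_component)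
      also have "\<dots> \<le> dist (w a) (p a) + dist (p a) (p b) + dist (w b) (p b)"
        using dist_triangle[of "w a" "w b" "p a"] dist_triangle2[of "p a" "w b" "p b"] by simp
      finally show ?thesis using pw[OF ab(1)] pw[OF ab(2)] by simp
    qed
    have injp: "inj_on (\<lambda>a. (p a, h/8)) C"
    proof (rule inj_onI)
      fix a b assume "a \<in> C" "b \<in> C" "(p a, h/8) = (p b, h/8)"
      then show "a = b" using pd[of a b] kh(3) by fastforce
    qed
    let ?P = "(\<lambda>a. (p a, h/8)) ` C"
    have "?P \<in> packings \<delta> (B i)"
    proof -
      have "cball (p a) (h/8) \<inter> cball (p b) (h/8) = {}" if "a \<in> C" "b \<in> C" "a \<noteq> b" for a b
      proof (rule equals0I)
        fix v assume "v \<in> cball (p a) (h/8) \<inter> cball (p b) (h/8)"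
        then show False using dist_triangle2[of "p a" "p b" v] pd[OF that] kh(3) by simp
      qed
      then have "disjoint_family_on (\<lambda>(x, r). cball x r) ?P"
        unfolding disjoint_family_on_def by fastforce
      then show ?thesis using C(1) pw kh(3,4) kt t(3)
        by (auto simp: packings_def intro: countable_finite)
    qed
    moreover have "1 \<le> (\<Sum>\<^sub>\<infinity>(x, r)\<in>?P. ennreal ((2 * r) powr s))"
    proof -
      have "(\<Sum>\<^sub>\<infinity>(x, r)\<in>?P. ennreal ((2 * r) powr s)) = (\<Sum>(x, r)\<in>?P. ennreal ((2 * r) powr s))"
        using C(1) by (intro infsum_finite) auto
      also have "\<dots> = (\<Sum>a\<in>C. ennreal ((h/4) powr s))"
        by (subst sum.reindex[OF injp]) simp
      also have "\<dots> = ennreal (real (card C) * (h/4) powr s)"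
        by (simp add: ennreal_mult ennreal_of_nat_eq_real_of_nat)
      finally have eq: "(\<Sum>\<^sub>\<infinity>(x, r)\<in>?P. ennreal ((2 * r) powr s)) = ennreal (real (card C) * (h/4) powr s)" .
      have "4 powr s \<le> 4 powr real CARD('m)" using s by (intro powr_mono) auto
      also have "\<dots> = real (4 ^ CARD('m))" by (simp add: powr_realpow)
      also have "\<dots> \<le> real k" using kh(1) by (simp only: of_nat_le_iff max.bounded_iff)
      also have "\<dots> \<le> real (card C) * h powr (real CARD('m) - 1 / real k)" by (rule C(3))
      also have "\<dots> \<le> real (card C) * h powr s"
      proof (intro mult_left_mono powr_mono')
        have "1 / real k \<le> 1" using kh(2) by simp
        then show "h \<le> 1" using kh(4) by linarith
      qed (use kt t(4) kh(3) in auto)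
      finally have "4 powr s \<le> real (card C) * h powr s" .
      then have "1 \<le> real (card C) * (h/4) powr s" using kh(3) by (simp add: powr_divide field_simps)
      then show ?thesis unfolding eq by (metis ennreal_1 ennreal_leI)
    qed
    ultimately show "1 \<le> (SUP P\<in>packings \<delta> (B i). \<Sum>\<^sub>\<infinity>(x, r)\<in>P. ennreal ((2 * r) powr s))"
      by (rule SUP_upper2)
  qed
  also have "\<dots> \<le> (\<Sum>i. packing_premeasure s (B i))"
    using sum_le_suminf[of "\<lambda>i. packing_premeasure s (B i)" "{i}"] by simp
  finally show False using B(2) by simp
qed

text \<open>Comparing volumes, disjoint balls near a bounded set have bounded sum of
  \<open>r ^ DIM('a)\<close>. The surplus exponent contributes
  \<open>\<delta> powr (s - DIM('a))\<close>, which tends to 0 with \<open>\<delta>\<close>.\<close>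

lemma packing_measure_eq_0:
  fixes A :: "'a::euclidean_space set"
  assumes A: "bounded A" and s: "real DIM('a) < s"
  shows "packing_measure s A = 0"
proof -
  obtain R where R: "0 < R" "\<And>x. x \<in> A \<Longrightarrow> norm x \<le> R" using A bounded_pos by blast
  let ?n = "DIM('a)"
  have fin: "(\<Sum>(x, r)\<in>F. (2 * r) powr s) \<le> \<delta> powr (s - real ?n) * (2 * (R + 1)) ^ ?n"
    if P: "P \<in> packings \<delta> A" and F: "finite F" "F \<subseteq> P" and \<delta>: "0 < \<delta>" "\<delta> \<le> 1" for F P \<delta>
  proof -
    have xr: "x \<in> A" "0 < r" "2 * r \<le> \<delta>" if "(x, r) \<in> F" for x r
      using P F that by (auto simp: packings_def)
    have dj: "disjoint_family_on (\<lambda>(x, r). cball x r) F"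
      using P F by (auto simp: packings_def intro: disjoint_family_on_mono)
    have sub: "(\<Union>(x, r)\<in>F. cball x r) \<subseteq> cball 0 (R + 1)"
    proof clarify
      fix x r z assume xrF: "(x, r) \<in> F" and z: "z \<in> cball x r"
      have "norm z \<le> norm x + dist x z" using norm_triangle_sub[of z x] by (simp add: dist_norm norm_minus_commute)
      then show "z \<in> cball 0 (R + 1)" using z R(2)[OF xr(1)[OF xrF]] xr[OF xrF] \<delta> by simp
    qed
    let ?c = "unit_ball_vol (real ?n)"
    have c: "0 < ?c" by simp
    have cb: "measure lborel (cball x r) = ?c * r ^ ?n" if "0 \<le> r" for x :: 'a and r
      using content_cball[OF that, of x] by simp
    have fin_ball: "emeasure lborel (cball x r) \<noteq> top" for x :: 'a and r
      using emeasure_bounded_finite[OF bounded_cball, of x r] by simp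
    have "?c * (\<Sum>(x, r)\<in>F. r ^ ?n) = (\<Sum>p\<in>F. measure lborel (case p of (x, r) \<Rightarrow> cball x r))"
      unfolding sum_distrib_left
    proof (intro sum.cong refl)
      fix p assume p: "p \<in> F"
      obtain x r where xrp: "p = (x, r)" by (cases p)
      then have "0 \<le> r" using xr(2)[of x r] p by simp
      then show "?c * (case p of (x, r) \<Rightarrow> r ^ ?n) = measure lborel (case p of (x, r) \<Rightarrow> cball x r)"
        using cb[of r x] xrp by simp
    qed
    also have "\<dots> = measure lborel (\<Union>(x, r)\<in>F. cball x r)"
      by (intro measure_finite_Union[symmetric] F(1) dj) (auto simp: fin_ball split: prod.splits)
    also have "\<dots> \<le> measure lborel (cball 0 (R + 1) :: 'a set)"
      using sub F(1)
      by (intro measure_mono_fmeasurable fmeasurableI emeasure_bounded_finite bounded_cball) auto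
    also have "\<dots> = ?c * (R + 1) ^ ?n" using R(1) by (intro cb) simp
    finally have vol: "(\<Sum>(x, r)\<in>F. r ^ ?n) \<le> (R + 1) ^ ?n" using c by simp
    have "(\<Sum>(x, r)\<in>F. (2 * r) powr s) \<le> (\<Sum>(x, r)\<in>F. \<delta> powr (s - real ?n) * (2 ^ ?n * r ^ ?n))"
    proof (intro sum_mono, clarify)
      fix x r assume "(x, r) \<in> F"
      then have r: "0 < r" "2 * r \<le> \<delta>" using xr by auto
      have "(2 * r) powr s = (2 * r) powr (s - real ?n) * (2 * r) ^ ?n"
        using r by (simp add: powr_diff powr_realpow)
      also have "\<dots> \<le> \<delta> powr (s - real ?n) * (2 * r) ^ ?n"
        using r s by (intro mult_right_mono powr_mono2) auto
      finally show "(2 * r) powr s \<le> \<delta> powr (s - real ?n) * (2 ^ ?n * r ^ ?n)" by (simp add: power_mult_distrib)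
    qed
    also have "\<dots> = \<delta> powr (s - real ?n) * 2 ^ ?n * (\<Sum>(x, r)\<in>F. r ^ ?n)"
      unfolding sum_distrib_left by (intro sum.cong) auto
    also have "\<dots> \<le> \<delta> powr (s - real ?n) * 2 ^ ?n * (R + 1) ^ ?n"
      using vol by (intro mult_left_mono) auto
    finally show ?thesis by (simp only: power_mult_distrib mult.assoc)
  qed
  have pre: "packing_premeasure s A \<le> ennreal (\<delta> powr (s - real ?n) * (2 * (R + 1)) ^ ?n)" if \<delta>: "0 < \<delta>" "\<delta> \<le> 1" for \<delta>
    unfolding packing_premeasure_def
  proof (rule INF_lower2[of \<delta>])
    show "(SUP P\<in>packings \<delta> A. \<Sum>\<^sub>\<infinity>(x, r)\<in>P. ennreal ((2 * r) powr s)) \<le> ennreal (\<delta> powr (s - real ?n) * (2 * (R + 1)) ^ ?n)"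
    proof (rule SUP_least)
      fix P assume P: "P \<in> packings \<delta> A"
      show "(\<Sum>\<^sub>\<infinity>(x, r)\<in>P. ennreal ((2 * r) powr s)) \<le> ennreal (\<delta> powr (s - real ?n) * (2 * (R + 1)) ^ ?n)"
      proof (subst nonneg_infsum_complete, simp, rule SUP_least)
        fix F assume "F \<in> {F. finite F \<and> F \<subseteq> P}"
        then have F: "finite F" "F \<subseteq> P" by auto
        have "(\<Sum>p\<in>F. case p of (x, r) \<Rightarrow> ennreal ((2 * r) powr s)) = (\<Sum>p\<in>F. ennreal (case p of (x, r) \<Rightarrow> (2 * r) powr s))"
          by (intro sum.cong) auto
        also have "\<dots> = ennreal (\<Sum>(x, r)\<in>F. (2 * r) powr s)"
          by (intro sum_ennreal) auto
        also have "\<dots> \<le> ennreal (\<delta> powr (s - real ?n) * (2 * (R + 1)) ^ ?n)"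
          by (intro ennreal_leI fin[OF P F \<delta>])
        finally show "(\<Sum>p\<in>F. case p of (x, r) \<Rightarrow> ennreal ((2 * r) powr s)) \<le> ennreal (\<delta> powr (s - real ?n) * (2 * (R + 1)) ^ ?n)" .
      qed
    qed
  qed (use \<delta> in auto)
  have "packing_premeasure s A \<le> 0 + ennreal e" if e: "0 < e" for e
  proof -
    have "((\<lambda>\<delta>. \<delta> powr (s - real ?n) * (2 * (R + 1)) ^ ?n) \<longlongrightarrow> 0 * (2 * (R + 1)) ^ ?n) (at_right 0)"
    proof (intro tendsto_intros)
      show "((\<lambda>\<delta>. \<delta> powr (s - real ?n)) \<longlongrightarrow> 0) (at_right 0)"
        by (rule tendsto_zero_powrI[OF tendsto_ident_at tendsto_const])
          (use s in \<open>auto simp: eventually_at_filter\<close>)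
    qed
    then have "\<forall>\<^sub>F \<delta> in at_right 0. \<delta> powr (s - real ?n) * (2 * (R + 1)) ^ ?n < e"
      using e by (intro order_tendstoD(2)) auto
    moreover have "\<forall>\<^sub>F \<delta>::real in at_right 0. 0 < \<delta> \<and> \<delta> \<le> 1"
      by (auto simp: eventually_at_right_field intro!: exI[of _ 1])
    ultimately have "\<forall>\<^sub>F \<delta> in at_right 0. (0 < \<delta> \<and> \<delta> \<le> 1) \<and> \<delta> powr (s - real ?n) * (2 * (R + 1)) ^ ?n < e"
      by eventually_elim auto
    then obtain \<delta> where "0 < \<delta>" "\<delta> \<le> 1" "\<delta> powr (s - real ?n) * (2 * (R + 1)) ^ ?n < e"
      using eventually_happens' trivial_limit_at_right_real by (metis (no_types, lifting))
    then have "packing_premeasure s A \<le> ennreal e"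
      using order_trans[OF pre ennreal_leI] by (meson less_imp_le)
    then show ?thesis by simp
  qed
  then have "packing_premeasure s A = 0" by (metis ennreal_le_epsilon le_zero_eq)
  moreover have "packing_measure s A \<le> (\<Sum>i::nat. packing_premeasure s A)"
    unfolding packing_measure_def by (rule INF_lower) auto
  ultimately show ?thesis by simp
qed

lemma packing_dim_fiber:
  fixes f :: "real^'m \<Rightarrow> real^'n"
  assumes "inj \<iota>" "\<forall>k>0. oscillates \<iota> k f" "continuous_on unit_cube f" "stable_value f y unit_cube"
  shows "packing_dim (f -` {y} \<inter> unit_cube) = ereal (real CARD('m))"
  unfolding packing_dim_def
proof (rule antisym)
  let ?A = "f -` {y} \<inter> unit_cube" and ?m = "real CARD('m)"
  show "(INF s\<in>{s. 0 \<le> s \<and> packing_measure s ?A = 0}. ereal s) \<le> ereal ?m"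
  proof (rule ereal_le_epsilon2)
    fix e :: real assume "0 < e"
    moreover have "bounded ?A" by (meson bounded_cbox bounded_subset inf_le2)
    ultimately have "packing_measure (?m + e) ?A = 0" by (intro packing_measure_eq_0) auto
    then show "(INF s\<in>{s. 0 \<le> s \<and> packing_measure s ?A = 0}. ereal s) \<le> ereal ?m + ereal e"
      using \<open>0 < e\<close> by (intro INF_lower2[of "?m + e"]) auto
  qed
  show "ereal ?m \<le> (INF s\<in>{s. 0 \<le> s \<and> packing_measure s ?A = 0}. ereal s)"
    using packing_measure_fiber_nonzero[OF assms] by (intro INF_greatest) (force simp: not_less[symmetric])
qed

section \<open>Dense maps with thin fibers\<close>

text \<open>Vectors are chosen one by one. The new one only has to avoid the spans of subfamilies
  with fewer than \<open>DIM('a)\<close> members: finitely many proper subspaces, a negligible set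
  that cannot contain a ball.\<close>

lemma perturb_to_independent:
  fixes c :: "'i \<Rightarrow> 'a::euclidean_space"
  assumes "finite I" "0 < \<theta>"
  shows "\<exists>a. (\<forall>i\<in>I. dist (a i) (c i) < \<theta>) \<and> (\<forall>T\<subseteq>I. card T \<le> DIM('a) \<longrightarrow> inj_on a T \<and> independent (a ` T))"
  using assms(1)
proof (induction I rule: finite_induct)
  case empty
  then show ?case by (simp add: independent_empty)
next
  case (insert k I)
  then obtain a where a: "\<forall>i\<in>I. dist (a i) (c i) < \<theta>"
    "\<And>T. T \<subseteq> I \<Longrightarrow> card T \<le> DIM('a) \<Longrightarrow> inj_on a T \<and> independent (a ` T)" by blast
  let ?Bad = "\<Union>T\<in>{T. T \<subseteq> I \<and> card T < DIM('a)}. span (a ` T)"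
  have "negligible ?Bad"
  proof (rule negligible_Union)
    show "finite ((\<lambda>T. span (a ` T)) ` {T. T \<subseteq> I \<and> card T < DIM('a)})"
      by (rule finite_imageI, rule finite_subset[OF _ finite_Pow_iff[THEN iffD2, OF insert.hyps(1)]]) blast
    fix S assume "S \<in> (\<lambda>T. span (a ` T)) ` {T. T \<subseteq> I \<and> card T < DIM('a)}"
    then obtain T where T: "S = span (a ` T)" "T \<subseteq> I" "card T < DIM('a)" by blast
    have "finite T" using T insert.hyps(1) finite_subset by blast
    then have "dim S \<le> card T"
      using dim_le_card'[of "a ` T"] card_image_le[of T a] unfolding T(1) dim_span by force
    then show "negligible S" using T(3) by (intro negligible_lowdim) simp
  qed
  moreover have "\<not> negligible (ball (c k) \<theta>)"
    using assms(2) by (intro open_not_negligible) auto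
  ultimately have "\<not> ball (c k) \<theta> \<subseteq> ?Bad" using negligible_subset by blast
  then obtain v where "v \<in> ball (c k) \<theta>" and v2: "v \<notin> ?Bad" by (meson subsetI)
  then have v: "dist v (c k) < \<theta>" by (simp add: dist_commute)
  show ?case
  proof (intro exI[of _ "a(k := v)"] conjI ballI allI impI)
    fix i assume "i \<in> insert k I"
    then show "dist ((a(k := v)) i) (c i) < \<theta>" using a(1) v insert.hyps(2) by auto
  next
    fix T assume T: "T \<subseteq> insert k I" "card T \<le> DIM('a)"
    have fT: "finite T" using T insert.hyps(1) finite_subset by blast
    have "inj_on (a(k := v)) T \<and> independent ((a(k := v)) ` T)"
    proof (cases "k \<in> T")
      case False
      then have "T \<subseteq> I" using T by blast
      moreover have "inj_on (a(k := v)) T = inj_on a T" "(a(k := v)) ` T = a ` T"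
        using False by (auto simp: inj_on_def)
      ultimately show ?thesis using a(2) T by auto
    next
      case True
      define T' where "T' = T - {k}"
      have T': "T = insert k T'" "k \<notin> T'" "T' \<subseteq> I" using T True by (auto simp: T'_def)
      have "finite T'" using fT by (simp add: T'_def)
      then have "card T' < DIM('a)" using T(2) T'(1,2) by simp
      then have "inj_on a T'" "independent (a ` T')" "v \<notin> span (a ` T')"
        using a(2)[of T'] T'(3) v2 by auto
      moreover have "(a(k := v)) ` T = insert v (a ` T')"
        using T' by auto
      moreover have "inj_on (a(k := v)) T"
        unfolding T'(1) using calculation(1,3) T'(2) span_superset[of "a ` T'"]
        by (auto simp: inj_on_def)
      ultimately show ?thesis by (simp add: independent_insert)
    qed
    then show "inj_on (a(k := v)) T" "independent ((a(k := v)) ` T)" by auto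
  qed
qed

lemma cells_imp_ball_cover:
  fixes S :: "'a::metric_space set"
  assumes T: "finite T" "\<And>x. x \<in> S \<Longrightarrow> \<phi> x \<in> T"
    and same: "\<And>x z. x \<in> S \<Longrightarrow> z \<in> S \<Longrightarrow> \<phi> x = \<phi> z \<Longrightarrow> dist x z < r"
  shows "\<exists>C. finite C \<and> card C \<le> card T \<and> S \<subseteq> (\<Union>c\<in>C. ball c r)"
proof -
  let ?rep = "\<lambda>t. SOME x. x \<in> S \<and> \<phi> x = t"
  let ?C = "?rep ` (\<phi> ` S)"
  have sub: "\<phi> ` S \<subseteq> T" using T(2) by blast
  have fin: "finite (\<phi> ` S)" using finite_subset[OF sub T(1)] .
  have "card ?C \<le> card T"
    using card_image_le[OF fin, of ?rep] card_mono[OF T(1) sub] by linarith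
  moreover have "S \<subseteq> (\<Union>c\<in>?C. ball c r)"
  proof
    fix x assume x: "x \<in> S"
    have "?rep (\<phi> x) \<in> S \<and> \<phi> (?rep (\<phi> x)) = \<phi> x"
      using x by (intro someI[of "\<lambda>z. z \<in> S \<and> \<phi> z = \<phi> x" x]) auto
    then have "dist (?rep (\<phi> x)) x < r" using same x by blast
    then show "x \<in> (\<Union>c\<in>?C. ball c r)" using x by auto
  qed
  ultimately show ?thesis using fin by (intro exI[of _ ?C]) auto
qed

text \<open>Differences of points of the slice lie in the \<open>d\<close>-dimensional orthogonal
  complement of the \<open>v i\<close>. Rounding the coordinates in an orthonormal basis of it sorts
  the slice into cells. The summand 1 in the radius makes the distance bound strict, also for
  \<open>d = 0\<close>.\<close>

lemma affine_slice_ball_cover: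
  fixes v :: "'n::finite \<Rightarrow> 'a::euclidean_space"
  assumes v: "inj v" "independent (range v)" and R: "0 < R" and N: "0 < N" and d: "DIM('a) = d + CARD('n)"
  shows "\<exists>C. finite C \<and> card C \<le> (2 * N + 1) ^ d \<and>
     {x. norm x \<le> R \<and> (\<forall>i. v i \<bullet> x = b i)} \<subseteq> (\<Union>c\<in>C. ball c ((2 * real d * R + 1) / real N))"
proof (cases "{x. norm x \<le> R \<and> (\<forall>i. v i \<bullet> x = b i)} = {}")
  case True
  then show ?thesis by (intro exI[of _ "{}"]) auto
next
  case False
  let ?S = "{x. norm x \<le> R \<and> (\<forall>i. v i \<bullet> x = b i)}"
  from False obtain x0 where x0: "x0 \<in> ?S" by blast
  define V where "V = {y \<in> UNIV. \<forall>x\<in>span (range v). orthogonal x y}"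
  have "dim V + dim (span (range v)) = DIM('a)"
    unfolding V_def using dim_subspace_orthogonal_to_vectors[of "span (range v)" UNIV] by simp
  moreover have "dim (span (range v)) = CARD('n)"
    using v by (simp add: dim_span dim_eq_card_independent card_image)
  ultimately have dimV: "dim V = d" using d by simp
  have subV: "subspace V"
    unfolding V_def by (auto simp: subspace_def orthogonal_def inner_simps)
  obtain B where B: "B \<subseteq> V" "pairwise orthogonal B" "\<And>x. x \<in> B \<Longrightarrow> norm x = 1"
    "independent B" "card B = dim V" "span B = V"
    using orthonormal_basis_subspace[OF subV] by metis
  have fB: "finite B" using B(4) by (rule independent_imp_finite)
  have inV: "x - z \<in> V" if "x \<in> ?S" "z \<in> ?S" for x z
  proof -
    have "orthogonal (x - z) u" if "u \<in> span (range v)" for u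
      using that by (rule orthogonal_to_span) (use \<open>x \<in> ?S\<close> \<open>z \<in> ?S\<close> in \<open>auto simp: orthogonal_def inner_simps inner_commute\<close>)
    then show ?thesis by (simp add: V_def orthogonal_commute)
  qed
  \<comment> \<open>Coordinates relative to \<open>x0\<close> lie between \<open>- 2 * R\<close> and
    \<open>2 * R\<close>; in units of \<open>2 * R / N\<close> their floors take the
    \<open>2 * N + 1\<close> values from \<open>- N\<close> to \<open>N\<close>.\<close>
  define \<phi> where "\<phi> x = restrict (\<lambda>e. \<lfloor>real N * ((x - x0) \<bullet> e) / (2 * R)\<rfloor>) B" for x
  define T where "T = PiE B (\<lambda>_. {- int N .. int N})"
  have "card T = (2 * N + 1) ^ d"
    using fB B(5) dimV by (simp add: T_def card_PiE nat_add_distrib nat_mult_distrib)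
  moreover have "\<exists>C. finite C \<and> card C \<le> card T \<and> ?S \<subseteq> (\<Union>c\<in>C. ball c ((2 * real d * R + 1) / real N))"
  proof (rule cells_imp_ball_cover[where \<phi> = \<phi>])
    show "finite T" unfolding T_def using fB by (intro finite_PiE) auto
    show "\<phi> x \<in> T" if x: "x \<in> ?S" for x
    proof -
      have "- int N \<le> \<lfloor>real N * ((x - x0) \<bullet> e) / (2 * R)\<rfloor> \<and> \<lfloor>real N * ((x - x0) \<bullet> e) / (2 * R)\<rfloor> \<le> int N" if e: "e \<in> B" for e
      proof -
        have "\<bar>(x - x0) \<bullet> e\<bar> \<le> norm (x - x0) * norm e" by (rule Cauchy_Schwarz_ineq2)
        also have "\<dots> \<le> 2 * R" using B(3)[OF e] x x0 norm_triangle_ineq4[of x x0] by simp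
        finally have *: "\<bar>((x - x0) \<bullet> e) / (2 * R)\<bar> \<le> 1" using R by simp
        have "\<bar>real N * (((x - x0) \<bullet> e) / (2 * R))\<bar> \<le> real N * 1"
          unfolding abs_mult using * by (intro mult_mono) auto
        moreover have "real N * ((x - x0) \<bullet> e) / (2 * R) = real N * (((x - x0) \<bullet> e) / (2 * R))" by simp
        ultimately have "- real N \<le> real N * ((x - x0) \<bullet> e) / (2 * R)" "real N * ((x - x0) \<bullet> e) / (2 * R) \<le> real N"
          by linarith+
        then show ?thesis by linarith
      qed
      then show ?thesis by (auto simp: T_def \<phi>_def)
    qed
    show "dist x z < (2 * real d * R + 1) / real N" if x: "x \<in> ?S" and z: "z \<in> ?S" and eq: "\<phi> x = \<phi> z" for x z
    proof -
      have c: "\<bar>(x - z) \<bullet> e\<bar> \<le> 2 * R / real N" if e: "e \<in> B" for e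
      proof -
        have "\<lfloor>real N * ((x - x0) \<bullet> e) / (2 * R)\<rfloor> = \<lfloor>real N * ((z - x0) \<bullet> e) / (2 * R)\<rfloor>"
          using fun_cong[OF eq, of e] e by (simp add: \<phi>_def)
        then have "\<bar>real N * ((x - x0) \<bullet> e) / (2 * R) - real N * ((z - x0) \<bullet> e) / (2 * R)\<bar> \<le> 1"
          by linarith
        also have "real N * ((x - x0) \<bullet> e) / (2 * R) - real N * ((z - x0) \<bullet> e) / (2 * R) = real N / (2 * R) * ((x - z) \<bullet> e)"
          by (simp add: inner_diff_left algebra_simps diff_divide_distrib)
        finally have "real N / (2 * R) * \<bar>(x - z) \<bullet> e\<bar> \<le> 1" using R by (simp add: abs_mult)
        then show ?thesis using R N by (simp add: field_simps)
      qed
      have "x - z = (\<Sum>e\<in>B. ((x - z) \<bullet> e) *\<^sub>R e)"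
        using orthonormal_basis_expand[OF B(2,3) _ fB, of "x - z"] inV[OF x z] B(6) by simp
      then have "norm (x - z) \<le> (\<Sum>e\<in>B. norm (((x - z) \<bullet> e) *\<^sub>R e))" by (metis norm_sum)
      also have "\<dots> \<le> (\<Sum>e\<in>B. 2 * R / real N)"
        using c B(3) by (intro sum_mono) simp
      also have "\<dots> = 2 * real d * R / real N" using B(5) dimV by simp
      also have "\<dots> < (2 * real d * R + 1) / real N" using N by (intro divide_strict_right_mono) auto
      finally show ?thesis by (simp add: dist_norm)
    qed
  qed
  ultimately show ?thesis by simp
qed

text \<open>A number of balls of order \<open>N ^ d\<close>, each of radius \<open>A / N\<close>,
  costs in exponent \<open>s\<close> a multiple of \<open>N powr (d - s)\<close>, which tends to
  0.\<close>

lemma ball_coverable_of_count: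
  fixes S :: "'a::metric_space set"
  assumes A: "0 < A" and L: "0 \<le> L" and s: "real d < s" and e: "0 < e"
    and H: "\<And>N::nat. 0 < N \<Longrightarrow> \<exists>C. finite C \<and> real (card C) \<le> L * real ((2 * N + 1) ^ d) \<and>
       S \<subseteq> (\<Union>c\<in>C. ball c (A / real N))"
  shows "ball_coverable s e S"
proof -
  have lim1: "(\<lambda>N::nat. 2 * A * inverse (real N)) \<longlonglongrightarrow> 2 * A * 0"
    by (intro tendsto_intros lim_inverse_n)
  have lim2: "(\<lambda>N::nat. (L * 3 ^ d * (2 * A) powr s) * inverse (real N) powr (s - real d)) \<longlonglongrightarrow> (L * 3 ^ d * (2 * A) powr s) * 0"
    using s by (intro tendsto_intros tendsto_zero_powrI[OF lim_inverse_n tendsto_const]) auto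
  have "\<forall>\<^sub>F N in sequentially. 2 * A * inverse (real N) < e" using lim1 e by (intro order_tendstoD(2)) auto
  moreover have "\<forall>\<^sub>F N in sequentially. (L * 3 ^ d * (2 * A) powr s) * inverse (real N) powr (s - real d) < e"
    using lim2 e by (intro order_tendstoD(2)) auto
  moreover have "\<forall>\<^sub>F N in sequentially. (0::nat) < N" by (rule eventually_gt_at_top)
  ultimately have "\<forall>\<^sub>F N in sequentially. 0 < N \<and> 2 * A * inverse (real N) < e \<and>
      (L * 3 ^ d * (2 * A) powr s) * inverse (real N) powr (s - real d) < e"
    by eventually_elim auto
  then obtain N where N: "0 < N" "2 * A * inverse (real N) < e"
      "(L * 3 ^ d * (2 * A) powr s) * inverse (real N) powr (s - real d) < e"
    using eventually_happens'[OF sequentially_bot] by blast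
    obtain C where C: "finite C" "real (card C) \<le> L * real ((2 * N + 1) ^ d)" "S \<subseteq> (\<Union>c\<in>C. ball c (A / real N))"
      using H[OF N(1)] by blast
    have "real ((2 * N + 1) ^ d) \<le> real ((3 * N) ^ d)" using N(1) by (intro of_nat_mono power_mono) auto
    also have "\<dots> = 3 ^ d * real N powr real d" using N(1) by (simp add: power_mult_distrib powr_realpow)
    finally have n: "L * real ((2 * N + 1) ^ d) \<le> L * (3 ^ d * real N powr real d)" using L by (rule mult_left_mono)
    have "real (card C) * (2 * (A / real N)) powr s \<le> L * (3 ^ d * real N powr real d) * (2 * (A / real N)) powr s"
      using C(2) n by (intro mult_right_mono) auto
    also have "\<dots> = (L * 3 ^ d * (2 * A) powr s) * inverse (real N) powr (s - real d)"
      using A N(1) by (simp add: powr_divide powr_diff powr_mult inverse_eq_divide field_simps)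
    finally have "real (card C) * (2 * (A / real N)) powr s < e" using N(3) by linarith
    moreover have "2 * (A / real N) < e" using N(2) by (simp add: divide_inverse)
    ultimately show ?thesis
      unfolding ball_coverable_def using C(1,3) A N(1) by (intro exI[of _ C] exI[of _ "A / real N"]) auto
qed

lemma continuous_on_Max_image:
  fixes \<phi> :: "'i \<Rightarrow> 'a::topological_space \<Rightarrow> real"
  assumes "finite I" "I \<noteq> {}" "\<And>i. i \<in> I \<Longrightarrow> continuous_on S (\<phi> i)"
  shows "continuous_on S (\<lambda>x. Max ((\<lambda>i. \<phi> i x) ` I))"
  using assms
proof (induction I rule: finite_ne_induct)
  case (insert i I)
  have "Max ((\<lambda>i. \<phi> i x) ` insert i I) = max (\<phi> i x) (Max ((\<lambda>i. \<phi> i x) ` I))" for x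
    using insert.hyps by simp
  then show ?case using insert by (simp add: continuous_on_max)
qed simp

text \<open>By compactness a cover of one fiber also covers the preimage of a ball around
  \<open>y\<close>. A Lebesgue number of these balls over the compact image gives one
  \<open>\<delta>\<close> that works for all values simultaneously.\<close>

lemma ball_coverable_fibers_open:
  fixes g :: "real^'m \<Rightarrow> real^'n"
  assumes g: "continuous_on unit_cube g" and cov: "\<And>y. ball_coverable s e (g -` {y} \<inter> unit_cube)" and e: "0 < e"
  shows "\<exists>\<delta>>0. \<forall>h. (\<forall>x\<in>unit_cube. dist (g x) (h x) \<le> \<delta>) \<longrightarrow> (\<forall>y. ball_coverable s e (h -` {y} \<inter> unit_cube))"
proof -
  let ?K = "unit_cube :: (real^'m) set"
  have mono: "ball_coverable s e A" if "ball_coverable s e B" "A \<subseteq> B" for A B :: "(real^'m) set"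
    using that unfolding ball_coverable_def by (meson order_trans)
  have "\<exists>r>0. ball_coverable s e (g -` ball y r \<inter> ?K)" for y
  proof -
    obtain C r where C: "finite C" "0 < r" "g -` {y} \<inter> ?K \<subseteq> (\<Union>c\<in>C. ball c r)" "2 * r < e" "real (card C) * (2 * r) powr s < e"
      using cov[of y] unfolding ball_coverable_def by blast
    let ?W = "\<Union>c\<in>C. ball c r"
    have "compact (g ` (?K - ?W))"
      by (intro compact_continuous_image continuous_on_subset[OF g] compact_diff compact_cbox) auto
    moreover have "y \<notin> g ` (?K - ?W)" using C(3) by blast
    ultimately obtain \<rho> where \<rho>: "\<rho> > 0" "\<And>w. w \<in> g ` (?K - ?W) \<Longrightarrow> \<rho> \<le> dist y w"
      using separate_point_closed[OF compact_imp_closed] by metis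
    have "g -` ball y \<rho> \<inter> ?K \<subseteq> ?W"
    proof
      fix x assume x: "x \<in> g -` ball y \<rho> \<inter> ?K"
      show "x \<in> ?W"
      proof (rule ccontr)
        assume "x \<notin> ?W"
        then have "\<rho> \<le> dist y (g x)" using x \<rho>(2) by blast
        then show False using x by simp
      qed
    qed
    then have "ball_coverable s e (g -` ball y \<rho> \<inter> ?K)"
      unfolding ball_coverable_def using C by blast
    then show ?thesis using \<rho>(1) by blast
  qed
  then obtain r where r: "\<And>y. 0 < r y" "\<And>y. ball_coverable s e (g -` ball y (r y) \<inter> ?K)" by metis
  have "compact (g ` ?K)" by (intro compact_continuous_image g compact_cbox)
  then obtain \<eta> where \<eta>: "0 < \<eta>" "\<And>z. z \<in> g ` ?K \<Longrightarrow> \<exists>G\<in>range (\<lambda>y. ball y (r y)). ball z \<eta> \<subseteq> G"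
    by (rule Heine_Borel_lemma[of "g ` ?K" "range (\<lambda>y. ball y (r y))"]) (use r(1) in \<open>auto intro!: UN_I centre_in_ball[THEN iffD2]\<close>)
  show ?thesis
  proof (intro exI[of _ "\<eta>/3"] conjI allI impI)
    fix h :: "real^'m \<Rightarrow> real^'n" and y assume h: "\<forall>x\<in>?K. dist (g x) (h x) \<le> \<eta>/3"
    show "ball_coverable s e (h -` {y} \<inter> ?K)"
    proof (cases "h -` {y} \<inter> ?K = {}")
      case True
      then show ?thesis unfolding ball_coverable_def using e by (intro exI[of _ "{}"] exI[of _ "e/3"]) auto
    next
      case False
      then obtain x0 where x0: "x0 \<in> ?K" "h x0 = y" by blast
      then obtain y' where y': "ball (g x0) \<eta> \<subseteq> ball y' (r y')" using \<eta>(2) by blast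
      have "h -` {y} \<inter> ?K \<subseteq> g -` ball y' (r y') \<inter> ?K"
      proof
        fix x assume x: "x \<in> h -` {y} \<inter> ?K"
        have "dist (g x0) (g x) \<le> dist (g x0) y + dist (g x) y" by (rule dist_triangle2)
        also have "\<dots> \<le> \<eta>/3 + \<eta>/3" using h x0 x by (intro add_mono) auto
        finally have "g x \<in> ball (g x0) \<eta>" using \<eta>(1) by simp
        then show "x \<in> g -` ball y' (r y') \<inter> ?K" using y' x by blast
      qed
      then show ?thesis using mono r(2) by blast
    qed
  qed (use \<eta> in auto)
qed

text \<open>Max-min combinations of affine functions whose gradients, for different components, are in
  general position: each fiber lies in finitely many affine subspaces of dimension \<open>m - n\<close>.\<close>

lemma thin_fibers_dense:
  fixes f :: "real^'m \<Rightarrow> real^'n"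
  assumes mn: "CARD('n) \<le> CARD('m)" and f: "continuous_on unit_cube f" and \<epsilon>: "0 < \<epsilon>"
    and s: "real (CARD('m) - CARD('n)) < s" and e: "0 < e"
  obtains g where "continuous_on unit_cube g" "\<And>x. x \<in> unit_cube \<Longrightarrow> dist (f x) (g x) \<le> \<epsilon>"
    "\<And>y. ball_coverable s e (g -` {y} \<inter> unit_cube)"
proof -
  let ?K = "unit_cube :: (real^'m) set"
  define n m where "n = real CARD('n)" and "m = real CARD('m)"
  have nm: "1 \<le> n" "1 \<le> m" by (auto simp: n_def m_def Suc_leI)
  \<comment> \<open>Signed unit vectors, one full set for each component \<open>i\<close>; their
    maximal inner product with \<open>z\<close> is the maximum norm of \<open>z\<close>. The
    perturbation \<open>a\<close> puts all of them, over all components, in general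
    position.\<close>
  define c :: "'n \<times> 'm \<times> bool \<Rightarrow> real^'m" where
    "c = (\<lambda>(i, j, b). if b then axis j 1 else - axis j 1)"
  obtain a where a: "\<And>\<kappa>. dist (a \<kappa>) (c \<kappa>) < 1 / (2 * m)"
    and ind: "\<And>T. card T \<le> DIM(real^'m) \<Longrightarrow> inj_on a T \<and> independent (a ` T)"
    using perturb_to_independent[of UNIV "1 / (2 * m)" c] nm by auto
  have normc: "norm (c \<kappa>) = 1" for \<kappa> by (cases \<kappa>) (auto simp: c_def norm_axis_1)
  \<comment> \<open>A polyhedral substitute for the norm, comparable to it by the bounds
    \<open>q_lower\<close> and \<open>q_upper\<close>.\<close>
  define q :: "'n \<Rightarrow> real^'m \<Rightarrow> real" where "q i z = Max ((\<lambda>\<sigma>. a (i, \<sigma>) \<bullet> z) ` UNIV)" for i z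
  have q_ge: "a (i, \<sigma>) \<bullet> z \<le> q i z" for i \<sigma> z unfolding q_def by (intro Max_ge) auto
  have q_ex: "\<exists>\<sigma>. q i z = a (i, \<sigma>) \<bullet> z" for i z
  proof -
    have "q i z \<in> (\<lambda>\<sigma>. a (i, \<sigma>) \<bullet> z) ` UNIV" unfolding q_def by (intro Max_in) auto
    then show ?thesis by blast
  qed
  have ac: "\<bar>(a \<kappa> - c \<kappa>) \<bullet> z\<bar> \<le> norm z / (2 * m)" for \<kappa> z
  proof -
    have "\<bar>(a \<kappa> - c \<kappa>) \<bullet> z\<bar> \<le> norm (a \<kappa> - c \<kappa>) * norm z" by (rule Cauchy_Schwarz_ineq2)
    also have "\<dots> \<le> 1 / (2 * m) * norm z" using a[of \<kappa>] by (intro mult_right_mono) (auto simp: dist_norm)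
    finally show ?thesis by simp
  qed
  have q_lower: "norm z / (2 * m) \<le> q i z" for i z
  proof -
    have "\<exists>j. norm z / m \<le> \<bar>z $ j\<bar>"
    proof (rule ccontr)
      assume "\<nexists>j. norm z / m \<le> \<bar>z $ j\<bar>"
      then have "(\<Sum>j\<in>UNIV. \<bar>z $ j\<bar>) < (\<Sum>j\<in>(UNIV::'m set). norm z / m)"
        by (intro sum_strict_mono) (auto simp: not_le)
      also have "\<dots> = norm z" using nm by (simp add: m_def)
      finally show False using norm_le_l1_cart[of z] by simp
    qed
    then obtain j where j: "norm z / m \<le> \<bar>z $ j\<bar>" by blast
    have "c (i, j, 0 \<le> z $ j) \<bullet> z = \<bar>z $ j\<bar>" by (auto simp: c_def inner_axis' )
    then have "norm z / m - norm z / (2 * m) \<le> a (i, j, 0 \<le> z $ j) \<bullet> z"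
      using ac[of "(i, j, 0 \<le> z $ j)" z] j by (simp add: inner_diff_left abs_le_iff)
    also have "\<dots> \<le> q i z" by (rule q_ge)
    finally show ?thesis using nm by (simp add: field_simps)
  qed
  have q_upper: "q i z \<le> 2 * norm z" for i z
  proof -
    obtain \<sigma> where \<sigma>: "q i z = a (i, \<sigma>) \<bullet> z" using q_ex by blast
    have "c (i, \<sigma>) \<bullet> z \<le> norm z" using norm_cauchy_schwarz[of "c (i, \<sigma>)" z] normc by simp
    moreover have "norm z / (2 * m) \<le> norm z" using nm by (simp add: divide_le_eq mult_le_cancel_left1)
    ultimately show ?thesis using ac[of "(i, \<sigma>)" z] \<sigma> by (simp add: inner_diff_left abs_le_iff)
  qed
  have "bounded (f ` ?K)" using f by (intro compact_imp_bounded compact_continuous_image compact_cbox)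
  then obtain R0 where R0: "0 < R0" "\<And>x. x \<in> ?K \<Longrightarrow> norm (f x) \<le> R0" by (auto simp: bounded_pos)
  have fR: "\<bar>f x $ i\<bar> \<le> R0" if "x \<in> ?K" for x i
    using component_le_norm_cart[of "f x" i] R0(2)[OF that] by linarith
  define \<epsilon>1 where "\<epsilon>1 = \<epsilon> / (2 * n)"
  have \<epsilon>1: "0 < \<epsilon>1" using \<epsilon> nm by (simp add: \<epsilon>1_def)
  have "uniformly_continuous_on ?K f" using f by (intro compact_uniformly_continuous compact_cbox)
  then obtain \<rho> where \<rho>: "0 < \<rho>" "\<And>x z. x \<in> ?K \<Longrightarrow> z \<in> ?K \<Longrightarrow> dist z x < \<rho> \<Longrightarrow> dist (f z) (f x) < \<epsilon>1"
    unfolding uniformly_continuous_on_def using \<epsilon>1 by metis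
  have \<rho>i: "\<bar>f z $ i - f x $ i\<bar> < \<epsilon>1" if "x \<in> ?K" "z \<in> ?K" "dist z x < \<rho>" for x z i
    using component_le_norm_cart[of "f z - f x" i] \<rho>(2)[OF that] by (simp add: dist_norm)
  \<comment> \<open>The slope is so steep that at distance \<open>\<rho>\<close> the cone has fallen
    by at least \<open>2 * R0\<close>, the largest possible difference between values of a
    component; far centres thus never push the maximum above \<open>f\<close>.\<close>
  define M where "M = 4 * m * R0 / \<rho>"
  have M: "0 < M" using R0 \<rho> nm by (simp add: M_def)
  define \<tau> where "\<tau> = min \<rho> (\<epsilon>1 / (2 * M))"
  have \<tau>: "0 < \<tau>" "\<tau> \<le> \<rho>" "M * (2 * \<tau>) \<le> \<epsilon>1"
  proof -
    show "0 < \<tau>" "\<tau> \<le> \<rho>" using \<rho> \<epsilon>1 M by (auto simp: \<tau>_def)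
    have "M * (2 * \<tau>) \<le> M * (2 * (\<epsilon>1 / (2 * M)))" using M by (intro mult_left_mono) (auto simp: \<tau>_def)
    then show "M * (2 * \<tau>) \<le> \<epsilon>1" using M by simp
  qed
  obtain Q where Q: "finite Q" "Q \<subseteq> ?K" "?K \<subseteq> (\<Union>p\<in>Q. ball p \<tau>)"
    using compactE_image[of ?K ?K "\<lambda>p. ball p \<tau>"] \<tau>(1) compact_cbox[of 0 "1::real^'m"]
    by (metis (no_types, lifting) UN_I centre_in_ball open_ball subsetI)
  have Qne: "Q \<noteq> {}" using Q(3) unit_cube_nonempty by auto
  \<comment> \<open>Polyhedral cones with apex on the graph of each component of \<open>f\<close>;
    their upper envelope over the net \<open>Q\<close> approximates it. At a net point within
    \<open>\<tau>\<close> of \<open>x\<close> the cone has fallen by at most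
    \<open>\<epsilon>1\<close>.\<close>
  define \<phi> where "\<phi> i p x = f p $ i - M * q i (x - p)" for i p x
  define g where "g x = (\<chi> i. Max ((\<lambda>p. \<phi> i p x) ` Q))" for x
  have cont_q: "continuous_on UNIV (q i)" for i
    unfolding q_def by (intro continuous_on_Max_image continuous_intros) auto
  have cont_g: "continuous_on ?K g"
    unfolding g_def
  proof (intro continuous_on_vec_lambda continuous_on_Max_image Q(1) Qne)
    fix i p
    have "continuous_on ?K (\<lambda>x. q i (x - p))"
      by (rule continuous_on_compose2[OF cont_q]) (auto intro!: continuous_intros)
    then show "continuous_on ?K (\<phi> i p)" unfolding \<phi>_def by (intro continuous_intros)
  qed
  have gi: "\<bar>f x $ i - g x $ i\<bar> \<le> 2 * \<epsilon>1" if x: "x \<in> ?K" for x i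
  proof -
    have "g x $ i \<le> f x $ i + \<epsilon>1"
    proof -
      have "\<phi> i p x \<le> f x $ i + \<epsilon>1" if p: "p \<in> Q" for p
      proof (cases "dist p x < \<rho>")
        case True
        have "0 \<le> norm (x - p) / (2 * m)" using nm by simp
        then have "0 \<le> M * q i (x - p)" using M q_lower[of "x - p" i] by (intro mult_nonneg_nonneg) auto
        then show ?thesis using \<rho>i[of x p i] x p Q(2) True unfolding \<phi>_def by (smt (verit) subsetD)
      next
        case False
        have "2 * R0 = M * (\<rho> / (2 * m))" using \<rho>(1) nm by (simp add: M_def)
        also have "\<dots> \<le> M * q i (x - p)"
        proof (intro mult_left_mono)
          have "\<rho> / (2 * m) \<le> norm (x - p) / (2 * m)"
            using False nm by (intro divide_right_mono) (auto simp: dist_norm norm_minus_commute)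
          then show "\<rho> / (2 * m) \<le> q i (x - p)" using q_lower[of "x - p" i] by linarith
        qed (use M in auto)
        finally show ?thesis using fR[of p i] fR[of x i] x p Q(2) \<epsilon>1 unfolding \<phi>_def by (smt (verit) subsetD)
      qed
      then show ?thesis unfolding g_def using Q(1) Qne by (auto simp: Max_le_iff)
    qed
    moreover have "f x $ i - 2 * \<epsilon>1 \<le> g x $ i"
    proof -
      obtain p where p: "p \<in> Q" "dist p x < \<tau>" using Q(3) x by auto
      have "q i (x - p) \<le> 2 * \<tau>" using q_upper[of i "x - p"] p(2) by (simp add: dist_norm norm_minus_commute)
      then have "M * q i (x - p) \<le> M * (2 * \<tau>)" using M by (intro mult_left_mono) auto
      then have "f x $ i - 2 * \<epsilon>1 \<le> \<phi> i p x"
        using \<tau>(2,3) p \<rho>i[of x p i] x Q(2) unfolding \<phi>_def by (smt (verit) subsetD)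
      also have "\<dots> \<le> g x $ i" unfolding g_def using Q(1) p(1) by simp
      finally show ?thesis .
    qed
    ultimately show ?thesis using \<epsilon>1 by linarith
  qed
  have dist_g: "dist (f x) (g x) \<le> \<epsilon>" if x: "x \<in> ?K" for x
  proof -
    have "norm (f x - g x) \<le> (\<Sum>i\<in>UNIV. \<bar>(f x - g x) $ i\<bar>)" by (rule norm_le_l1_cart)
    also have "\<dots> \<le> (\<Sum>i\<in>(UNIV::'n set). 2 * \<epsilon>1)" using gi[OF x] by (intro sum_mono) simp
    also have "\<dots> = \<epsilon>" using nm by (simp add: \<epsilon>1_def n_def)
    finally show ?thesis by (simp add: dist_norm)
  qed
  define d where "d = CARD('m) - CARD('n)"
  define T where "T = PiE (UNIV::'n set) (\<lambda>_. Q \<times> (UNIV :: ('m \<times> bool) set))"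
  have fT: "finite T" unfolding T_def using Q(1) by (intro finite_PiE) auto
  obtain R where R: "0 < R" "\<And>x. x \<in> ?K \<Longrightarrow> norm x \<le> R"
    using bounded_cbox[of 0 "1::real^'m"] by (auto simp: bounded_pos)
  \<comment> \<open>For every component \<open>i\<close>, \<open>t i\<close> records a net point
    attaining the outer maximum and the index of an affine function active there. This turns
    \<open>g x = y\<close> into \<open>n\<close> linear equations.\<close>
  let ?slice = "\<lambda>y t. {x. norm x \<le> R \<and> (\<forall>i. a (i, snd (t i)) \<bullet> x = (f (fst (t i)) $ i - y $ i) / M + a (i, snd (t i)) \<bullet> fst (t i))}"
  have fiber: "g -` {y} \<inter> ?K \<subseteq> (\<Union>t\<in>T. ?slice y t)" for y
  proof
    fix x assume x: "x \<in> g -` {y} \<inter> ?K"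
    have "\<exists>p\<sigma>. p\<sigma> \<in> Q \<times> UNIV \<and> a (i, snd p\<sigma>) \<bullet> x = (f (fst p\<sigma>) $ i - y $ i) / M + a (i, snd p\<sigma>) \<bullet> fst p\<sigma>" for i
    proof -
      have "g x $ i \<in> (\<lambda>p. \<phi> i p x) ` Q" unfolding g_def using Q(1) Qne by (simp add: Max_in)
      then obtain p where p: "p \<in> Q" "g x $ i = \<phi> i p x" by blast
      obtain \<sigma> where \<sigma>: "q i (x - p) = a (i, \<sigma>) \<bullet> (x - p)" using q_ex by blast
      have "y $ i = f p $ i - M * (a (i, \<sigma>) \<bullet> (x - p))" using p(2) x \<sigma> by (auto simp: \<phi>_def)
      then have "a (i, \<sigma>) \<bullet> (x - p) = (f p $ i - y $ i) / M" using M by (simp add: field_simps)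
      then have "a (i, \<sigma>) \<bullet> x = (f p $ i - y $ i) / M + a (i, \<sigma>) \<bullet> p" by (simp add: inner_diff_right)
      then show ?thesis using p(1) by (intro exI[of _ "(p, \<sigma>)"]) auto
    qed
    then obtain t where "\<And>i. t i \<in> Q \<times> UNIV \<and> a (i, snd (t i)) \<bullet> x = (f (fst (t i)) $ i - y $ i) / M + a (i, snd (t i)) \<bullet> fst (t i)"
      by metis
    then show "x \<in> (\<Union>t\<in>T. ?slice y t)" using R(2) x by (intro UN_I[of t]) (auto simp: T_def PiE_iff)
  qed
  define A where "A = 2 * real d * R + 1"
  have A: "0 < A" using R(1) by (simp add: A_def add_nonneg_pos)
  have count: "\<exists>C. finite C \<and> real (card C) \<le> real (card T) * real ((2 * N + 1) ^ d) \<and>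
      g -` {y} \<inter> ?K \<subseteq> (\<Union>c\<in>C. ball c (A / real N))" if N: "0 < N" for y N
  proof -
    have "\<exists>C. finite C \<and> card C \<le> (2 * N + 1) ^ d \<and> ?slice y t \<subseteq> (\<Union>c\<in>C. ball c (A / real N))" for t
      unfolding A_def
    proof (rule affine_slice_ball_cover)
      let ?v = "\<lambda>i. a (i, snd (t i))" and ?I = "range (\<lambda>i. (i, snd (t i)))"
      \<comment> \<open>The \<open>n\<close> gradients belong to different components, so their
        indices are distinct and general position makes them independent.\<close>
      have "inj (\<lambda>i. (i, snd (t i)))" by (auto simp: inj_def)
      then have "card ?I = CARD('n)" by (rule card_image)
      then have "inj_on a ?I" "independent (a ` ?I)" using ind[of ?I] mn by auto
      then show "inj ?v" "independent (range ?v)"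
        by (auto simp: inj_on_def image_image)
    qed (use R N mn in \<open>auto simp: d_def\<close>)
    then have "\<exists>C. \<forall>t. finite (C t) \<and> card (C t) \<le> (2 * N + 1) ^ d \<and> ?slice y t \<subseteq> (\<Union>c\<in>C t. ball c (A / real N))"
      by (intro choice allI)
    then obtain C where C0: "\<forall>t. finite (C t) \<and> card (C t) \<le> (2 * N + 1) ^ d \<and> ?slice y t \<subseteq> (\<Union>c\<in>C t. ball c (A / real N))"
      by (elim exE) (rule that)
    note C = C0[THEN spec, THEN conjunct1] C0[THEN spec, THEN conjunct2, THEN conjunct1]
      C0[THEN spec, THEN conjunct2, THEN conjunct2]
    have "card (\<Union>t\<in>T. C t) \<le> (\<Sum>t\<in>T. card (C t))" by (rule card_UN_le[OF fT])
    also have "\<dots> \<le> card T * (2 * N + 1) ^ d" using C(2) sum_bounded_above[of T "\<lambda>t. card (C t)"] by simp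
    finally have "real (card (\<Union>t\<in>T. C t)) \<le> real (card T) * real ((2 * N + 1) ^ d)"
      by (metis of_nat_le_iff of_nat_mult)
    moreover have "g -` {y} \<inter> ?K \<subseteq> (\<Union>c\<in>(\<Union>t\<in>T. C t). ball c (A / real N))"
      using fiber[of y] C(3) by blast
    ultimately show ?thesis using fT C(1) by (intro exI[of _ "\<Union>t\<in>T. C t"]) auto
  qed
  have "ball_coverable s e (g -` {y} \<inter> ?K)" for y
    by (rule ball_coverable_of_count[OF A _ s[folded d_def] e, of "real (card T)"]) (use count in auto)
  then show thesis using that cont_g dist_g by blast
qed

section \<open>The generic fiber\<close>

theorem corollary5p4:
  assumes "CARD('n::finite) \<le> CARD('m::finite)"
  shows "comeager_in (mtopology_of (cube_maps :: (real ^ 'm \<Rightarrow> real ^ 'n) metric))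
    {f \<in> mspace cube_maps. \<forall>y \<in> interior (f ` unit_cube).
       top_dim (top_of_set (f -` {y} \<inter> unit_cube)) = ereal (real CARD('m) - real CARD('n)) \<and>
       hausdorff_dim (f -` {y} \<inter> unit_cube) = ereal (real CARD('m) - real CARD('n)) \<and>
       packing_dim (f -` {y} \<inter> unit_cube) = ereal (real CARD('m))}"
proof -
  obtain \<iota> :: "'n \<Rightarrow> 'm" where \<iota>: "inj \<iota>"
    using assms inj_on_iff_card_le[of "UNIV :: 'n set" "UNIV :: 'm set"] by auto
  define d where "d = CARD('m) - CARD('n)"
  have d: "real d = real CARD('m) - real CARD('n)" "int d = int CARD('m) - int CARD('n)"
    using assms by (simp_all add: d_def of_nat_diff)
  obtain D :: "(real^'n) set" where D: "countable D" "\<And>X. open X \<Longrightarrow> X \<noteq> {} \<Longrightarrow> \<exists>q\<in>D. q \<in> X"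
    using countable_dense_setE[where ?'a = "real^'n"] by blast
  define P1 :: "nat \<Rightarrow> (real^'m \<Rightarrow> real^'n) \<Rightarrow> bool" where
    "P1 j f \<longleftrightarrow> (\<forall>y. ball_coverable (real d + 1 / real (Suc j)) (1 / real (Suc j)) (f -` {y} \<inter> unit_cube))" for j f
  define P2 :: "real^'n \<Rightarrow> nat \<Rightarrow> (real^'m \<Rightarrow> real^'n) \<Rightarrow> bool" where
    "P2 q j f \<longleftrightarrow> (cball q (1 / real (Suc j)) \<subseteq> f ` unit_cube \<longrightarrow>
       (\<exists>\<epsilon>>0. \<forall>h. continuous_on unit_cube h \<longrightarrow> (\<forall>x\<in>unit_cube. dist (h x) (f x) \<le> \<epsilon>) \<longrightarrow>
          cball q (1 / real (Suc j)) \<subseteq> h ` unit_cube))" for q j f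
  \<comment> \<open>One countable index set carries all three families: \<open>Some q\<close> for
    stable covering of balls around \<open>q\<close>, and \<open>None\<close> with a flag for thin
    fibers or oscillation.\<close>
  let ?I = "(Some ` D \<union> {None}) \<times> (UNIV :: (nat \<times> bool) set)"
  define P where "P i f = (case i of (Some q, j, _) \<Rightarrow> P2 q j f | (None, j, True) \<Rightarrow> P1 j f
      | (None, j, False) \<Rightarrow> oscillates \<iota> (Suc j) f)" for i f
  show ?thesis
  proof (rule comeager_in_cube_maps[where I = ?I and P = P])
    show "countable ?I" using D(1) by (intro countable_SIGMA) auto
  next
    fix i and f :: "real^'m \<Rightarrow> real^'n" and \<epsilon> :: real
    assume i: "i \<in> ?I" and f: "continuous_on unit_cube f" and \<epsilon>: "0 < \<epsilon>"
    obtain u j b where ujb: "i = (u, j, b)" by (cases i) auto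
    show "\<exists>g \<delta>. 0 < \<delta> \<and> continuous_on unit_cube g \<and> (\<forall>x\<in>unit_cube. dist (f x) (g x) \<le> \<epsilon>) \<and>
        (\<forall>h. continuous_on unit_cube h \<longrightarrow> (\<forall>x\<in>unit_cube. dist (g x) (h x) \<le> \<delta>) \<longrightarrow> P i h)"
    proof (cases u)
      case (Some q)
      then have "P i = P2 q j" by (simp add: P_def ujb fun_eq_iff)
      then show ?thesis using stably_covers_dense[OF f \<epsilon>, of q "1 / real (Suc j)"] unfolding P2_def by simp
    next
      case None
      show ?thesis
      proof (cases b)
        case True
        then have Pi: "P i = P1 j" using None by (simp add: P_def ujb fun_eq_iff)
        obtain g where g: "continuous_on unit_cube g" "\<And>x. x \<in> unit_cube \<Longrightarrow> dist (f x) (g x) \<le> \<epsilon>"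
          "\<And>y. ball_coverable (real d + 1 / real (Suc j)) (1 / real (Suc j)) (g -` {y} \<inter> unit_cube)"
          using thin_fibers_dense[OF assms f \<epsilon>, of "real d + 1 / real (Suc j)" "1 / real (Suc j)"]
          by (auto simp: d_def)
        obtain \<delta> where "\<delta> > 0" "\<And>h. (\<forall>x\<in>unit_cube. dist (g x) (h x) \<le> \<delta>) \<Longrightarrow>
            (\<forall>y. ball_coverable (real d + 1 / real (Suc j)) (1 / real (Suc j)) (h -` {y} \<inter> unit_cube))"
          using ball_coverable_fibers_open[OF g(1,3)] by auto
        then show ?thesis using g(1,2) unfolding Pi P1_def by blast
      next
        case False
        then have "P i = oscillates \<iota> (Suc j)" using None by (simp add: P_def ujb fun_eq_iff)
        then show ?thesis using oscillates_dense[OF f \<epsilon>, of "Suc j" \<iota>] by simp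
      qed
    qed
  next
    fix f :: "real^'m \<Rightarrow> real^'n"
    assume f: "continuous_on unit_cube f" and Pf: "\<And>i. i \<in> ?I \<Longrightarrow> P i f"
    have cov: "ball_coverable (real d + 1 / real (Suc j)) (1 / real (Suc j)) (f -` {y} \<inter> unit_cube)" for j y
      using Pf[of "(None, j, True)"] by (simp add: P_def P1_def)
    have osc: "\<forall>k>0. oscillates \<iota> k f"
    proof (intro allI impI)
      fix k :: nat assume "0 < k"
      then obtain j where "k = Suc j" by (cases k) auto
      then show "oscillates \<iota> k f" using Pf[of "(None, j, False)"] by (simp add: P_def)
    qed
    show "\<forall>y \<in> interior (f ` unit_cube).
       top_dim (top_of_set (f -` {y} \<inter> unit_cube)) = ereal (real CARD('m) - real CARD('n)) \<and>
       hausdorff_dim (f -` {y} \<inter> unit_cube) = ereal (real CARD('m) - real CARD('n)) \<and>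
       packing_dim (f -` {y} \<inter> unit_cube) = ereal (real CARD('m))"
    proof
      fix y assume "y \<in> interior (f ` unit_cube)"
      then obtain e where e: "0 < e" "ball y e \<subseteq> f ` unit_cube" by (auto simp: mem_interior)
      let ?F = "f -` {y} \<inter> unit_cube"
      \<comment> \<open>A ball centred in \<open>D\<close> that contains \<open>y\<close> and fits
        inside the image is covered stably, and this makes \<open>y\<close> stable.\<close>
      have st: "stable_value f y unit_cube"
      proof -
        obtain j :: nat where j: "1 / real (Suc j) < e / 2" using e(1) nat_approx_posE[of "e/2"] by auto
        obtain q where q: "q \<in> D" "dist y q < 1 / real (Suc j)"
          using D(2)[of "ball y (1 / real (Suc j))"] by auto
        have "cball q (1 / real (Suc j)) \<subseteq> ball y e"
        proof
          fix z assume "z \<in> cball q (1 / real (Suc j))"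
          then show "z \<in> ball y e" using j q(2) dist_triangle[of y z q] by simp
        qed
        moreover have "P2 q j f" using Pf[of "(Some q, j, True)"] q(1) by (simp add: P_def)
        moreover have "y \<in> cball q (1 / real (Suc j))" using q(2) by (simp add: dist_commute)
        ultimately show ?thesis unfolding P2_def stable_value_def using e(2) by (meson order_trans subsetD)
      qed
      have F: "compact ?F"
        using continuous_closed_preimage[OF f, of "{y}"] by (metis Int_commute closed_cbox closed_singleton compact_Int_closed compact_cbox inf.right_idem)
      \<comment> \<open>A single crossed cube suffices for the lower bound.\<close>
      have "\<not> top_of_set ?F dim_le (int d - 1)"
      proof -
        obtain k h C x where C: "0 < h" "C \<noteq> {}" "\<forall>a\<in>C. crosses \<iota> f y a h"
          "\<forall>a\<in>C. cbox a (a + h *\<^sub>R 1) \<subseteq> unit_cube \<inter> ball x (1 / real k)"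
          using oscillates_stable_value[OF osc order_refl st, of 0] by metis
        then obtain a where a: "crosses \<iota> f y a h" "cbox a (a + h *\<^sub>R 1) \<subseteq> unit_cube" by blast
        have "{x \<in> cbox a (a + h *\<^sub>R 1). f x = y} \<subseteq> ?F" using a(2) by auto
        then show ?thesis
          using crosses_not_dim_le[OF \<iota> C(1) a(1) continuous_on_subset[OF f a(2)] F] d(2) by simp
      qed
      moreover have "hausdorff_measure t ?F = 0" if t: "real d < t" for t
      proof (rule ball_coverable_imp_hausdorff_measure_eq_0)
        show "0 < t" using t by linarith
        fix e :: real assume "0 < e"
        \<comment> \<open>For large \<open>j\<close> the exponent
          \<open>real d + 1 / real (Suc j)\<close> drops below \<open>t\<close> and the cover bound
          below \<open>e\<close>.\<close>
        then obtain j :: nat where j: "1 / real (Suc j) < min e (t - real d)"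
          using t nat_approx_posE[of "min e (t - real d)"] by auto
        have "ball_coverable (real d + 1 / real (Suc j)) e ?F"
          using cov[of j y] j unfolding ball_coverable_def by (meson less_trans min_less_iff_conj)
        then show "\<exists>s\<le>t. ball_coverable s e ?F"
          using j by (intro exI[of _ "real d + 1 / real (Suc j)"]) auto
      qed
      ultimately show "top_dim (top_of_set ?F) = ereal (real CARD('m) - real CARD('n)) \<and>
          hausdorff_dim ?F = ereal (real CARD('m) - real CARD('n)) \<and> packing_dim ?F = ereal (real CARD('m))"
        using top_dim_hausdorff_dim_eq[of d ?F] packing_dim_fiber[OF \<iota> osc f st] d(1) by simp
    qed
  qed
qed

end
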